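(* Let $m\in\mathbb{N}$ and let $E\subset\mathbb{R}$ be a closed set with $\#E\ge m+1$. Let $\mathrm{Ext}_E$ be the Whitney-type extension operator defined in the context (its definition does not involve $p$). Then there is a constant $C=C(m)$ depending only on $m$ such that for every $p\in(1,\infty]$ the operator $\mathrm{Ext}_E$ is well defined on the trace space $L^m_p(\mathbb{R})|_E$, maps it linearly into $L^m_p(\mathbb{R})$, and for every $f\in L^m_p(\mathbb{R})|_E$ satisfies $$(\mathrm{Ext}_E f)|_E=f\qquad\text{and}\qquad \|\mathrm{Ext}_E f\|_{L^m_p(\mathbb{R})}\le C\,\|f\|_{L^m_p(\mathbb{R})|_E}.$$
   Context: Spaces. For $p\in(1,\infty]$, $L^m_p(\mathbb{R})$ is the space of all $F:\mathbb{R}\to\mathbb{R}$ with $F^{(m-1)}$ absolutely continuous on $\mathbb{R}$ and weak derivative $F^{(m)}\in L_p(\mathbb{R})$, with seminorm $\|F\|_{L^m_p(\mathbb{R})}=\|F^{(m)}\|_{L_p(\mathbb{R})}$. The trace space $L^m_p(\mathbb{R})|_E$ consists of all $f:E\to\mathbb{R}$ having an extension in $L^m_p(\mathbb{R})$, with seminorm $\|f\|_{L^m_p(\mathbb{R})|_E}=\inf\{\|F\|_{L^m_p(\mathbb{R})}:F\in L^m_p(\mathbb{R}),F|_E=f\}$. $\mathcal{P}_k$ is the space of polynomials on $\mathbb{R}$ of degree at most $k$; $L_S[f]$ is the Lagrange polynomial of degree at most $\#S-1$ interpolating $f$ on the finite set $S$. The notation $S\to x$ means $\mathrm{diam}(S\cup\{x\})\to0$.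 Step 1 (knots). For a nonempty finite $A\subset E$, $A\ne E$, containing at most one limit point of $E$, define $a_E(A)\in E$: if $A$ contains no limit point of $E$, $a_E(A)$ is a point of $E\setminus A$ nearest to $A$ (one fixed choice for each $A$); if $A$ contains a (unique) limit point $a$ of $E$, $a_E(A)=a$. For $x\in E$ put $y_0(x)=x$, $Y_0(x)=\{x\}$. Inductively for $j=0,1,\dots$: if $j=m-1$ or $y_j(x)$ is a limit point of $E$, put $n(x)=j$ and stop; otherwise put $y_{j+1}(x)=a_E(Y_j(x))$ and $Y_{j+1}(x)=Y_j(x)\cup\{y_{j+1}(x)\}$. Let $S_x=\{y_0(x),\dots,y_{n(x)}(x)\}$ and $s_x=y_{n(x)}(x)$. Step 2 (jets). Given $f$ on $E$, define $P_x\in\mathcal{P}_{m-1}$ for each $x\in E$: if $\#S_x=m$, $P_x=L_{S_x}[f]$; if $\#S_x<m$ (then $s_x$ is a limit point of $E$), $P_x$ is the Hermite polynomial in $\mathcal{P}_{m-1}$ with $P_x(y)=f(y)$ for all $y\in S_x$ and $P_x^{(i)}(s_x)=f_i(s_x)$ for $1\le i\le m-\#S_x$, where $f_i(s_x)=\lim L_S^{(i)}[f](s_x)$ as $S\to s_x$, $S\subset E$, $\#S=m$. Step 3 (extension). Write $\mathbb{R}\setminus E$ as the disjoint union of a family $\mathcal{J}_E$ of open intervals (with endpoints in $E\cup\{\pm\infty\}$). For $J=(a,b)\in\mathcal{J}_E$: if $J=(-\infty,b)$ let $H_J=P_b$; if $J=(a,+\infty)$ let $H_J=P_a$; if $J$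 is bounded let $H_J\in\mathcal{P}_{2m-1}$ be the Hermite polynomial with $H_J^{(i)}(a)=P_a^{(i)}(a)$ and $H_J^{(i)}(b)=P_b^{(i)}(b)$ for $i=0,\dots,m-1$. Define $\mathrm{Ext}_E f(x)=P_x(x)$ for $x\in E$ and $\mathrm{Ext}_E f(x)=H_J(x)$ for $x\in J$, $J\in\mathcal{J}_E$. "Well defined" means that all limits used in Step 2 exist. *)

theory Defs
  imports
    "HOL-Analysis.Analysis"
    "HOL-Computational_Algebra.Polynomial"
    "HOL-Probability.Essential_Supremum"
begin

section \<open>Homogeneous Sobolev spaces on the line and their trace spaces\<close>

definition abs_continuous :: "(real \<Rightarrow> real) \<Rightarrow> bool" where
  "abs_continuous F \<longleftrightarrow>
     (\<forall>\<epsilon>>0. \<exists>\<delta>>0. \<forall>D :: (real \<times> real) set.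
        finite D \<and> (\<forall>(a, b)\<in>D. a < b) \<and>
        disjoint_family_on (\<lambda>(a, b). {a<..<b}) D \<and> (\<Sum>(a, b)\<in>D. b - a) < \<delta>
        \<longrightarrow> (\<Sum>(a, b)\<in>D. \<bar>F b - F a\<bar>) < \<epsilon>)"

definition locally_integrable :: "(real \<Rightarrow> real) \<Rightarrow> bool" where
  "locally_integrable g \<longleftrightarrow> (\<forall>a b. set_integrable lebesgue {a..b} g)"

definition test_function :: "(real \<Rightarrow> real) \<Rightarrow> bool" where
  "test_function \<phi> \<longleftrightarrow>
     (\<forall>k x. (deriv ^^ k) \<phi> field_differentiable (at x)) \<and>
     (\<exists>r. \<forall>x. \<bar>x\<bar> > r \<longrightarrow> \<phi> x = 0)"

definition is_weak_deriv :: "nat \<Rightarrow> (real \<Rightarrow> real) \<Rightarrow> (real \<Rightarrow> real) \<Rightarrow> bool" where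
  "is_weak_deriv k F g \<longleftrightarrow>
     locally_integrable F \<and> locally_integrable g \<and>
     (\<forall>\<phi>. test_function \<phi> \<longrightarrow>
        (LINT x|lebesgue. F x * (deriv ^^ k) \<phi> x) =
        (- 1) ^ k * (LINT x|lebesgue. g x * \<phi> x))"

text \<open>Exponents are extended reals; only \<open>1 < p \<le> \<infinity>\<close> is of interest.\<close>

definition Lp_space :: "ereal \<Rightarrow> (real \<Rightarrow> real) set" where
  "Lp_space p = {g \<in> borel_measurable lebesgue.
     if p = \<infinity> then esssup lebesgue (\<lambda>x. ereal \<bar>g x\<bar>) < \<infinity>
     else integrable lebesgue (\<lambda>x. \<bar>g x\<bar> powr real_of_ereal p)}"

definition Lp_norm :: "ereal \<Rightarrow> (real \<Rightarrow> real) \<Rightarrow> real" where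
  "Lp_norm p g =
     (if p = \<infinity> then real_of_ereal (esssup lebesgue (\<lambda>x. ereal \<bar>g x\<bar>))
      else (LINT x|lebesgue. \<bar>g x\<bar> powr real_of_ereal p) powr (1 / real_of_ereal p))"

definition sobolev :: "nat \<Rightarrow> ereal \<Rightarrow> (real \<Rightarrow> real) set" where
  "sobolev m p = {F.
     (\<forall>k<m - 1. \<forall>x. (deriv ^^ k) F field_differentiable (at x)) \<and>
     abs_continuous ((deriv ^^ (m - 1)) F) \<and>
     (\<exists>g\<in>Lp_space p. is_weak_deriv m F g)}"

text \<open>The weak derivative is determined up to null sets, so the choice below does not
  affect the seminorm.\<close>

definition sobolev_seminorm :: "nat \<Rightarrow> ereal \<Rightarrow> (real \<Rightarrow> real) \<Rightarrow> real" where
  "sobolev_seminorm m p F = Lp_norm p (SOME g. is_weak_deriv m F g)"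

text \<open>A function on \<open>E\<close> is represented by a total function whose values outside \<open>E\<close> are
  irrelevant (for the extension operator this is lemma \<open>extension_cong\<close> below).\<close>

definition trace_space :: "nat \<Rightarrow> ereal \<Rightarrow> real set \<Rightarrow> (real \<Rightarrow> real) set" where
  "trace_space m p E = {f. \<exists>F\<in>sobolev m p. \<forall>x\<in>E. F x = f x}"

definition trace_seminorm :: "nat \<Rightarrow> ereal \<Rightarrow> real set \<Rightarrow> (real \<Rightarrow> real) \<Rightarrow> real" where
  "trace_seminorm m p E f =
     (INF F \<in> {F \<in> sobolev m p. \<forall>x\<in>E. F x = f x}. sobolev_seminorm m p F)"


section \<open>Knots\<close>

text \<open>\<open>a\<close> is an admissible choice of the map \<open>a\<^sub>E\<close>; it is unique only up to the choice of
  nearest points.\<close>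

definition knot_choice :: "real set \<Rightarrow> (real set \<Rightarrow> real) \<Rightarrow> bool" where
  "knot_choice E a \<longleftrightarrow>
     (\<forall>A. finite A \<and> A \<noteq> {} \<and> A \<subset> E \<longrightarrow>
        ((\<forall>x\<in>A. \<not> x islimpt E) \<longrightarrow>
           a A \<in> E - A \<and> (\<forall>y\<in>E - A. infdist (a A) A \<le> infdist y A)) \<and>
        (\<forall>x. {z \<in> A. z islimpt E} = {x} \<longrightarrow> a A = x))"

text \<open>The sequences \<open>Y\<^sub>j(x)\<close> and \<open>y\<^sub>j(x)\<close> are continued past the stopping index \<open>n(x)\<close>; the
  values beyond it are never used.\<close>

primrec knot_set :: "(real set \<Rightarrow> real) \<Rightarrow> real \<Rightarrow> nat \<Rightarrow> real set" where
  "knot_set a x 0 = {x}"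
| "knot_set a x (Suc j) = insert (a (knot_set a x j)) (knot_set a x j)"

primrec knot :: "(real set \<Rightarrow> real) \<Rightarrow> real \<Rightarrow> nat \<Rightarrow> real" where
  "knot a x 0 = x"
| "knot a x (Suc j) = a (knot_set a x j)"

definition last_index :: "nat \<Rightarrow> real set \<Rightarrow> (real set \<Rightarrow> real) \<Rightarrow> real \<Rightarrow> nat" where
  "last_index m E a x = (LEAST j. j = m - 1 \<or> knot a x j islimpt E)"

definition knots :: "nat \<Rightarrow> real set \<Rightarrow> (real set \<Rightarrow> real) \<Rightarrow> real \<Rightarrow> real set" where
  "knots m E a x = knot_set a x (last_index m E a x)"

definition last_knot :: "nat \<Rightarrow> real set \<Rightarrow> (real set \<Rightarrow> real) \<Rightarrow> real \<Rightarrow> real" where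
  "last_knot m E a x = knot a x (last_index m E a x)"


section \<open>Jets\<close>

abbreviation poly_deriv :: "nat \<Rightarrow> real poly \<Rightarrow> real \<Rightarrow> real" where
  "poly_deriv i P x \<equiv> poly ((pderiv ^^ i) P) x"

definition lagrange :: "real set \<Rightarrow> (real \<Rightarrow> real) \<Rightarrow> real poly" where
  "lagrange S f = (THE P. degree P \<le> card S - 1 \<and> (\<forall>y\<in>S. poly P y = f y))"

text \<open>The filter of \<open>m\<close>-point subsets \<open>S\<close> of \<open>E\<close> with \<open>S \<rightarrow> s\<close>, that is,
  \<open>diam (S \<union> {s}) \<rightarrow> 0\<close>.\<close>

definition sets_to :: "nat \<Rightarrow> real set \<Rightarrow> real \<Rightarrow> real set filter" where
  "sets_to m E s =
     (INF \<delta>\<in>{0<..}. principal {S. S \<subseteq> E \<and> finite S \<and> card S = m \<and> diameter (S \<union> {s}) < \<delta>})"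

definition jet_limit :: "nat \<Rightarrow> real set \<Rightarrow> (real \<Rightarrow> real) \<Rightarrow> nat \<Rightarrow> real \<Rightarrow> real" where
  "jet_limit m E f i s = Lim (sets_to m E s) (\<lambda>S. poly_deriv i (lagrange S f) s)"

definition jet_poly ::
  "nat \<Rightarrow> real set \<Rightarrow> (real set \<Rightarrow> real) \<Rightarrow> (real \<Rightarrow> real) \<Rightarrow> real \<Rightarrow> real poly" where
  "jet_poly m E a f x =
     (let S = knots m E a x; s = last_knot m E a x in
      if card S = m then lagrange S f
      else (THE P. degree P \<le> m - 1 \<and> (\<forall>y\<in>S. poly P y = f y) \<and>
              (\<forall>i\<in>{1..m - card S}. poly_deriv i P s = jet_limit m E f i s)))"

definition extension_well_defined ::
  "nat \<Rightarrow> real set \<Rightarrow> (real set \<Rightarrow> real) \<Rightarrow> (real \<Rightarrow> real) \<Rightarrow> bool" where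
  "extension_well_defined m E a f \<longleftrightarrow>
     (\<forall>x\<in>E. let S = knots m E a x; s = last_knot m E a x in
        card S < m \<longrightarrow>
        (\<forall>i\<in>{1..m - card S}.
           \<exists>l. ((\<lambda>S. poly_deriv i (lagrange S f) s) \<longlongrightarrow> l) (sets_to m E s)))"


section \<open>The extension operator\<close>

definition hermite :: "nat \<Rightarrow> (real \<Rightarrow> real poly) \<Rightarrow> real \<Rightarrow> real \<Rightarrow> real poly" where
  "hermite m P a b =
     (THE H. degree H \<le> 2 * m - 1 \<and>
        (\<forall>i<m. poly_deriv i H a = poly_deriv i (P a) a \<and>
               poly_deriv i H b = poly_deriv i (P b) b))"

text \<open>\<open>J\<close> is a connected component of the complement of \<open>E\<close>, i.e. an open interval; its finite
  endpoints are \<open>Inf J\<close> and \<open>Sup J\<close>.\<close>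

definition gap_poly :: "nat \<Rightarrow> (real \<Rightarrow> real poly) \<Rightarrow> real set \<Rightarrow> real poly" where
  "gap_poly m P J =
     (if bdd_below J \<and> bdd_above J then hermite m P (Inf J) (Sup J)
      else if bdd_above J then P (Sup J)
      else P (Inf J))"

definition extension ::
  "nat \<Rightarrow> real set \<Rightarrow> (real set \<Rightarrow> real) \<Rightarrow> (real \<Rightarrow> real) \<Rightarrow> real \<Rightarrow> real" where
  "extension m E a f x =
     (if x \<in> E then poly (jet_poly m E a f x) x
      else poly (gap_poly m (jet_poly m E a f) (connected_component_set (- E) x)) x)"


subsection \<open>The extension depends only on the values on \<open>E\<close>\<close>

lemma finite_knot_set: "finite (knot_set a x j)"
  and knot_set_nonempty: "knot_set a x j \<noteq> {}"
  and card_knot_set: "card (knot_set a x j) \<le> j + 1"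
proof (induction j)
  case (Suc j)
  { case 1 then show ?case using Suc by simp }
  { case 2 then show ?case by simp }
  { case 3 then show ?case using Suc by (simp add: card_insert_if) }
qed auto

lemma knot_set_eq: "knot_set a x j = knot a x ` {..j}"
  by (induction j) (auto simp: atMost_Suc)

lemma knots_subset:
  assumes a: "knot_choice E a" and E: "infinite E \<or> card E \<ge> m + 1" and x: "x \<in> E"
  shows "knots m E a x \<subseteq> E"
proof -
  let ?n = "last_index m E a x"
  have not_stop: "j \<noteq> m - 1 \<and> \<not> knot a x j islimpt E" if "j < ?n" for j
    using not_less_Least[of j] that unfolding last_index_def by blast
  have n: "?n \<le> m - 1"
    unfolding last_index_def by (rule Least_le) simp
  have "j \<le> ?n \<Longrightarrow> knot_set a x j \<subseteq> E" for j
  proof (induction j)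
    case 0
    then show ?case using x by simp
  next
    case (Suc j)
    let ?A = "knot_set a x j"
    have sub: "?A \<subseteq> E" using Suc by simp
    have "?A \<noteq> E"
      using E card_knot_set[of a x j] finite_knot_set[of a x j] Suc.prems n by auto
    with sub have "finite ?A \<and> ?A \<noteq> {} \<and> ?A \<subset> E"
      using finite_knot_set[of a x j] knot_set_nonempty[of a x j] by blast
    moreover have "\<forall>y\<in>?A. \<not> y islimpt E"
      using not_stop Suc.prems unfolding knot_set_eq by auto
    ultimately have "a ?A \<in> E"
      using a unfolding knot_choice_def by blast
    with sub show ?case by simp
  qed
  then show ?thesis unfolding knots_def by simp
qed

lemma lagrange_cong: "(\<And>y. y \<in> S \<Longrightarrow> f y = g y) \<Longrightarrow> lagrange S f = lagrange S g"
  unfolding lagrange_def by simp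

lemma eventually_sets_to_subset: "eventually (\<lambda>S. S \<subseteq> E) (sets_to m E s)"
proof -
  have "sets_to m E s \<le>
      principal {S. S \<subseteq> E \<and> finite S \<and> card S = m \<and> diameter (S \<union> {s}) < 1}"
    unfolding sets_to_def by (rule INF_lower) simp
  then show ?thesis
    by (rule filter_leD) (simp add: eventually_principal)
qed

lemma jet_limit_cong:
  assumes "\<forall>x\<in>E. f x = g x"
  shows "jet_limit m E f i s = jet_limit m E g i s"
proof -
  have ev: "eventually (\<lambda>S. poly_deriv i (lagrange S f) s = poly_deriv i (lagrange S g) s)
      (sets_to m E s)"
    using eventually_sets_to_subset
  proof eventually_elim
    case (elim S)
    then have "lagrange S f = lagrange S g"
      using assms by (intro lagrange_cong) auto
    then show ?case by simp
  qed
  show ?thesis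
    unfolding jet_limit_def using ev by (rule Lim_cong) simp
qed

lemma extension_cong:
  assumes "closed E" "infinite E \<or> card E \<ge> m + 1" "knot_choice E a" "\<forall>x\<in>E. f x = g x"
  shows "extension m E a f = extension m E a g"
proof -
  have jet: "jet_poly m E a f x = jet_poly m E a g x" if x: "x \<in> E" for x
  proof -
    have eq: "\<forall>y\<in>knots m E a x. f y = g y"
      using knots_subset[OF assms(3,2) x] assms(4) by blast
    then have "lagrange (knots m E a x) f = lagrange (knots m E a x) g"
      by (intro lagrange_cong) blast
    with eq show ?thesis
      unfolding jet_poly_def Let_def using jet_limit_cong[OF assms(4)] by simp
  qed
  have ne: "E \<noteq> {}"
    using assms(2) by auto
  have gap: "gap_poly m (jet_poly m E a f) J = gap_poly m (jet_poly m E a g) J"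
    if J: "J \<in> components (- E)" for J
  proof -
    have op: "open J"
      using J assms(1) open_components[of "- E"] by auto
    have "J \<noteq> {}" and con: "connected J" and sub: "J \<subseteq> - E"
      using J assms(1) by (auto simp: in_components_nonempty in_components_connected
          in_components_subset)
    have maximal: "T \<subseteq> J" if "connected T" "T \<subseteq> - E" "T \<inter> J \<noteq> {}" for T
      using components_maximal[OF J that(1,2)] that(3) by blast
    have endpoint: "c \<in> E" if c: "c \<in> closure J" "c \<notin> J" for c
    proof (rule ccontr)
      assume "c \<notin> E"
      have "connected (insert c J)"
        by (rule connected_intermediate_closure[OF con]) (use c closure_subset in auto)
      then have "insert c J \<subseteq> J"
        using \<open>c \<notin> E\<close> sub \<open>J \<noteq> {}\<close> by (intro maximal) auto
      with c show False by simp
    qed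
    have Inf: "Inf J \<in> E" if "bdd_below J"
    proof (rule endpoint)
      show "Inf J \<in> closure J"
        by (rule closure_contains_Inf) fact+
      show "Inf J \<notin> J"
      proof
        assume "Inf J \<in> J"
        then obtain e where "e > 0" "ball (Inf J) e \<subseteq> J"
          using op open_contains_ball by blast
        then have "Inf J - e / 2 \<in> J" by (auto simp: dist_real_def)
        with that have "Inf J \<le> Inf J - e / 2" by (intro cInf_lower)
        with \<open>e > 0\<close> show False by simp
      qed
    qed
    have Sup: "Sup J \<in> E" if "bdd_above J"
    proof (rule endpoint)
      show "Sup J \<in> closure J"
        by (rule closure_contains_Sup) fact+
      show "Sup J \<notin> J"
      proof
        assume "Sup J \<in> J"
        then obtain e where "e > 0" "ball (Sup J) e \<subseteq> J"
          using op open_contains_ball by blast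
        then have "Sup J + e / 2 \<in> J" by (auto simp: dist_real_def)
        with that have "Sup J + e / 2 \<le> Sup J" by (intro cSup_upper)
        with \<open>e > 0\<close> show False by simp
      qed
    qed
    have "bdd_below J \<or> bdd_above J"
    proof (rule ccontr)
      assume unbdd: "\<not> ?thesis"
      obtain e where "e \<in> E" using ne by blast
      from unbdd obtain u v where "u \<in> J" "u < e" "v \<in> J" "e < v"
        unfolding bdd_below_def bdd_above_def by (metis not_le)
      then have "e \<in> J"
        using con by (meson connectedD_interval less_imp_le)
      with \<open>e \<in> E\<close> sub show False by blast
    qed
    then show ?thesis
      unfolding gap_poly_def hermite_def using jet Inf Sup by auto
  qed
  show ?thesis
  proof
    fix x
    show "extension m E a f x = extension m E a g x"
    proof (cases "x \<in> E")
      case True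
      then show ?thesis by (simp add: extension_def jet)
    next
      case False
      then have "connected_component_set (- E) x \<in> components (- E)"
        by (simp add: componentsI)
      with False show ?thesis by (simp add: extension_def gap)
    qed
  qed
qed

end

theory Submission
  imports Defs
begin

text \<open>
  Proof idea. Let \<open>F\<close> be any Sobolev extension of \<open>f\<close>. The jets \<open>P\<^sub>x\<close> are Hermite interpolants of
  \<open>F\<close> at the knots of \<open>x\<close>, so by Rolle's theorem \<open>P\<^sub>x - F\<close> and its derivatives are controlled on the
  hull of the knots by the integral of the modulus of the \<open>m\<close>-th derivative of \<open>F\<close> over that hull.
  Since the next knot depends only on the set of knots chosen so far, two endpoints of a gap \<open>(u, v)\<close>
  of \<open>E\<close> either have the same knots, hence the same jet, or all their knots lie within distance
  \<open>m (v - u)\<close>. In both cases the \<open>m\<close>-th derivative of the Hermite polynomial on the gap is at most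
  \<open>C(m) / (v - u)\<close> times the integral over a hull of length at most \<open>(2m + 1) (v - u)\<close>. The knots
  are consecutive points of \<open>E\<close>, so each hull meets few gaps and the hulls overlap at most
  \<open>4m + 1\<close> times. Jensen's inequality on each gap then gives the \<open>L\<^sub>p\<close> bound with a constant
  independent of \<open>p\<close>; no maximal function is needed. The pieces fit together because the difference
  of the extension and \<open>F\<close> has vanishing jet at every limit point of \<open>E\<close>, so that its derivatives
  integrate to zero over each component of the complement of the set of limit points.
\<close>

section \<open>Hermite interpolation\<close>

text \<open>The function to be bounded is fixed by \<open>f\<close>, while every estimate is made
  against an arbitrary extension F; since the jets do not see F, the infimum over F can wait until
  the last step. The obstacle is regularity: E may be a Cantor set of positive measure, so its gaps
  accumulate and a definition by pieces says nothing about absolute continuity of the (m-1)-st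
  derivative. The candidate for the m-th derivative is therefore written down beforehand, from the
  pieces on the gaps and from F on E, and its \<open>L_p\<close> bound comes before any proof that
  it is a derivative; this bound supplies the local integrability that the gluing needs. To keep
  weak derivatives out of the geometric argument, Sobolev functions are replaced by chains of
  functions linked by integral formulas; test functions occur only in the passage to and from
  chains.\<close>

lemma pderiv_neq_0_if_root:
  fixes P :: "real poly"
  assumes "poly P x = 0" "P \<noteq> 0"
  shows "pderiv P \<noteq> 0"
proof
  assume "pderiv P = 0"
  then have "degree P = 0" by (simp add: pderiv_eq_0_iff)
  then obtain c where "P = [:c:]" by (rule degree_eq_zeroE)
  with assms show False by simp
qed

text \<open>Differentiation lowers the order of a root by exactly one in characteristic 0, so the
  induction passes to \<open>pderiv P\<close> with one condition less.\<close>

lemma order_ge_if_derivs_vanish: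
  fixes P :: "real poly"
  assumes "P \<noteq> 0" "\<And>i. i < k \<Longrightarrow> poly_deriv i P x = 0"
  shows "order x P \<ge> k"
  using assms
proof (induction k arbitrary: P)
  case (Suc k)
  have "poly P x = 0"
    using Suc.prems(2)[of 0] by simp
  then have pd: "pderiv P \<noteq> 0"
    using Suc.prems(1) pderiv_neq_0_if_root by blast
  have "poly_deriv i (pderiv P) x = 0" if "i < k" for i
    using Suc.prems(2)[of "Suc i"] that by (simp add: funpow_Suc_right del: funpow.simps)
  then have "order x (pderiv P) \<ge> k"
    using Suc.IH pd by blast
  moreover have "order x P = Suc (order x (pderiv P))"
    using Suc.prems(1) pd \<open>poly P x = 0\<close> by (simp add: order_pderiv order_root)
  ultimately show ?case by simp
qed simp

text \<open>The same descent along \<open>pderiv\<close>, now keeping track of equality. The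
  nonvanishing k-th derivative is what \<open>hermite_exists\<close> divides by.\<close>

lemma derivs_at_order:
  fixes P :: "real poly"
  assumes "P \<noteq> 0" "order x P = k"
  shows "(\<forall>i<k. poly_deriv i P x = 0) \<and> poly_deriv k P x \<noteq> 0"
  using assms
proof (induction k arbitrary: P)
  case 0
  then show ?case by (simp add: order_root)
next
  case (Suc k)
  have root: "poly P x = 0"
    using Suc.prems by (simp add: order_root)
  then have pd: "pderiv P \<noteq> 0"
    using Suc.prems(1) pderiv_neq_0_if_root by blast
  have "order x P = Suc (order x (pderiv P))"
    using Suc.prems(1) pd root by (simp add: order_pderiv order_root)
  then have IH: "(\<forall>i<k. poly_deriv i (pderiv P) x = 0) \<and> poly_deriv k (pderiv P) x \<noteq> 0"
    using Suc.IH[OF pd] Suc.prems by simp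
  then have *: "(\<forall>i<k. poly_deriv (Suc i) P x = 0) \<and> poly_deriv (Suc k) P x \<noteq> 0"
    by (simp add: funpow_Suc_right del: funpow.simps)
  have "poly_deriv i P x = 0" if "i < Suc k" for i
    using * root that by (cases i) (auto simp del: funpow.simps simp: funpow_0)
  with * show ?case by blast
qed

lemma higher_pderiv_minus: "(pderiv ^^ n) (P - Q :: real poly) = (pderiv ^^ n) P - (pderiv ^^ n) Q"
  by (induction n) (simp_all add: pderiv_diff)

text \<open>A nonzero polynomial has at most as many roots, counted with order, as its degree; the
  conditions would force more.\<close>

lemma hermite_zero:
  fixes P :: "real poly"
  assumes "finite S" "degree P < (\<Sum>x\<in>S. \<mu> x)"
    and "\<And>x i. x \<in> S \<Longrightarrow> i < \<mu> x \<Longrightarrow> poly_deriv i P x = 0"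
  shows "P = 0"
proof (rule ccontr)
  assume nz: "P \<noteq> 0"
  have ord: "\<mu> x \<le> order x P" if "x \<in> S" for x
    using order_ge_if_derivs_vanish[OF nz] assms(3)[OF that] by blast
  have "(\<Sum>x\<in>S. \<mu> x) \<le> (\<Sum>x\<in>S. order x P)"
    by (intro sum_mono ord)
  also have "\<dots> = (\<Sum>x\<in>S \<inter> {x. poly P x = 0}. order x P)"
    using assms(1) by (intro sum.mono_neutral_right) (auto simp: order_root)
  also have "\<dots> \<le> (\<Sum>x | poly P x = 0. order x P)"
    using nz by (intro sum_mono2) (auto simp: poly_roots_finite)
  also have "\<dots> \<le> degree P"
    using nz by (rule sum_order_le_degree)
  finally show False using assms(2) by simp
qed

lemma hermite_unique:
  fixes P Q :: "real poly"
  assumes "finite S" "degree P < (\<Sum>x\<in>S. \<mu> x)" "degree Q < (\<Sum>x\<in>S. \<mu> x)"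
    and "\<And>x i. x \<in> S \<Longrightarrow> i < \<mu> x \<Longrightarrow> poly_deriv i P x = poly_deriv i Q x"
  shows "P = Q"
proof -
  have "degree (P - Q) < (\<Sum>x\<in>S. \<mu> x)"
    using degree_diff_le_max[of P Q] assms(2,3) by simp
  then have "P - Q = 0"
    by (rule hermite_zero[OF assms(1)]) (use assms(4) in \<open>auto simp: higher_pderiv_minus\<close>)
  then show ?thesis by simp
qed

text \<open>Newton's scheme: conditions are added one at a time. Given a solution for one condition
  less, a multiple of the node polynomial with the old multiplicities meets the new condition
  without disturbing the others.\<close>

lemma hermite_exists:
  fixes c :: "real \<Rightarrow> nat \<Rightarrow> real"
  assumes "finite S"
  shows "\<exists>P. degree P \<le> (\<Sum>x\<in>S. \<mu> x) - 1 \<and> (\<forall>x\<in>S. \<forall>i<\<mu> x. poly_deriv i P x = c x i)"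
proof (induction "\<Sum>x\<in>S. \<mu> x" arbitrary: \<mu>)
  case 0
  then have "\<forall>x\<in>S. \<mu> x = 0" using assms by simp
  then show ?case by (intro exI[of _ 0]) auto
next
  case (Suc N)
  then obtain x where x: "x \<in> S" "\<mu> x > 0"
    by (metis bot_nat_0.not_eq_extremum nat.distinct(1) sum.neutral)
  \<comment> \<open>The condition given up is the highest one at x. The node polynomial W then
    vanishes there to order exactly \<open>\<nu> x\<close>, so its derivative of that order is
    nonzero and can be scaled to any prescribed value.\<close>
  define \<nu> where "\<nu> = \<mu>(x := \<mu> x - 1)"
  have "(\<Sum>y\<in>S. \<mu> y) = \<mu> x + (\<Sum>y\<in>S-{x}. \<mu> y)"
    using assms x by (simp add: sum.remove)
  moreover have "(\<Sum>y\<in>S. \<nu> y) = \<nu> x + (\<Sum>y\<in>S-{x}. \<nu> y)"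
    using assms x by (simp add: sum.remove)
  moreover have "(\<Sum>y\<in>S-{x}. \<nu> y) = (\<Sum>y\<in>S-{x}. \<mu> y)"
    by (intro sum.cong) (auto simp: \<nu>_def)
  ultimately have N: "(\<Sum>y\<in>S. \<nu> y) = N"
    using Suc.hyps(2) x by (simp add: \<nu>_def)
  obtain P where P: "degree P \<le> N - 1" "\<forall>y\<in>S. \<forall>i<\<nu> y. poly_deriv i P y = c y i"
    using Suc.hyps(1)[of \<nu>] N by auto
  define W :: "real poly" where "W = (\<Prod>y\<in>S. [:-y, 1:] ^ \<nu> y)"
  have W0: "W \<noteq> 0" unfolding W_def using assms by simp
  have degW: "degree W = N"
    unfolding W_def N[symmetric]
    by (subst degree_prod_sum_eq) (auto simp: degree_power_eq)
  have ordW: "order y W = \<nu> y" if y: "y \<in> S" for y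
  proof -
    define V :: "real poly" where "V = (\<Prod>z\<in>S-{y}. [:-z, 1:] ^ \<nu> z)"
    have WV: "W = [:-y, 1:] ^ \<nu> y * V"
      unfolding W_def V_def using assms y by (simp add: prod.remove)
    have "poly V y \<noteq> 0"
      unfolding V_def using assms by (auto simp: poly_prod)
    then have "order y V = 0" by (simp add: order_0I)
    with WV W0 show ?thesis
      by (simp add: order_mult order_power_n_n)
  qed
  have Wlow: "poly_deriv i W y = 0" if "y \<in> S" "i < \<nu> y" for y i
    using derivs_at_order[OF W0 ordW[OF that(1)]] that by blast
  have Wtop: "poly_deriv (\<nu> x) W x \<noteq> 0"
    using derivs_at_order[OF W0 ordW[OF x(1)]] by blast
  define d where "d = (c x (\<nu> x) - poly_deriv (\<nu> x) P x) / poly_deriv (\<nu> x) W x"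
  define Q where "Q = P + smult d W"
  have Qd: "poly_deriv i Q y = poly_deriv i P y + d * poly_deriv i W y" for i y
    by (simp add: Q_def higher_pderiv_add higher_pderiv_smult)
  have "degree Q \<le> N"
    unfolding Q_def using P(1) degW by (intro degree_add_le) auto
  moreover have "poly_deriv i Q y = c y i" if "y \<in> S" "i < \<mu> y" for y i
  proof (cases "y = x \<and> i = \<nu> x")
    case True
    then show ?thesis using Wtop by (auto simp: Qd d_def)
  next
    case False
    then have "i < \<nu> y" using that by (auto simp: \<nu>_def)
    then show ?thesis using P(2) Wlow that by (auto simp: Qd)
  qed
  ultimately show ?case using Suc.hyps(2) by (intro exI[of _ Q]) auto
qed

section \<open>Zeros of derivatives\<close>

text \<open>Induction by removing the largest zero; Rolle's theorem gives one new zero of G' between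
  the two largest. Disjointness of T from S is part of the claim because
  \<open>rolle_multiple\<close> adds a node of S to T and must not count it twice.\<close>

lemma rolle_finite:
  fixes G G' :: "real \<Rightarrow> real"
  assumes "finite S" "card S = Suc n"
    and der: "\<And>x. (G has_real_derivative G' x) (at x)"
    and zero: "\<And>x. x \<in> S \<Longrightarrow> G x = 0"
  shows "\<exists>T. finite T \<and> card T = n \<and> T \<inter> S = {} \<and> T \<subseteq> {Min S<..<Max S} \<and> (\<forall>x\<in>T. G' x = 0)"
  using assms(1,2) zero
proof (induction n arbitrary: S)
  case 0
  then show ?case by (intro exI[of _ "{}"]) auto
next
  case (Suc n)
  define M where "M = Max S"
  define S0 where "S0 = S - {M}"
  have M: "M \<in> S" unfolding M_def using Suc.prems by (intro Max_in) auto
  have S0: "finite S0" "card S0 = Suc n" "S0 \<noteq> {}"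
  proof -
    show "finite S0" "card S0 = Suc n"
      unfolding S0_def using Suc.prems M by auto
    then show "S0 \<noteq> {}" by auto
  qed
  obtain T where T: "finite T" "card T = n" "T \<inter> S0 = {}" "T \<subseteq> {Min S0<..<Max S0}"
      "\<forall>x\<in>T. G' x = 0"
    using Suc.IH[of S0] S0 Suc.prems(3) by (auto simp: S0_def)
  have ltM: "y < M" if "y \<in> S0" for y
    using that Suc.prems(1) unfolding S0_def M_def by (metis DiffE Max_ge insertI1 less_eq_real_def)
  have mx: "Max S0 \<in> S0" using S0 by simp
  have lt: "Max S0 < M" using ltM mx by blast
  have "\<exists>z>Max S0. z < M \<and> (G has_real_derivative 0) (at z)"
  proof (rule Rolle[OF lt])
    show "G (Max S0) = G M" using Suc.prems(3) mx M by (simp add: S0_def)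
    show "continuous_on {Max S0..M} G"
      using der by (intro DERIV_continuous_on) (auto intro: has_field_derivative_at_within)
    show "G differentiable at x" for x
      using der real_differentiable_def by blast
  qed
  then obtain z where z: "Max S0 < z" "z < M" "G' z = 0"
    using der DERIV_unique by blast
  have mS: "Min S0 = Min S"
  proof -
    have "S = insert M S0" using M by (auto simp: S0_def)
    then have "Min S = min M (Min S0)" using S0 by simp
    moreover have "Min S0 < M" using ltM S0 by simp
    ultimately show ?thesis by simp
  qed
  have "z \<notin> S0" using z S0 by (meson Max_ge leD)
  moreover have "z \<notin> T" using T(4) z by auto
  moreover have "M \<notin> T" using T(4) lt by auto
  ultimately have "finite (insert z T) \<and> card (insert z T) = Suc n \<and> insert z T \<inter> S = {}"
    using T z by (auto simp: S0_def)
  moreover have "Min S0 \<le> Max S0" using S0 by simp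
  then have "insert z T \<subseteq> {Min S<..<Max S}"
    using z T(4) mS lt unfolding M_def by auto
  ultimately show ?case using T(5) z(3) by (intro exI[of _ "insert z T"]) auto
qed

text \<open>With s counted r + 1 times there are \<open>card S + r\<close> zeros, and each
  differentiation costs one: Rolle gives zeros between the nodes and, while r is positive, s
  survives with multiplicity r.\<close>

lemma rolle_multiple:
  fixes G :: "nat \<Rightarrow> real \<Rightarrow> real"
  assumes "finite S" "s \<in> S" "S \<subseteq> {\<alpha>..\<beta>}"
    and "\<And>i x. Suc i < card S + r \<Longrightarrow> (G i has_real_derivative G (Suc i) x) (at x)"
    and "\<And>x. x \<in> S \<Longrightarrow> G 0 x = 0"
    and "\<And>i. i \<le> r \<Longrightarrow> G i s = 0"
    and "k < card S + r"
  shows "\<exists>z\<in>{\<alpha>..\<beta>}. G k z = 0"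
  using assms
proof (induction k arbitrary: G S s r)
  case 0
  then show ?case by (intro bexI[of _ s]) auto
next
  case (Suc k)
  obtain n where n: "card S = Suc n"
    using Suc.prems(1,2) by (metis card_Suc_Diff1)
  have ne: "S \<noteq> {}" using Suc.prems by auto
  have "\<And>x. (G 0 has_real_derivative G 1 x) (at x)"
    using Suc.prems(4)[of 0] Suc.prems(7) by simp
  then obtain T where T: "finite T" "card T = n" "T \<inter> S = {}" "T \<subseteq> {Min S<..<Max S}"
      "\<forall>x\<in>T. G 1 x = 0"
    using rolle_finite[OF Suc.prems(1) n, of "G 0" "G 1"] Suc.prems(5) by blast
  have hull: "T \<subseteq> {\<alpha>..\<beta>}"
  proof -
    have "Min S \<in> S" "Max S \<in> S" using Suc.prems(1) ne by auto
    then have "\<alpha> \<le> Min S" "Max S \<le> \<beta>" using Suc.prems(3) by auto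
    then show ?thesis using T(4) by force
  qed
  show ?case
  proof (cases r)
    case 0
    \<comment> \<open>Without multiplicity at s, its role passes to any of the new zeros; there is
      one because at least two nodes were left.\<close>
    then have "n > 0" using Suc.prems(7) n by simp
    then obtain t where t: "t \<in> T" using T by fastforce
    show ?thesis
      by (rule Suc.IH[where S = T and s = t and G = "\<lambda>i. G (Suc i)" and r = 0])
         (use T t hull Suc.prems n 0 in auto)
  next
    case (Suc r')
    have sT: "s \<notin> T" using T Suc.prems(2) by auto
    have G1: "G (Suc i) s = 0" if "i \<le> r'" for i
      using Suc.prems(6)[of "Suc i"] Suc that by simp
    show ?thesis
      by (rule Suc.IH[where S = "insert s T" and s = s and G = "\<lambda>i. G (Suc i)" and r = r'])
         (use T sT hull Suc.prems n Suc G1[of 0] G1 in auto)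
  qed
qed

section \<open>Chains of iterated antiderivatives\<close>

text \<open>Derivatives of a function whose (m-1)-st derivative is locally absolutely continuous, in
  integral form. The entry of index m is a concrete representative of the weak derivative; the
  entries below it are continuous automatically (\<open>chain_continuous\<close>).\<close>

definition antideriv_chain :: "nat \<Rightarrow> (nat \<Rightarrow> real \<Rightarrow> real) \<Rightarrow> bool" where
  "antideriv_chain m \<Phi> \<longleftrightarrow> (\<forall>i\<le>m. locally_integrable (\<Phi> i)) \<and>
     (\<forall>i<m. \<forall>x y. x \<le> y \<longrightarrow> \<Phi> i y - \<Phi> i x = integral {x..y} (\<Phi> (Suc i)))"

lemma locally_integrable_abs_on:
  "locally_integrable f \<Longrightarrow> f absolutely_integrable_on {a..b}"
  by (simp add: locally_integrable_def)

lemma locally_integrable_on: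
  "locally_integrable f \<Longrightarrow> f integrable_on {a..b}"
  by (rule set_lebesgue_integral_eq_integral(1)[OF locally_integrable_abs_on])

lemma locally_integrable_abs_integrable_on:
  "locally_integrable f \<Longrightarrow> (\<lambda>x. \<bar>f x\<bar>) integrable_on {a..b}"
  using locally_integrable_abs_on[of f a b] unfolding absolutely_integrable_on_def by simp

lemma integral_abs_mono:
  assumes "locally_integrable f" "{a..b} \<subseteq> {c..d}"
  shows "integral {a..b} (\<lambda>x. \<bar>f x\<bar>) \<le> integral {c..d} (\<lambda>x. \<bar>f x\<bar>)"
  using assms by (intro integral_subset_le locally_integrable_abs_integrable_on) auto

lemma abs_integral_le:
  assumes "locally_integrable f"
  shows "\<bar>integral {a..b} f\<bar> \<le> integral {a..b} (\<lambda>x. \<bar>f x\<bar>)"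
  using integral_norm_bound_integral[of f "{a..b}" "\<lambda>x. \<bar>f x\<bar>"] assms
  by (simp add: locally_integrable_on locally_integrable_abs_integrable_on)

lemma continuous_imp_locally_integrable:
  assumes "continuous_on UNIV (f :: real \<Rightarrow> real)"
  shows "locally_integrable f"
  unfolding locally_integrable_def
  using assms by (auto intro: absolutely_integrable_continuous_real continuous_on_subset)

lemma continuous_on_if_integral:
  assumes "locally_integrable f" and "\<And>x y. x \<le> y \<Longrightarrow> F y - F x = integral {x..y} f"
  shows "continuous_on UNIV (F :: real \<Rightarrow> real)"
proof -
  have "isCont F x" for x
  proof -
    have "continuous_on {x-1..x+1} (\<lambda>t. F (x-1) + integral {x-1..t} f)"
      by (intro continuous_intros indefinite_integral_continuous_1 locally_integrable_on assms)
    moreover have "F (x-1) + integral {x-1..t} f = F t" if "t \<in> {x-1..x+1}" for t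
      using assms(2)[of "x-1" t] that by simp
    ultimately have "continuous_on {x-1..x+1} F"
      by (metis (no_types, lifting) continuous_on_cong)
    then show ?thesis
      by (rule continuous_on_interior) auto
  qed
  then show ?thesis by (simp add: continuous_on_eq_continuous_at)
qed

lemma has_deriv_if_integral:
  assumes "continuous_on UNIV f" and "\<And>x y. x \<le> y \<Longrightarrow> F y - F x = integral {x..y} f"
  shows "(F has_real_derivative f x) (at x)"
proof -
  have "((\<lambda>t. integral {x-1..t} f) has_real_derivative f x) (at x within {x-1..x+1})"
    by (rule integral_has_real_derivative) (auto intro: continuous_on_subset[OF assms(1)])
  then have "((\<lambda>t. integral {x-1..t} f) has_real_derivative f x) (at x)"
    using at_within_Icc_at[of "x-1" x "x+1"] by simp
  then have "((\<lambda>t. F (x-1) + integral {x-1..t} f) has_real_derivative f x) (at x)"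
    by (auto intro!: derivative_eq_intros)
  then show ?thesis
  proof (rule has_field_derivative_transform_within_open[where S = "{x-1<..}"])
    show "F (x - 1) + integral {x - 1..t} f = F t" if "t \<in> {x-1<..}" for t
      using assms(2)[of "x-1" t] that by simp
  qed auto
qed

lemma chain_integrable: "antideriv_chain m \<Phi> \<Longrightarrow> i \<le> m \<Longrightarrow> locally_integrable (\<Phi> i)"
  by (simp add: antideriv_chain_def)

lemma chain_integral:
  "antideriv_chain m \<Phi> \<Longrightarrow> i < m \<Longrightarrow> x \<le> y \<Longrightarrow> \<Phi> i y - \<Phi> i x = integral {x..y} (\<Phi> (Suc i))"
  by (simp add: antideriv_chain_def)

lemma chain_continuous:
  assumes "antideriv_chain m \<Phi>" "i < m"
  shows "continuous_on UNIV (\<Phi> i)"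
  by (rule continuous_on_if_integral[OF chain_integrable[OF assms(1), of "Suc i"]])
     (use assms chain_integral in auto)

lemma chain_deriv:
  assumes "antideriv_chain m \<Phi>" "Suc i < m"
  shows "(\<Phi> i has_real_derivative \<Phi> (Suc i) x) (at x)"
  by (rule has_deriv_if_integral[OF chain_continuous[OF assms]])
     (use assms chain_integral in auto)

lemma has_deriv_poly_deriv:
  "(poly_deriv i P has_real_derivative poly_deriv (Suc i) P x) (at x)"
  by (simp add: poly_DERIV)

lemma poly_deriv_eq_0: "degree P < i \<Longrightarrow> poly_deriv i P x = 0"
proof -
  assume "degree P < i"
  then have "(pderiv ^^ i) P = 0"
    by (intro poly_eqI) (simp add: coeff_higher_pderiv coeff_eq_0)
  then show ?thesis by simp
qed

text \<open>P and \<open>\<Phi> 0\<close> share m conditions in the hull, so by Rolle each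
  difference of k-th derivatives with k < m has a zero there. At k = m-1 the polynomial part is
  constant and the difference is an increment of \<open>\<Phi> (m - 1)\<close>; each step down in k
  starts from a zero and costs a factor \<beta> - \<alpha>.\<close>

lemma interpolation_error:
  fixes P :: "real poly"
  assumes chain: "antideriv_chain m \<Phi>" and deg: "degree P < m"
    and S: "finite S" "s \<in> S" "S \<subseteq> {\<alpha>..\<beta>}" "card S + r = m"
    and eq: "\<And>x. x \<in> S \<Longrightarrow> poly P x = \<Phi> 0 x"
    and jet: "\<And>i. i \<le> r \<Longrightarrow> poly_deriv i P s = \<Phi> i s"
    and k: "k < m" and x: "x \<in> {\<alpha>..\<beta>}"
  shows "\<bar>poly_deriv k P x - \<Phi> k x\<bar> \<le> (\<beta> - \<alpha>) ^ (m - 1 - k) * integral {\<alpha>..\<beta>} (\<lambda>t. \<bar>\<Phi> m t\<bar>)"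
proof -
  define G where "G i x = poly_deriv i P x - \<Phi> i x" for i x
  let ?I = "integral {\<alpha>..\<beta>} (\<lambda>t. \<bar>\<Phi> m t\<bar>)"
  have int: "locally_integrable (\<Phi> m)" using chain by (simp add: chain_integrable)
  have derG: "(G i has_real_derivative G (Suc i) x) (at x)" if "Suc i < m" for i x
    unfolding G_def by (intro DERIV_diff has_deriv_poly_deriv chain_deriv[OF chain that])
  have zero: "\<exists>z\<in>{\<alpha>..\<beta>}. G k z = 0" if "k < m" for k
    by (rule rolle_multiple[OF S(1-3), of r G])
       (use derG eq jet that S in \<open>auto simp: G_def\<close>)
  have I0: "?I \<ge> 0"
    by (rule integral_nonneg[OF locally_integrable_abs_integrable_on[OF int]]) simp
  have "\<forall>x\<in>{\<alpha>..\<beta>}. \<bar>G k x\<bar> \<le> (\<beta> - \<alpha>) ^ d * ?I" if "k + d = m - 1" "k < m" for k d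
    using that
  proof (induction d arbitrary: k)
    case 0
    then have k: "Suc k = m" by simp
    obtain z where z: "z \<in> {\<alpha>..\<beta>}" "G k z = 0" using zero 0 by blast
    have "\<bar>\<Phi> k y - \<Phi> k x\<bar> \<le> ?I" if "\<alpha> \<le> x" "x \<le> y" "y \<le> \<beta>" for x y
    proof -
      have "\<Phi> k y - \<Phi> k x = integral {x..y} (\<Phi> m)"
        using chain_integral[OF chain, of k x y] that k by simp
      moreover have "\<bar>integral {x..y} (\<Phi> m)\<bar> \<le> integral {x..y} (\<lambda>t. \<bar>\<Phi> m t\<bar>)"
        using abs_integral_le[OF int] .
      moreover have "\<dots> \<le> ?I"
        using that by (intro integral_abs_mono[OF int]) auto
      ultimately show ?thesis by simp
    qed
    note bound = this
    have const: "poly_deriv k P x = poly_deriv k P z" for x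
    proof -
      have "degree ((pderiv ^^ k) P) = 0"
        using deg k by (simp add: degree_higher_pderiv)
      then obtain c where "(pderiv ^^ k) P = [:c:]" by (metis degree_eq_zeroE)
      then show ?thesis by simp
    qed
    have "\<bar>G k x\<bar> \<le> ?I" if "x \<in> {\<alpha>..\<beta>}" for x
    proof -
      have "\<bar>G k x\<bar> = \<bar>\<Phi> k x - \<Phi> k z\<bar>"
        using z(2) const[of x] by (simp add: G_def)
      then show ?thesis
        using bound[of x z] bound[of z x] that z(1) by (cases "x \<le> z") auto
    qed
    then show ?case by simp
  next
    case (Suc d)
    then have k: "Suc k < m" by simp
    obtain z where z: "z \<in> {\<alpha>..\<beta>}" "G k z = 0" using zero Suc by blast
    have IH: "\<forall>x\<in>{\<alpha>..\<beta>}. \<bar>G (Suc k) x\<bar> \<le> (\<beta> - \<alpha>) ^ d * ?I"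
      using Suc.IH[of "Suc k"] Suc.prems k by simp
    show ?case
    proof
      fix x assume x: "x \<in> {\<alpha>..\<beta>}"
      have "norm (G k x - G k z) \<le> ((\<beta> - \<alpha>) ^ d * ?I) * norm (x - z)"
      proof (rule field_differentiable_bound)
        show "(G k has_field_derivative G (Suc k) t) (at t within {\<alpha>..\<beta>})" for t
          using derG[OF k] by (rule has_field_derivative_at_within)
      qed (use IH x z in auto)
      also have "\<dots> \<le> ((\<beta> - \<alpha>) ^ d * ?I) * (\<beta> - \<alpha>)"
        using x z I0 by (intro mult_left_mono) auto
      finally show "\<bar>G k x\<bar> \<le> (\<beta> - \<alpha>) ^ Suc d * ?I"
        using z(2) by (simp add: mult_ac)
    qed
  qed
  from this[of k "m - 1 - k"] k x show ?thesis by (auto simp: G_def)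
qed

section \<open>Smooth step functions\<close>

text \<open>Existence of derivatives is stated by recursion on witnesses, so that closure under
  sums, products and affine substitution needs no formula for higher derivatives.
  \<open>times_differentiable_imp\<close> returns to iterated \<open>deriv\<close>.\<close>

primrec times_differentiable :: "nat \<Rightarrow> (real \<Rightarrow> real) \<Rightarrow> bool" where
  "times_differentiable 0 f \<longleftrightarrow> True"
| "times_differentiable (Suc n) f \<longleftrightarrow>
     (\<exists>f'. (\<forall>x. (f has_real_derivative f' x) (at x)) \<and> times_differentiable n f')"

lemma times_differentiable_SucD: "times_differentiable (Suc n) f \<Longrightarrow> times_differentiable n f"
  by (induction n arbitrary: f) auto

lemma times_differentiable_const: "times_differentiable n (\<lambda>x. c)"
proof (induction n arbitrary: c)
  case (Suc n)
  show ?case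
    unfolding times_differentiable.simps
    by (intro exI[of _ "\<lambda>x. 0"] conjI allI Suc.IH) (auto intro!: derivative_eq_intros)
qed simp

lemma times_differentiable_add:
  "times_differentiable n f \<Longrightarrow> times_differentiable n g \<Longrightarrow> times_differentiable n (\<lambda>x. f x + g x)"
proof (induction n arbitrary: f g)
  case (Suc n)
  then obtain f' g' where
    "\<And>x. (f has_real_derivative f' x) (at x)" "times_differentiable n f'"
    "\<And>x. (g has_real_derivative g' x) (at x)" "times_differentiable n g'" by auto
  then show ?case
    unfolding times_differentiable.simps
    by (intro exI[of _ "\<lambda>x. f' x + g' x"] conjI allI Suc.IH DERIV_add)
qed simp

lemma times_differentiable_mult:
  "times_differentiable n f \<Longrightarrow> times_differentiable n g \<Longrightarrow> times_differentiable n (\<lambda>x. f x * g x)"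
proof (induction n arbitrary: f g)
  case (Suc n)
  then obtain f' g' where
    d: "\<And>x. (f has_real_derivative f' x) (at x)" "times_differentiable n f'"
    "\<And>x. (g has_real_derivative g' x) (at x)" "times_differentiable n g'" by auto
  have low: "times_differentiable n f" "times_differentiable n g"
    using Suc.prems by (auto simp only: times_differentiable_SucD)
  show ?case
    unfolding times_differentiable.simps
  proof (intro exI[of _ "\<lambda>x. f' x * g x + f x * g' x"] conjI allI)
    show "times_differentiable n (\<lambda>x. f' x * g x + f x * g' x)"
      by (intro times_differentiable_add Suc.IH d low)
    show "((\<lambda>x. f x * g x) has_real_derivative f' x * g x + f x * g' x) (at x)" for x
      using DERIV_mult'[OF d(1)[of x] d(3)[of x]] by (simp add: add.commute)
  qed
qed simp

lemma times_differentiable_affine: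
  "times_differentiable n f \<Longrightarrow> times_differentiable n (\<lambda>x. f (c * x + d))"
proof (induction n arbitrary: f)
  case (Suc n)
  then obtain f' where
    d: "\<And>x. (f has_real_derivative f' x) (at x)" "times_differentiable n f'" by auto
  show ?case
    unfolding times_differentiable.simps
  proof (intro exI[of _ "\<lambda>x. f' (c * x + d) * c"] conjI allI)
    show "times_differentiable n (\<lambda>x. f' (c * x + d) * c)"
      by (rule times_differentiable_mult[OF Suc.IH[OF d(2)] times_differentiable_const])
    show "((\<lambda>x. f (c * x + d)) has_real_derivative f' (c * x + d) * c) (at x)" for x
      by (rule DERIV_chain2[OF d(1)]) (auto intro!: derivative_eq_intros)
  qed
qed simp

lemma times_differentiable_deriv:
  "times_differentiable (Suc n) f \<Longrightarrow>
     (\<forall>x. (f has_real_derivative deriv f x) (at x)) \<and> times_differentiable n (deriv f)"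
proof -
  assume "times_differentiable (Suc n) f"
  then obtain f' where d: "\<And>x. (f has_real_derivative f' x) (at x)" "times_differentiable n f'"
    by auto
  then have "deriv f = f'" using DERIV_imp_deriv by blast
  with d show ?thesis by simp
qed

lemma times_differentiable_imp:
  assumes "\<And>n. times_differentiable n f"
  shows "(deriv ^^ k) f field_differentiable (at x)"
proof -
  have "times_differentiable n ((deriv ^^ k) f)" for n
  proof (induction k arbitrary: n)
    case (Suc k)
    then show ?case using times_differentiable_deriv[OF Suc.IH[of "Suc n"]] by simp
  qed (use assms in simp)
  then have "times_differentiable 1 ((deriv ^^ k) f)" .
  then show ?thesis unfolding field_differentiable_def by auto
qed

section \<open>Functions flat at the origin and the smooth step\<close>

definition exp_germ :: "real poly \<Rightarrow> real \<Rightarrow> real" where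
  "exp_germ p x = (if x > 0 then poly p (1 / x) * exp (- (1 / x)) else 0)"

lemma poly_exp_decay: "((\<lambda>t. poly q t * exp (- t)) \<longlongrightarrow> 0) at_top" for q :: "real poly"
proof -
  have "((\<lambda>t. \<Sum>i\<le>degree q. coeff q i * (t ^ i / exp t)) \<longlongrightarrow> (\<Sum>i\<le>degree q. coeff q i * 0)) at_top"
    by (intro tendsto_sum tendsto_mult tendsto_const tendsto_power_div_exp_0)
  moreover have "(\<Sum>i\<le>degree q. coeff q i * (t ^ i / exp t)) = poly q t * exp (- t)" for t
    by (simp add: poly_altdef sum_distrib_right exp_minus field_simps sum_divide_distrib)
  ultimately show ?thesis by simp
qed

text \<open>In t = 1/x one has d/dx = -t^2 d/dt, which sends p e^(-t) to t^2 (p - p') e^(-t): the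
  family is closed under differentiation, hence smooth. At 0 the right difference quotient is t p(t)
  e^(-t), which tends to 0.\<close>

lemma DERIV_exp_germ:
  "(exp_germ p has_real_derivative exp_germ ([:0, 0, 1:] * (p - pderiv p)) x) (at x)"
proof (cases x "0 :: real" rule: linorder_cases)
  case less
  have "((\<lambda>x. 0 :: real) has_real_derivative 0) (at x)" by simp
  then have "(exp_germ p has_real_derivative 0) (at x)"
    by (rule has_field_derivative_transform_within_open[where S = "{..<0}"])
       (use less in \<open>auto simp: exp_germ_def\<close>)
  then show ?thesis using less by (simp add: exp_germ_def)
next
  case greater
  have "((\<lambda>x. poly p (1 / x) * exp (- (1 / x))) has_real_derivative
      poly (pderiv p) (1 / x) * (- 1 / x\<^sup>2) * exp (- (1 / x)) +
      poly p (1 / x) * (exp (- (1 / x)) * (1 / x\<^sup>2))) (at x)"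
    using greater
    by (auto intro!: derivative_eq_intros DERIV_chain2[OF poly_DERIV] simp: power2_eq_square)
  also have "poly (pderiv p) (1 / x) * (- 1 / x\<^sup>2) * exp (- (1 / x)) +
      poly p (1 / x) * (exp (- (1 / x)) * (1 / x\<^sup>2)) = exp_germ ([:0, 0, 1:] * (p - pderiv p)) x"
    using greater by (simp add: exp_germ_def field_simps power2_eq_square)
  finally show ?thesis
    by (rule has_field_derivative_transform_within_open[where S = "{0<..}"])
       (use greater in \<open>auto simp: exp_germ_def\<close>)
next
  case equal
  have "((\<lambda>y. poly ([:0, 1:] * p) (inverse y) * exp (- inverse y)) \<longlongrightarrow> 0) (at_right 0)"
    by (rule filterlim_compose[OF poly_exp_decay filterlim_inverse_at_top_right])
  then have "((\<lambda>y. exp_germ p y / y) \<longlongrightarrow> 0) (at_right 0)"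
    by (rule Lim_transform_eventually)
       (auto simp: exp_germ_def field_simps eventually_at_filter)
  moreover have "((\<lambda>y. exp_germ p y / y) \<longlongrightarrow> 0) (at_left 0)"
    by (rule tendsto_eventually) (auto simp: exp_germ_def eventually_at_filter)
  ultimately have "((\<lambda>y. exp_germ p y / y) \<longlongrightarrow> 0) (at 0)"
    by (simp add: filterlim_at_split)
  then have "(exp_germ p has_real_derivative 0) (at 0)"
    by (simp add: has_field_derivative_iff exp_germ_def)
  then show ?thesis using equal by (simp add: exp_germ_def)
qed

lemma times_differentiable_exp_germ: "times_differentiable n (exp_germ p)"
  by (induction n arbitrary: p) (auto intro: DERIV_exp_germ)

lemma antiderivative_exists:
  assumes "locally_integrable f"
  shows "\<exists>F. \<forall>x y. x \<le> y \<longrightarrow> F y - F x = integral {x..y} f"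
proof -
  define F where "F x = (if 0 \<le> x then integral {0..x} f else - integral {x..0} f)" for x
  note comb = Henstock_Kurzweil_Integration.integral_combine[OF _ _ locally_integrable_on[OF assms]]
  have "F y - F x = integral {x..y} f" if "x \<le> y" for x y
    using that comb[of 0 x y] comb[of x 0 y] comb[of x y 0]
    by (cases "0 \<le> x"; cases "0 \<le> y") (auto simp: F_def)
  then show ?thesis by blast
qed

text \<open>The step is the normalised primitive of a bump, the product of a flat germ at 0 and its
  mirror image at 1. Its derivative \<theta> is returned too because it is the mollifier used for
  the du Bois-Reymond lemma.\<close>

lemma smooth_step_exists:
  "\<exists>\<Theta> \<theta>. (\<forall>n. times_differentiable n \<Theta>) \<and> (\<forall>x. (\<Theta> has_real_derivative \<theta> x) (at x)) \<and>
     continuous_on UNIV \<theta> \<and> (\<forall>x. \<theta> x \<ge> 0) \<and> (\<forall>x. 0 \<le> \<Theta> x \<and> \<Theta> x \<le> 1) \<and>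
     (\<forall>x\<le>0. \<Theta> x = 0) \<and> (\<forall>x\<ge>1. \<Theta> x = 1) \<and> (\<forall>x. x \<notin> {0..1} \<longrightarrow> \<theta> x = (0::real))"
proof -
  define \<eta> where "\<eta> x = exp_germ 1 x * exp_germ 1 (1 - x)" for x
  have sm: "times_differentiable n \<eta>" for n
    unfolding \<eta>_def
    using times_differentiable_mult[OF times_differentiable_exp_germ
        times_differentiable_affine[OF times_differentiable_exp_germ], of n 1 1 "-1" 1] by simp
  have nonneg: "\<eta> x \<ge> 0" for x by (simp add: \<eta>_def exp_germ_def)
  have pos: "\<eta> x > 0" if "0 < x" "x < 1" for x using that by (simp add: \<eta>_def exp_germ_def)
  have out: "\<eta> x = 0" if "x \<le> 0 \<or> 1 \<le> x" for x using that by (auto simp: \<eta>_def exp_germ_def)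
  have cont: "continuous_on UNIV \<eta>"
    using sm[of 1] by (auto intro!: continuous_at_imp_continuous_on intro: DERIV_isCont)
  obtain F where F: "\<And>x y. x \<le> y \<Longrightarrow> F y - F x = integral {x..y} \<eta>"
    using antiderivative_exists[OF continuous_imp_locally_integrable[OF cont]] by blast
  have dF: "(F has_real_derivative \<eta> x) (at x)" for x
    by (rule has_deriv_if_integral[OF cont F])
  have mono: "F x \<le> F y" if "x \<le> y" for x y
    using that by (rule DERIV_nonneg_imp_nondecreasing) (use dF nonneg in blast)
  have lt: "F 0 < F 1"
    by (rule DERIV_pos_imp_increasing_open)
       (use dF pos in \<open>auto intro!: continuous_at_imp_continuous_on DERIV_isCont\<close>)
  have left: "F x = F 0" if "x \<le> 0" for x
  proof -
    have "integral {x..0} \<eta> = integral {x..0} (\<lambda>x. 0)"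
      by (rule integral_cong) (use out in auto)
    then show ?thesis using F[OF that] by simp
  qed
  have right: "F x = F 1" if "x \<ge> 1" for x
  proof -
    have "integral {1..x} \<eta> = integral {1..x} (\<lambda>x. 0)"
      by (rule integral_cong) (use out in auto)
    then show ?thesis using F[OF that] by simp
  qed
  define d where "d = F 1 - F 0"
  have d: "d > 0" using lt by (simp add: d_def)
  define \<Theta> where "\<Theta> x = (F x - F 0) / d" for x
  define \<theta> where "\<theta> x = \<eta> x / d" for x
  have d\<Theta>: "(\<Theta> has_real_derivative \<theta> x) (at x)" for x
    unfolding \<Theta>_def \<theta>_def using d by (auto intro!: derivative_eq_intros dF)
  have "times_differentiable n \<theta>" for n
    unfolding \<theta>_def using times_differentiable_mult[OF sm times_differentiable_const[of n "1/d"]] by simp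
  then have "times_differentiable n \<Theta>" for n
    using d\<Theta> by (cases n) auto
  moreover have "0 \<le> \<Theta> x \<and> \<Theta> x \<le> 1" for x
  proof -
    have "F 0 \<le> F x \<and> F x \<le> F 1"
      using mono[of 0 x] mono[of x 1] left[of x] right[of x] lt
      by (cases "x \<le> 0"; cases "x \<ge> 1") auto
    then show ?thesis using d by (simp add: \<Theta>_def) (simp add: d_def)
  qed
  moreover have "continuous_on UNIV \<theta>"
    unfolding \<theta>_def using d by (intro continuous_intros cont) auto
  moreover have "\<theta> x \<ge> 0" for x using nonneg d by (simp add: \<theta>_def)
  moreover have "\<Theta> x = 0" if "x \<le> 0" for x using left[OF that] by (simp add: \<Theta>_def)
  moreover have "\<Theta> x = 1" if "x \<ge> 1" for x using right[OF that] d by (simp add: \<Theta>_def d_def)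
  moreover have "\<theta> x = 0" if "x \<notin> {0..1}" for x using out[of x] that by (auto simp: \<theta>_def)
  ultimately show ?thesis using d\<Theta> by (intro exI[of _ \<Theta>] exI[of _ \<theta>]) auto
qed

section \<open>Weak derivatives\<close>

lemma locally_integrable_mult_continuous:
  assumes "locally_integrable f" "continuous_on UNIV h"
  shows "locally_integrable (\<lambda>x. f x * h x)"
  unfolding locally_integrable_def
proof (intro allI)
  fix a b :: real
  have "(\<lambda>x. h x * f x) absolutely_integrable_on {a..b}"
  proof (rule absolutely_integrable_bounded_measurable_product_real)
    have c: "continuous_on {a..b} h" using assms(2) continuous_on_subset by blast
    show "h \<in> borel_measurable (lebesgue_on {a..b})"
      by (rule continuous_imp_measurable_on_sets_lebesgue[OF c]) simp
    show "bounded (h ` {a..b})"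
      using compact_continuous_image[OF c] compact_imp_bounded by blast
    show "f absolutely_integrable_on {a..b}" using assms(1) by (rule locally_integrable_abs_on)
  qed simp
  then show "(\<lambda>x. f x * h x) absolutely_integrable_on {a..b}" by (simp add: mult.commute)
qed

lemma locally_integrable_add:
  "locally_integrable f \<Longrightarrow> locally_integrable g \<Longrightarrow> locally_integrable (\<lambda>x. f x + g x)"
  by (simp add: locally_integrable_def set_integral_add)

lemma locally_integrable_diff:
  "locally_integrable f \<Longrightarrow> locally_integrable g \<Longrightarrow> locally_integrable (\<lambda>x. f x - g x)"
  by (simp add: locally_integrable_def set_integral_diff)

section \<open>Integration by parts for primitives of locally integrable functions\<close>

lemma constant_if_superadditive_bound:
  fixes T V :: "real \<Rightarrow> real"
  assumes "a \<le> b" and bd: "\<And>x y. a \<le> x \<Longrightarrow> x \<le> y \<Longrightarrow> y \<le> b \<Longrightarrow> \<bar>T y - T x\<bar> \<le> C * (y - x) * (V y - V x)"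
  shows "T b = T a"
proof -
  have bound: "\<bar>T b - T a\<bar> \<le> C * (b - a) * (V b - V a) / real (Suc n)" for n
  proof -
    \<comment> \<open>On a partition into equal steps h the bounds add up to C h (V b - V a),
      because V telescopes; refining the partition sends this to 0.\<close>
    define h where "h = (b - a) / real (Suc n)"
    have h: "h \<ge> 0" "real (Suc n) * h = b - a" using assms(1) by (auto simp: h_def)
    define X where "X k = a + real k * h" for k
    have X: "X 0 = a" "X (Suc n) = b" using h by (auto simp: X_def)
    have step: "X (Suc k) - X k = h" for k by (simp add: X_def algebra_simps)
    have rng: "a \<le> X k" "X (Suc k) \<le> b" if "k < Suc n" for k
    proof -
      show "a \<le> X k" using h by (simp add: X_def)
      have "real (Suc k) * h \<le> real (Suc n) * h" using that h by (intro mult_right_mono) auto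
      then show "X (Suc k) \<le> b" using h by (simp add: X_def)
    qed
    have "T b - T a = (\<Sum>k<Suc n. T (X (Suc k)) - T (X k))"
      using sum_lessThan_telescope[of "\<lambda>k. T (X k)" "Suc n"] X by simp
    also have "\<bar>\<dots>\<bar> \<le> (\<Sum>k<Suc n. \<bar>T (X (Suc k)) - T (X k)\<bar>)" by (rule sum_abs)
    also have "\<dots> \<le> (\<Sum>k<Suc n. C * h * (V (X (Suc k)) - V (X k)))"
    proof (rule sum_mono)
      fix k assume "k \<in> {..<Suc n}"
      then show "\<bar>T (X (Suc k)) - T (X k)\<bar> \<le> C * h * (V (X (Suc k)) - V (X k))"
        using bd[of "X k" "X (Suc k)"] rng[of k] step[of k] h by simp
    qed
    also have "\<dots> = C * h * (V b - V a)"
      using sum_lessThan_telescope[of "\<lambda>k. V (X k)" "Suc n"] X by (simp add: sum_distrib_left[symmetric])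
    finally show ?thesis by (simp add: h_def)
  qed
  have "(\<lambda>n. C * (b - a) * (V b - V a) / real (Suc n)) \<longlonglongrightarrow> 0"
    by (rule LIMSEQ_Suc[OF lim_const_over_n])
  then have "\<bar>T b - T a\<bar> \<le> 0"
    by (rule LIMSEQ_le_const) (use bound in blast)
  then show ?thesis by simp
qed

lemma integration_by_parts_antideriv:
  fixes F f \<phi> \<phi>' :: "real \<Rightarrow> real"
  assumes ab: "a \<le> b" and f: "locally_integrable f"
    and F: "\<And>x y. x \<le> y \<Longrightarrow> F y - F x = integral {x..y} f"
    and \<phi>: "\<And>x. (\<phi> has_real_derivative \<phi>' x) (at x)" and c: "continuous_on UNIV \<phi>'"
  shows "F b * \<phi> b - F a * \<phi> a = integral {a..b} (\<lambda>x. F x * \<phi>' x) + integral {a..b} (\<lambda>x. f x * \<phi> x)"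
proof -
  have cF: "continuous_on UNIV F" using continuous_on_if_integral[OF f F] .
  have c\<phi>: "continuous_on UNIV \<phi>" using \<phi> by (meson DERIV_isCont continuous_at_imp_continuous_on)
  define w where "w x = F x * \<phi>' x + f x * \<phi> x" for x
  have i1: "locally_integrable (\<lambda>x. F x * \<phi>' x)"
    by (intro continuous_imp_locally_integrable continuous_intros cF c)
  have i2: "locally_integrable (\<lambda>x. f x * \<phi> x)"
    by (rule locally_integrable_mult_continuous[OF f c\<phi>])
  have iw: "locally_integrable w" unfolding w_def by (rule locally_integrable_add[OF i1 i2])
  obtain M where M: "\<And>x. x \<in> {a..b} \<Longrightarrow> \<bar>\<phi>' x\<bar> \<le> M"
  proof -
    have "compact (\<phi>' ` {a..b})" using c by (intro compact_continuous_image) (auto intro: continuous_on_subset)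
    then have "bounded (\<phi>' ` {a..b})" by (rule compact_imp_bounded)
    then obtain B where "\<forall>x\<in>{a..b}. \<bar>\<phi>' x\<bar> \<le> B" unfolding bounded_iff by auto
    then show ?thesis using that[of B] by blast
  qed
  have M0: "M \<ge> 0" using M[of a] ab by simp
  obtain W where W: "\<And>x y. x \<le> y \<Longrightarrow> W y - W x = integral {x..y} w"
    using antiderivative_exists[OF iw] by blast
  obtain V where V: "\<And>x y. x \<le> y \<Longrightarrow> V y - V x = integral {x..y} (\<lambda>t. \<bar>f t\<bar>)"
    using antiderivative_exists[of "\<lambda>t. \<bar>f t\<bar>"] f unfolding locally_integrable_def
    by (auto intro: set_integrable_abs)
  define T where "T x = F x * \<phi> x - W x" for x
  have "T b = T a"
  proof (rule constant_if_superadditive_bound[OF ab, of T "2 * M" V])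
    fix x y assume xy: "a \<le> x" "x \<le> y" "y \<le> b"
    \<comment> \<open>\<open>?u\<close> integrates to the increment of T: freezing F at y and \<phi>
      at x produces F y \<phi> y - F x \<phi> x, and each remaining term has one small factor,
      bounded by the variation V of F or by M times the length.\<close>
    let ?u = "\<lambda>t. (F y - F t) * \<phi>' t + f t * (\<phi> x - \<phi> t)"
    have "((\<lambda>t. F y * \<phi>' t) has_integral F y * \<phi> y - F y * \<phi> x) {x..y}"
      by (rule fundamental_theorem_of_calculus[OF xy(2)])
         (auto intro!: DERIV_cmult \<phi> simp: has_real_derivative_iff_has_vector_derivative[symmetric]
            intro: has_field_derivative_at_within)
    moreover have "((\<lambda>t. f t * \<phi> x) has_integral (F y - F x) * \<phi> x) {x..y}"
      using locally_integrable_on[OF f, of x y] F[OF xy(2)] by (metis has_integral_integral has_integral_mult_left)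
    moreover have "(w has_integral W y - W x) {x..y}"
      using locally_integrable_on[OF iw, of x y] W[OF xy(2)] by (metis has_integral_integral)
    ultimately have "((\<lambda>t. F y * \<phi>' t + f t * \<phi> x - w t) has_integral
        (F y * \<phi> y - F y * \<phi> x) + (F y - F x) * \<phi> x - (W y - W x)) {x..y}"
      by (intro has_integral_diff has_integral_add)
    then have "(?u has_integral T y - T x) {x..y}"
      by (simp add: w_def T_def algebra_simps)
    then have eq: "T y - T x = integral {x..y} ?u" "?u integrable_on {x..y}" by (auto simp: integral_unique)
    have "norm (integral {x..y} ?u) \<le> integral {x..y} (\<lambda>t. (V y - V x) * M + \<bar>f t\<bar> * (M * (y - x)))"
    proof (rule integral_norm_bound_integral[OF eq(2)])
      show "(\<lambda>t. (V y - V x) * M + \<bar>f t\<bar> * (M * (y - x))) integrable_on {x..y}"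
        by (intro integrable_add integrable_on_mult_left locally_integrable_abs_integrable_on f) auto
      fix t assume t: "t \<in> {x..y}"
      have "\<bar>F y - F t\<bar> \<le> V y - V x"
        using F[of t y] V[of x y] abs_integral_le[OF f, of t y] integral_abs_mono[OF f, of t y x y] t by simp
      then have "\<bar>(F y - F t) * \<phi>' t\<bar> \<le> (V y - V x) * M"
        unfolding abs_mult using M[of t] t xy by (intro mult_mono) auto
      moreover have "\<bar>\<phi> x - \<phi> t\<bar> \<le> M * (y - x)"
      proof -
        have "norm (\<phi> x - \<phi> t) \<le> M * norm (x - t)"
        proof (rule field_differentiable_bound[of "{a..b}"])
          show "(\<phi> has_field_derivative \<phi>' z) (at z within {a..b})" for z
            using \<phi> by (rule has_field_derivative_at_within)
        qed (use M t xy in auto)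
        also have "\<dots> \<le> M * (y - x)" using t M0 by (intro mult_left_mono) auto
        finally show ?thesis by simp
      qed
      then have "\<bar>f t * (\<phi> x - \<phi> t)\<bar> \<le> \<bar>f t\<bar> * (M * (y - x))"
        unfolding abs_mult by (intro mult_left_mono) auto
      ultimately show "norm (?u t) \<le> (V y - V x) * M + \<bar>f t\<bar> * (M * (y - x))" by simp
    qed
    also have "\<dots> = (V y - V x) * M * (y - x) + (V y - V x) * (M * (y - x))"
      using V[OF xy(2)] xy locally_integrable_abs_integrable_on[OF f, of x y]
      by (subst Henstock_Kurzweil_Integration.integral_add) (auto intro: integrable_on_mult_left)
    finally show "\<bar>T y - T x\<bar> \<le> 2 * M * (y - x) * (V y - V x)"
      using eq by (simp add: algebra_simps)
  qed
  then have "F b * \<phi> b - F a * \<phi> a = integral {a..b} w" using W[OF ab] by (simp add: T_def)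
  also have "\<dots> = integral {a..b} (\<lambda>x. F x * \<phi>' x) + integral {a..b} (\<lambda>x. f x * \<phi> x)"
    unfolding w_def by (intro Henstock_Kurzweil_Integration.integral_add locally_integrable_on i1 i2)
  finally show ?thesis .
qed

section \<open>Test functions, and chains as weak derivatives\<close>

lemma test_function_DERIV:
  assumes "test_function \<phi>"
  shows "(\<phi> has_real_derivative deriv \<phi> x) (at x)"
proof -
  have "(deriv ^^ 0) \<phi> field_differentiable (at x)" using assms unfolding test_function_def by blast
  then show ?thesis by (simp add: DERIV_deriv_iff_field_differentiable)
qed

lemma test_function_continuous: "test_function \<phi> \<Longrightarrow> continuous_on UNIV \<phi>"
  using test_function_DERIV by (meson DERIV_isCont continuous_at_imp_continuous_on)

lemma test_function_deriv:
  assumes "test_function \<phi>"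
  shows "test_function (deriv \<phi>)"
proof -
  obtain r where r: "\<And>x. \<bar>x\<bar> > r \<Longrightarrow> \<phi> x = 0" using assms unfolding test_function_def by blast
  have "deriv \<phi> x = 0" if "\<bar>x\<bar> > r" for x
  proof -
    have "((\<lambda>x. 0 :: real) has_real_derivative 0) (at x)" by simp
    then have "(\<phi> has_real_derivative 0) (at x)"
    proof (rule has_field_derivative_transform_within_open)
      show "open {x. \<bar>x\<bar> > r}" by (intro open_Collect_less continuous_intros)
    qed (use that r in auto)
    then show ?thesis by (rule DERIV_imp_deriv)
  qed
  moreover have "(deriv ^^ k) (deriv \<phi>) field_differentiable (at x)" for k x
  proof -
    have "(deriv ^^ (Suc k)) \<phi> field_differentiable (at x)" using assms unfolding test_function_def by blast
    then show ?thesis by (simp add: funpow_Suc_right del: funpow.simps)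
  qed
  ultimately show ?thesis unfolding test_function_def by blast
qed

lemma lebesgue_integral_compact_support:
  assumes "locally_integrable h" "\<And>x. x \<notin> {a..b} \<Longrightarrow> h x = 0"
  shows "(LINT x|lebesgue. h x) = integral {a..b} h"
proof -
  have "(LINT x|lebesgue. h x) = set_lebesgue_integral lebesgue {a..b} h"
    unfolding set_lebesgue_integral_def
    by (intro Bochner_Integration.integral_cong) (use assms(2) in \<open>auto simp: indicator_def\<close>)
  then show ?thesis
    using set_lebesgue_integral_eq_integral(2)[OF locally_integrable_abs_on[OF assms(1)]] by simp
qed

lemma weak_deriv_step:
  assumes f: "locally_integrable f"
    and F: "\<And>x y. x \<le> y \<Longrightarrow> F y - F x = integral {x..y} f"
    and \<phi>: "test_function \<phi>"
  shows "(LINT x|lebesgue. F x * deriv \<phi> x) = - (LINT x|lebesgue. f x * \<phi> x)"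
proof -
  obtain r0 where r0: "\<And>x. \<bar>x\<bar> > r0 \<Longrightarrow> \<phi> x = 0" using \<phi> unfolding test_function_def by blast
  obtain r1 where r1: "\<And>x. \<bar>x\<bar> > r1 \<Longrightarrow> deriv \<phi> x = 0"
    using test_function_deriv[OF \<phi>] unfolding test_function_def by blast
  define R where "R = \<bar>r0\<bar> + \<bar>r1\<bar> + 1"
  have R: "R > 0" by (simp add: R_def)
  have cF: "continuous_on UNIV F" using continuous_on_if_integral[OF f F] .
  have c: "continuous_on UNIV \<phi>" "continuous_on UNIV (deriv \<phi>)"
    using test_function_continuous \<phi> test_function_deriv by blast+
  have "(LINT x|lebesgue. F x * deriv \<phi> x) = integral {-R..R} (\<lambda>x. F x * deriv \<phi> x)"
    by (intro lebesgue_integral_compact_support continuous_imp_locally_integrable continuous_intros cF c)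
       (use r1 in \<open>auto simp: R_def\<close>)
  moreover have "(LINT x|lebesgue. f x * \<phi> x) = integral {-R..R} (\<lambda>x. f x * \<phi> x)"
    by (intro lebesgue_integral_compact_support locally_integrable_mult_continuous f c)
       (use r0 in \<open>auto simp: R_def\<close>)
  moreover have "\<phi> R = 0" "\<phi> (-R) = 0" using r0 by (auto simp: R_def)
  ultimately show ?thesis
    using integration_by_parts_antideriv[OF _ f F test_function_DERIV[OF \<phi>] c(2), of "-R" R] R by simp
qed

lemma chain_weak_integral:
  assumes "antideriv_chain m \<Phi>" "k \<le> m" "test_function \<phi>"
  shows "(LINT x|lebesgue. \<Phi> 0 x * (deriv ^^ k) \<phi> x) = (- 1) ^ k * (LINT x|lebesgue. \<Phi> k x * \<phi> x)"
  using assms(2,3)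
proof (induction k arbitrary: \<phi>)
  case (Suc k)
  have "(LINT x|lebesgue. \<Phi> 0 x * (deriv ^^ Suc k) \<phi> x) = (- 1) ^ k * (LINT x|lebesgue. \<Phi> k x * deriv \<phi> x)"
    using Suc.IH[OF _ test_function_deriv[OF Suc.prems(2)]] Suc.prems(1)
    by (simp add: funpow_Suc_right del: funpow.simps)
  also have "(LINT x|lebesgue. \<Phi> k x * deriv \<phi> x) = - (LINT x|lebesgue. \<Phi> (Suc k) x * \<phi> x)"
    by (rule weak_deriv_step[OF chain_integrable[OF assms(1)] chain_integral[OF assms(1)] Suc.prems(2)])
       (use Suc.prems(1) in auto)
  finally show ?case by simp
qed simp

lemma chain_imp_weak_deriv: "antideriv_chain m \<Phi> \<Longrightarrow> is_weak_deriv m (\<Phi> 0) (\<Phi> m)"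
  unfolding is_weak_deriv_def using chain_integrable[of m \<Phi>] chain_weak_integral[of m \<Phi> m] by auto

section \<open>Mollification and the du Bois-Reymond lemma\<close>

lemma approximate_identity:
  fixes \<Theta> \<theta> K :: "real \<Rightarrow> real"
  assumes d: "\<And>x. (\<Theta> has_real_derivative \<theta> x) (at x)" and c: "continuous_on UNIV \<theta>"
    and nonneg: "\<And>x. \<theta> x \<ge> 0" and out: "\<And>x. x \<notin> {0..1} \<Longrightarrow> \<theta> x = 0"
    and lim: "\<Theta> 0 = 0" "\<Theta> 1 = 1" and K: "continuous_on UNIV K"
  shows "(\<lambda>n. LINT t|lebesgue. K t * (real (Suc n) * \<theta> (real (Suc n) * (t - x)))) \<longlonglongrightarrow> K x"
proof (rule metric_LIMSEQ_I)
  fix e :: real assume e: "e > 0"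
  have "isCont K x" using K by (simp add: continuous_on_eq_continuous_at)
  then obtain \<delta> where \<delta>: "\<delta> > 0" "\<And>t. dist t x < \<delta> \<Longrightarrow> dist (K t) (K x) < e / 2"
    using e half_gt_zero unfolding continuous_at_eps_delta by metis
  obtain N where N: "inverse (real (Suc N)) < \<delta>" using reals_Archimedean[OF \<delta>(1)] by blast
  show "\<exists>no. \<forall>n\<ge>no. dist (LINT t|lebesgue. K t * (real (Suc n) * \<theta> (real (Suc n) * (t - x)))) (K x) < e"
  proof (intro exI allI impI)
    fix n assume n: "n \<ge> N"
    define s where "s = real (Suc n)"
    have s: "s > 0" by (simp add: s_def)
    have ss: "1 / s < \<delta>"
    proof -
      have "1 / s \<le> 1 / real (Suc N)" using n by (simp add: s_def frac_le)
      then show ?thesis using N by (simp add: inverse_eq_divide)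
    qed
    \<comment> \<open>The kernel is nonnegative, lives on [x, x + 1/s] and has mass \<Theta> 1 -
      \<Theta> 0 = 1; as 1/s < \<delta>, it averages K over points where K is within e/2 of K
      x.\<close>
    define k where "k t = s * \<theta> (s * (t - x))" for t
    have ck: "continuous_on UNIV k"
      unfolding k_def by (intro continuous_intros continuous_on_compose2[OF c]) auto
    have k0: "k t = 0" if "t \<notin> {x..x + 1 / s}" for t
    proof -
      have "s * (t - x) \<notin> {0..1}" using that s by (auto simp: field_simps zero_le_mult_iff)
      then show ?thesis using out by (simp add: k_def)
    qed
    have knn: "k t \<ge> 0" for t using nonneg s by (simp add: k_def)
    have "((\<lambda>t. \<Theta> (s * (t - x))) has_real_derivative k t) (at t)" for t
      unfolding k_def by (rule DERIV_chain2[OF d, THEN DERIV_cong]) (auto intro!: derivative_eq_intros)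
    then have "(k has_integral \<Theta> (s * (x + 1 / s - x)) - \<Theta> (s * (x - x))) {x..x + 1 / s}"
      using s by (intro fundamental_theorem_of_calculus)
       (auto simp: has_real_derivative_iff_has_vector_derivative[symmetric] intro: has_field_derivative_at_within)
    then have k1: "(k has_integral 1) {x..x + 1 / s}" using s lim by simp
    have Kk: "(LINT t|lebesgue. K t * k t) = integral {x..x + 1 / s} (\<lambda>t. K t * k t)"
      by (intro lebesgue_integral_compact_support continuous_imp_locally_integrable continuous_intros K ck)
         (use k0 in auto)
    have "(\<lambda>t. K t * k t) integrable_on {x..x + 1 / s}"
      by (intro locally_integrable_on continuous_imp_locally_integrable continuous_intros K ck)
    then have "((\<lambda>t. K t * k t - K x * k t) has_integral (LINT t|lebesgue. K t * k t) - K x * 1) {x..x + 1 / s}"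
      unfolding Kk by (intro has_integral_diff has_integral_mult_right k1) auto
    moreover have "((\<lambda>t. e / 2 * k t) has_integral e / 2 * 1) {x..x + 1 / s}"
      by (intro has_integral_mult_right k1)
    moreover have "norm (K t * k t - K x * k t) \<le> e / 2 * k t" if t: "t \<in> {x..x + 1 / s}" for t
    proof -
      have "\<bar>K t - K x\<bar> \<le> e / 2" using \<delta>(2)[of t] t ss by (auto simp: dist_real_def)
      then have "\<bar>K t - K x\<bar> * k t \<le> e / 2 * k t" using knn by (intro mult_right_mono)
      moreover have "norm (K t * k t - K x * k t) = \<bar>K t - K x\<bar> * k t"
        using knn[of t] by (simp add: left_diff_distrib[symmetric] abs_mult)
      ultimately show ?thesis by simp
    qed
    ultimately have "norm ((LINT t|lebesgue. K t * k t) - K x * 1) \<le> e / 2 * 1"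
      by (metis (no_types, lifting) has_integral_iff integral_norm_bound_integral)
    then show "dist (LINT t|lebesgue. K t * (real (Suc n) * \<theta> (real (Suc n) * (t - x)))) (K x) < e"
      using e by (simp add: k_def s_def dist_real_def)
  qed
qed

text \<open>\<open>\<phi> n\<close> is a difference of two smooth steps of width at most 1, starting
  at x and at y; their derivatives are approximate identities at x and y. A step vanishes at its
  starting point, which is why the limit is the indicator of a half-open interval. The common bound
  and support allow dominated convergence.\<close>

lemma test_functions_approximating_indicator:
  assumes "x < y"
  shows "\<exists>\<phi> :: nat \<Rightarrow> real \<Rightarrow> real. (\<forall>n. test_function (\<phi> n)) \<and> (\<forall>n t. \<bar>\<phi> n t\<bar> \<le> 1) \<and>
    (\<forall>n t. t \<notin> {x..y+1} \<longrightarrow> \<phi> n t = 0) \<and> (\<forall>t. (\<lambda>n. \<phi> n t) \<longlonglongrightarrow> indicator {x<..y} t) \<and>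
    (\<forall>K. continuous_on UNIV K \<longrightarrow> (\<lambda>n. LINT t|lebesgue. K t * deriv (\<phi> n) t) \<longlonglongrightarrow> K x - K y)"
proof -
  obtain \<Theta> \<theta> :: "real \<Rightarrow> real" where
    sm: "\<And>n. times_differentiable n \<Theta>" and d: "\<And>x. (\<Theta> has_real_derivative \<theta> x) (at x)" and
    c: "continuous_on UNIV \<theta>" and nonneg: "\<And>x. \<theta> x \<ge> 0" and
    bd: "\<And>x. 0 \<le> \<Theta> x \<and> \<Theta> x \<le> 1" and left: "\<And>x. x \<le> 0 \<Longrightarrow> \<Theta> x = 0" and
    right: "\<And>x. x \<ge> 1 \<Longrightarrow> \<Theta> x = 1" and out: "\<And>x. x \<notin> {0..1} \<Longrightarrow> \<theta> x = 0"
    using smooth_step_exists by blast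
  define S where "S z n t = \<Theta> (real (Suc n) * (t - z))" for z n t
  define \<phi> where "\<phi> n t = S x n t - S y n t" for n t
  define k where "k z n t = real (Suc n) * \<theta> (real (Suc n) * (t - z))" for z n t
  have dS: "(S z n has_real_derivative k z n t) (at t)" for z n t
    unfolding S_def k_def by (rule DERIV_chain2[OF d, THEN DERIV_cong]) (auto intro!: derivative_eq_intros)
  have d\<phi>: "(\<phi> n has_real_derivative k x n t - k y n t) (at t)" for n t
    unfolding \<phi>_def by (intro DERIV_diff dS)
  have smS: "times_differentiable j (S z n)" for j z n
    using times_differentiable_affine[OF sm, of j "real (Suc n)" "- real (Suc n) * z"]
    by (simp add: S_def[abs_def] algebra_simps)
  have "times_differentiable j (\<lambda>t. S x n t + (-1) * S y n t)" for j n
    by (intro times_differentiable_add times_differentiable_mult times_differentiable_const smS)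
  then have sm\<phi>: "times_differentiable j (\<phi> n)" for j n
    by (simp add: \<phi>_def[abs_def])
  have supp: "\<phi> n t = 0" if "t \<notin> {x..y+1}" for n t
  proof (cases "t < x")
    case True
    then have "real (Suc n) * (t - x) \<le> 0" "real (Suc n) * (t - y) \<le> 0"
      using assms by (auto intro!: mult_nonneg_nonpos)
    then show ?thesis using left by (simp add: \<phi>_def S_def)
  next
    case False
    have ge: "1 * 1 \<le> real (Suc n) * (t - z)" if "t - z \<ge> 1" for z
      using that by (intro mult_mono) auto
    have "1 \<le> real (Suc n) * (t - x)" "1 \<le> real (Suc n) * (t - y)"
      using ge[of x] ge[of y] False that assms by auto
    then show ?thesis using right by (simp add: \<phi>_def S_def)
  qed
  have "test_function (\<phi> n)" for n
    unfolding test_function_def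
  proof (intro conjI allI exI[of _ "\<bar>x\<bar> + \<bar>y\<bar> + 1"] impI)
    show "(deriv ^^ k) (\<phi> n) field_differentiable at t" for k t
      by (rule times_differentiable_imp[OF sm\<phi>])
    show "\<phi> n t = 0" if "\<bar>x\<bar> + \<bar>y\<bar> + 1 < \<bar>t\<bar>" for t
      by (rule supp) (use that in auto)
  qed
  moreover have "\<bar>\<phi> n t\<bar> \<le> 1" for n t
    using bd[of "real (Suc n) * (t - x)"] bd[of "real (Suc n) * (t - y)"] by (simp add: \<phi>_def S_def abs_le_iff)
  moreover have "(\<lambda>n. S z n t) \<longlonglongrightarrow> indicator {z<..} t" for z t
  proof (cases "t \<le> z")
    case True
    then have "S z n t = 0" for n
      unfolding S_def by (intro left) (auto intro!: mult_nonneg_nonpos)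
    then show ?thesis using True by simp
  next
    case False
    then obtain N where N: "inverse (real (Suc N)) < t - z" using reals_Archimedean[of "t - z"] by auto
    have "S z n t = 1" if "n \<ge> N" for n
      unfolding S_def
    proof (rule right)
      have "1 = real (Suc N) * inverse (real (Suc N))" by simp
      also have "\<dots> \<le> real (Suc n) * (t - z)" using N that by (intro mult_mono) auto
      finally show "1 \<le> real (Suc n) * (t - z)" .
    qed
    then have "\<forall>\<^sub>F n in sequentially. S z n t = 1" by (auto simp: eventually_sequentially)
    then show ?thesis using False by (simp add: tendsto_eventually)
  qed
  note limS = this
  have "(\<lambda>n. \<phi> n t) \<longlonglongrightarrow> indicator {x<..y} t" for t
  proof -
    have "(\<lambda>n. \<phi> n t) \<longlonglongrightarrow> indicator {x<..} t - indicator {y<..} t"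
      unfolding \<phi>_def by (intro tendsto_diff limS)
    moreover have "indicator {x<..} t - indicator {y<..} t = (indicator {x<..y} t :: real)"
      using assms by (auto simp: indicator_def)
    ultimately show ?thesis by simp
  qed
  moreover have "(\<lambda>n. LINT t|lebesgue. K t * deriv (\<phi> n) t) \<longlonglongrightarrow> K x - K y" if K: "continuous_on UNIV K" for K
  proof -
    have ck: "continuous_on UNIV (k z n)" for z n
      unfolding k_def by (intro continuous_intros continuous_on_compose2[OF c]) auto
    have int: "integrable lebesgue (\<lambda>t. K t * k z n t)" for z n
    proof -
      have "set_integrable lebesgue {z..z+1} (\<lambda>t. K t * k z n t)"
        by (intro locally_integrable_abs_on continuous_imp_locally_integrable continuous_intros K ck)
      moreover have "k z n t = 0" if "t \<notin> {z..z+1}" for t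
      proof -
        have "real (Suc n) * (t - z) \<notin> {0..1}"
        proof
          assume *: "real (Suc n) * (t - z) \<in> {0..1}"
          then have "t \<ge> z" by (auto simp: zero_le_mult_iff)
          then have "1 * (t - z) \<le> real (Suc n) * (t - z)" by (intro mult_right_mono) auto
          then show False using * that \<open>t \<ge> z\<close> by auto
        qed
        then show ?thesis using out by (simp add: k_def)
      qed
      then have "(\<lambda>t. indicator {z..z+1} t *\<^sub>R (K t * k z n t)) = (\<lambda>t. K t * k z n t)"
        by (intro ext) (auto simp: indicator_def)
      ultimately show ?thesis unfolding set_integrable_def by (simp only:)
    qed
    have "deriv (\<phi> n) t = k x n t - k y n t" for n t
      by (rule DERIV_imp_deriv[OF d\<phi>])
    then have "(LINT t|lebesgue. K t * deriv (\<phi> n) t) =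
        (LINT t|lebesgue. K t * k x n t) - (LINT t|lebesgue. K t * k y n t)" for n
      using Bochner_Integration.integral_diff[OF int int] by (simp add: right_diff_distrib)
    moreover have "(\<lambda>n. (LINT t|lebesgue. K t * k x n t) - (LINT t|lebesgue. K t * k y n t)) \<longlonglongrightarrow> K x - K y"
      unfolding k_def using left[of 0] right[of 1]
      by (intro tendsto_diff approximate_identity[of \<Theta> \<theta>] d c nonneg out K) auto
    ultimately show ?thesis by simp
  qed
  ultimately show ?thesis using supp by blast
qed

text \<open>The du Bois-Reymond lemma, by testing against smooth approximations of the indicator
  functions of intervals.\<close>

lemma weak_deriv_imp_integral:
  assumes K: "continuous_on UNIV K" and g: "locally_integrable g"
    and weak: "\<And>\<phi>. test_function \<phi> \<Longrightarrow> (LINT t|lebesgue. K t * deriv \<phi> t) = - (LINT t|lebesgue. g t * \<phi> t)"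
    and xy: "x \<le> y"
  shows "K y - K x = integral {x..y} g"
proof (cases "x = y")
  case False
  then have "x < y" using xy by simp
  from test_functions_approximating_indicator[OF \<open>x < y\<close>]
  obtain \<phi> :: "nat \<Rightarrow> real \<Rightarrow> real" where
    \<phi>: "\<forall>n. test_function (\<phi> n)" "\<forall>n t. \<bar>\<phi> n t\<bar> \<le> 1"
      "\<forall>n t. t \<notin> {x..y+1} \<longrightarrow> \<phi> n t = 0" "\<forall>t. (\<lambda>n. \<phi> n t) \<longlonglongrightarrow> indicator {x<..y} t"
      "\<forall>K. continuous_on UNIV K \<longrightarrow> (\<lambda>n. LINT t|lebesgue. K t * deriv (\<phi> n) t) \<longlonglongrightarrow> K x - K y"
    by (elim exE conjE) (rule that)
  have t: "test_function (\<phi> n)" and bd: "\<bar>\<phi> n t\<bar> \<le> 1" for n t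
    using \<phi>(1,2) by auto
  have supp: "\<phi> n t = 0" if "t \<notin> {x..y+1}" for n t
    using \<phi>(3) that by blast
  have lim: "(\<lambda>n. \<phi> n t) \<longlonglongrightarrow> indicator {x<..y} t" for t
    using \<phi>(4) by blast
  have limK: "(\<lambda>n. LINT t|lebesgue. K t * deriv (\<phi> n) t) \<longlonglongrightarrow> K x - K y"
    using \<phi>(5) K by blast
  \<comment> \<open>Cutting g to the common support leaves the products with \<open>\<phi> n\<close>
    unchanged and gives an integrable majorant.\<close>
  define w where "w t = indicator {x..y+1} t *\<^sub>R g t" for t
  have wint: "integrable lebesgue w"
    using locally_integrable_abs_on[OF g, of x "y+1"] unfolding w_def set_integrable_def .
  have eq: "g t * \<phi> n t = w t * \<phi> n t" for n t
    using supp[of t n] by (auto simp: w_def indicator_def)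
  have eq': "g t * indicator {x<..y} t = w t * indicator {x<..y} t" for t
    by (auto simp: w_def indicator_def)
  have wm: "w \<in> borel_measurable lebesgue" using wint by simp
  have "(\<lambda>n. LINT t|lebesgue. w t * \<phi> n t) \<longlonglongrightarrow> (LINT t|lebesgue. w t * indicator {x<..y} t)"
  proof (rule integral_dominated_convergence[where w = "\<lambda>t. \<bar>w t\<bar>"])
    have "\<phi> n \<in> borel_measurable lebesgue" for n
      by (intro measurable_completion) (simp add: borel_measurable_continuous_onI test_function_continuous[OF t])
    then show "(\<lambda>t. w t * \<phi> n t) \<in> borel_measurable lebesgue" for n
      using wm by measurable
    show "(\<lambda>t. w t * indicator {x<..y} t) \<in> borel_measurable lebesgue"
      by (intro borel_measurable_times wm borel_measurable_indicator) simp
    show "integrable lebesgue (\<lambda>t. \<bar>w t\<bar>)" using wint by simp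
    show "AE t in lebesgue. (\<lambda>n. w t * \<phi> n t) \<longlonglongrightarrow> w t * indicator {x<..y} t"
      by (intro AE_I2 tendsto_mult tendsto_const lim)
    show "AE t in lebesgue. norm (w t * \<phi> n t) \<le> \<bar>w t\<bar>" for n
      using bd by (intro AE_I2) (simp add: abs_mult mult_left_le)
  qed
  then have "(\<lambda>n. - (LINT t|lebesgue. K t * deriv (\<phi> n) t)) \<longlonglongrightarrow> (LINT t|lebesgue. g t * indicator {x<..y} t)"
    using weak[OF t] by (simp add: eq eq')
  then have "- (K x - K y) = (LINT t|lebesgue. g t * indicator {x<..y} t)"
    using LIMSEQ_unique tendsto_minus[OF limK] by blast
  also have "\<dots> = set_lebesgue_integral lebesgue {x<..y} g"
    unfolding set_lebesgue_integral_def by (simp add: mult.commute)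
  also have "\<dots> = integral {x<..y} g"
    by (rule set_lebesgue_integral_eq_integral(2))
       (rule set_integrable_subset[OF locally_integrable_abs_on[OF g, of x y]], auto)
  also have "\<dots> = integral {x..y} g"
    by (rule integral_spike_set) (auto intro: negligible_subset[of "{x}"])
  finally show ?thesis by simp
qed simp

section \<open>Sobolev functions as chains, and uniqueness of the weak derivative\<close>

lemma continuous_if_abs_continuous: "abs_continuous F \<Longrightarrow> continuous_on UNIV F"
  unfolding continuous_on_iff
proof (intro ballI allI impI)
  fix x e :: real assume F: "abs_continuous F" and e: "0 < e"
  obtain d where d: "d > 0" "\<And>D. finite D \<and> (\<forall>(a, b)\<in>D. a < b) \<and>
        disjoint_family_on (\<lambda>(a, b). {a<..<b}) D \<and> (\<Sum>(a, b)\<in>D. b - a) < d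
        \<Longrightarrow> (\<Sum>(a, b)\<in>D. \<bar>F b - F a\<bar>) < e"
    using F e unfolding abs_continuous_def by metis
  have one: "\<bar>F v - F u\<bar> < e" if "u < v" "v - u < d" for u v
    using d(2)[of "{(u, v)}"] that by (simp add: disjoint_family_on_def)
  have "dist (F y) (F x) < e" if "dist y x < d" for y
    using one[of x y] one[of y x] that e by (cases x y rule: linorder_cases) (auto simp: dist_real_def)
  then show "\<exists>d>0. \<forall>y\<in>UNIV. dist y x < d \<longrightarrow> dist (F y) (F x) < e" using d(1) by blast
qed

text \<open>The classical derivatives form a chain of length m-1, which moves m-1 derivatives off
  the test function in the weak identity. What remains says that g is the first weak derivative of
  the continuous \<open>(deriv ^^ (m - 1)) F\<close>, and the du Bois-Reymond lemma turns this into
  an integral formula.\<close>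

lemma sobolev_imp_chain:
  assumes m: "m \<ge> 1" and F: "F \<in> sobolev m p" and weak: "is_weak_deriv m F g"
  shows "antideriv_chain m (\<lambda>i. if i < m then (deriv ^^ i) F else g)"
proof -
  define G where "G i = (deriv ^^ i) F" for i
  obtain k where k: "m = Suc k" using m by (cases m) auto
  have diff: "(G i has_real_derivative G (Suc i) x) (at x)" if "i < k" for i x
  proof -
    have "(deriv ^^ i) F field_differentiable (at x)" using F that k unfolding sobolev_def by auto
    then show ?thesis by (simp add: G_def DERIV_deriv_iff_field_differentiable)
  qed
  have "abs_continuous (G k)" using F k unfolding sobolev_def G_def by simp
  then have ck: "continuous_on UNIV (G k)" by (rule continuous_if_abs_continuous)
  have cont: "continuous_on UNIV (G i)" if "i \<le> k" for i
    using that diff[of i] ck by (cases "i = k") (auto intro!: continuous_at_imp_continuous_on intro: DERIV_isCont)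
  have ftc: "G i y - G i x = integral {x..y} (G (Suc i))" if "i < k" "x \<le> y" for i x y
    using that diff[OF that(1)]
    by (intro integral_unique[symmetric] fundamental_theorem_of_calculus)
       (auto simp: has_real_derivative_iff_has_vector_derivative[symmetric] intro: has_field_derivative_at_within)
  have chain: "antideriv_chain k G"
    unfolding antideriv_chain_def using cont ftc by (auto intro: continuous_imp_locally_integrable)
  have g: "locally_integrable g" using weak by (simp add: is_weak_deriv_def)
  have "G k y - G k x = integral {x..y} g" if "x \<le> y" for x y
  proof (rule weak_deriv_imp_integral[OF ck g _ that])
    fix \<phi> assume \<phi>: "test_function \<phi>"
    have "(- 1) ^ k * (LINT t|lebesgue. G k t * deriv \<phi> t) = (LINT t|lebesgue. F t * (deriv ^^ k) (deriv \<phi>) t)"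
      using chain_weak_integral[OF chain order_refl test_function_deriv[OF \<phi>]] by (simp add: G_def)
    also have "\<dots> = (- 1) ^ m * (LINT t|lebesgue. g t * \<phi> t)"
      using weak \<phi> k unfolding is_weak_deriv_def by (simp add: funpow_Suc_right del: funpow.simps)
    finally show "(LINT t|lebesgue. G k t * deriv \<phi> t) = - (LINT t|lebesgue. g t * \<phi> t)"
      using k by (cases "even k") auto
  qed
  moreover have G_Suc: "deriv (G i) = G (Suc i)" for i by (simp add: G_def)
  ultimately show ?thesis
    unfolding antideriv_chain_def using cont ftc g k
    by (auto simp: G_def[symmetric] G_Suc less_Suc_eq intro: continuous_imp_locally_integrable)
qed

text \<open>After cutting to [-R, R], the Borel sets with vanishing integral include all half-lines
  and form a Dynkin system, so they are all Borel sets; up to null sets this covers all Lebesgue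
  sets. An integrable function with all set integrals 0 vanishes almost everywhere.\<close>

lemma AE_zero_if_integrals_zero:
  assumes h: "locally_integrable h" and zero: "\<And>x y. x \<le> y \<Longrightarrow> integral {x..y} h = 0"
  shows "AE x in lebesgue. h x = 0"
proof -
  have main: "AE x in lebesgue. indicator {-R..R} x * h x = 0" if R: "R > 0" for R :: real
  proof -
    define w where "w x = indicator {-R..R} x * h x" for x
    have w: "integrable lebesgue w"
      using locally_integrable_abs_on[OF h, of "-R" R] unfolding w_def set_integrable_def by simp
    have wA: "set_integrable lebesgue A w" if "A \<in> sets lebesgue" for A
      using integrable_mult_indicator[OF that w] by (simp add: set_integrable_def)
    have basic: "set_lebesgue_integral lebesgue {..a} w = 0" for a
    proof -
      have "set_lebesgue_integral lebesgue {..a} w = set_lebesgue_integral lebesgue {-R..min a R} h"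
        unfolding set_lebesgue_integral_def
        by (intro Bochner_Integration.integral_cong) (auto simp: w_def indicator_def)
      also have "\<dots> = integral {-R..min a R} h"
        by (rule set_lebesgue_integral_eq_integral(2)[OF locally_integrable_abs_on[OF h]])
      also have "\<dots> = 0" using zero[of "-R" "min a R"] by (cases "-R \<le> min a R") auto
      finally show ?thesis .
    qed
    have total: "set_lebesgue_integral lebesgue UNIV w = 0"
    proof -
      have "set_lebesgue_integral lebesgue UNIV w = set_lebesgue_integral lebesgue {..R} w"
        unfolding set_lebesgue_integral_def
        by (intro Bochner_Integration.integral_cong) (auto simp: w_def indicator_def)
      then show ?thesis using basic by simp
    qed
    have borel: "set_lebesgue_integral lebesgue A w = 0" if "A \<in> sigma_sets UNIV (range (\<lambda>a::real. {..a}))" for A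
    proof -
      have bor: "B \<in> sets lebesgue" if "B \<in> sigma_sets UNIV (range (\<lambda>a::real. {..a}))" for B
      proof -
        have "B \<in> sets borel" using that by (simp add: borel_eq_atMost)
        then show ?thesis by simp
      qed
      have "Int_stable (range (\<lambda>a::real. {..a}))"
        by (auto simp: Int_stable_def)
      then show ?thesis
      proof (rule sigma_sets_induct_disjoint[OF _ _ that])
        fix B assume "B \<in> range (\<lambda>a::real. {..a})"
        then show "set_lebesgue_integral lebesgue B w = 0" using basic by auto
      next
        fix B :: "real set"
        assume B: "B \<in> sigma_sets UNIV (range (\<lambda>a::real. {..a}))" "set_lebesgue_integral lebesgue B w = 0"
        have "set_lebesgue_integral lebesgue (B \<union> (UNIV - B)) w =
            set_lebesgue_integral lebesgue B w + set_lebesgue_integral lebesgue (UNIV - B) w"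
          using bor[OF B(1)] by (intro set_integral_Un wA) auto
        then show "set_lebesgue_integral lebesgue (UNIV - B) w = 0" using B(2) total by simp
      next
        fix A :: "nat \<Rightarrow> real set"
        assume A: "disjoint_family A" "range A \<subseteq> sigma_sets UNIV (range (\<lambda>a::real. {..a}))"
          "\<And>i. set_lebesgue_integral lebesgue (A i) w = 0"
        have "set_lebesgue_integral lebesgue (\<Union>i. A i) w = (\<Sum>i. set_lebesgue_integral lebesgue (A i) w)"
        proof (rule lebesgue_integral_countable_add)
          show Al: "A i \<in> sets lebesgue" for i using A(2) by (intro bor) auto
          show "set_integrable lebesgue (\<Union>i. A i) w" using Al by (intro wA) auto
        qed (use A(1) in \<open>auto simp: disjoint_family_on_def\<close>)
        then show "set_lebesgue_integral lebesgue (\<Union>i. A i) w = 0" using A(3) by simp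
      qed (auto simp: set_lebesgue_integral_def)
    qed
    have "set_lebesgue_integral lebesgue A w = 0" if A: "A \<in> sets lebesgue" for A
    proof -
      obtain S N N' where S: "A = S \<union> N" "N \<subseteq> N'" "N' \<in> null_sets lborel" "S \<in> sets lborel"
        using A by (rule sets_completionE)
      have "N' \<in> null_sets lebesgue" using S(3) by (rule null_sets_completionI)
      then have "AE x in lebesgue. x \<notin> N'" by (rule AE_not_in)
      then have "AE x in lebesgue. x \<in> A \<longleftrightarrow> x \<in> S" by eventually_elim (use S in auto)
      then have "set_lebesgue_integral lebesgue A w = set_lebesgue_integral lebesgue S w"
        using w A S(4) unfolding set_lebesgue_integral_def
        by (intro integral_cong_AE borel_measurable_scaleR borel_measurable_indicator) (auto simp: indicator_def elim!: eventually_mono)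
      then show ?thesis using borel[of S] S(4) by (simp add: borel_eq_atMost)
    qed
    then have "AE x in lebesgue. w x = 0"
      by (intro density_unique_real[OF w]) (auto simp: set_lebesgue_integral_def)
    then show ?thesis by (simp add: w_def)
  qed
  have "AE x in lebesgue. \<forall>n. indicator {-real (Suc n)..real (Suc n)} x * h x = 0"
    unfolding AE_all_countable by (intro allI main) simp
  then show ?thesis
  proof eventually_elim
    case (elim x)
    obtain n where "\<bar>x\<bar> < real n" using reals_Archimedean2 by blast
    then have "x \<in> {-real (Suc n)..real (Suc n)}" by auto
    then show ?case using elim[rule_format, of n] by simp
  qed
qed

text \<open>Both functions complete the same classical derivatives to a chain, so over every
  interval both integrate to the increment of the (m-1)-st derivative.\<close>

lemma weak_deriv_unique:
  assumes "m \<ge> 1" "F \<in> sobolev m p" "is_weak_deriv m F g" "is_weak_deriv m F h"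
  shows "AE x in lebesgue. g x = h x"
proof -
  have g: "locally_integrable g" and h: "locally_integrable h"
    using assms by (auto simp: is_weak_deriv_def)
  have "integral {x..y} (\<lambda>t. g t - h t) = 0" if "x \<le> y" for x y
    using chain_integral[OF sobolev_imp_chain[OF assms(1,2,3)], of "m - 1" x y]
      chain_integral[OF sobolev_imp_chain[OF assms(1,2,4)], of "m - 1" x y] assms(1) that
      Henstock_Kurzweil_Integration.integral_diff[OF locally_integrable_on[OF g] locally_integrable_on[OF h], of x y]
    by simp
  then have "AE x in lebesgue. g x - h x = 0"
    by (rule AE_zero_if_integrals_zero[OF locally_integrable_diff[OF g h]])
  then show ?thesis by simp
qed

lemma Lp_norm_cong_AE:
  assumes "g \<in> borel_measurable lebesgue" "h \<in> borel_measurable lebesgue" "AE x in lebesgue. g x = h x"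
  shows "Lp_norm p g = Lp_norm p h"
proof -
  have "esssup lebesgue (\<lambda>x. ereal \<bar>g x\<bar>) = esssup lebesgue (\<lambda>x. ereal \<bar>h x\<bar>)"
    by (rule esssup_AE_cong) (use assms in \<open>auto elim: eventually_mono\<close>)
  moreover have "(LINT x|lebesgue. \<bar>g x\<bar> powr q) = (LINT x|lebesgue. \<bar>h x\<bar> powr q)" for q
    by (rule integral_cong_AE) (use assms in \<open>auto elim: eventually_mono\<close>)
  ultimately show ?thesis by (simp add: Lp_norm_def)
qed

lemma locally_integrable_measurable:
  assumes "locally_integrable f"
  shows "f \<in> borel_measurable lebesgue"
proof (rule borel_measurable_LIMSEQ_real)
  show "(\<lambda>x. indicator {-real n..real n} x * f x) \<in> borel_measurable lebesgue" for n
    using locally_integrable_abs_on[OF assms, of "-real n" "real n"] unfolding set_integrable_def by simp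
  show "(\<lambda>n. indicator {-real n..real n} x * f x) \<longlonglongrightarrow> f x" for x
  proof (rule tendsto_eventually)
    show "\<forall>\<^sub>F n in sequentially. indicator {-real n..real n} x * f x = f x"
      using eventually_ge_at_top[of "nat \<lceil>\<bar>x\<bar>\<rceil>"]
      by eventually_elim (auto simp: indicator_def abs_le_iff nat_le_iff ceiling_le_iff)
  qed
qed

lemma sobolev_seminorm_eq:
  assumes "m \<ge> 1" "F \<in> sobolev m p" "is_weak_deriv m F g"
  shows "sobolev_seminorm m p F = Lp_norm p g"
proof -
  have s: "is_weak_deriv m F (SOME g. is_weak_deriv m F g)" 
    using someI[of "is_weak_deriv m F" g] assms(3) by simp
  show ?thesis
    unfolding sobolev_seminorm_def
    by (rule Lp_norm_cong_AE[OF _ _ weak_deriv_unique[OF assms(1,2) s assms(3)]])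
       (use s assms(3) in \<open>auto simp: is_weak_deriv_def intro: locally_integrable_measurable\<close>)
qed

section \<open>Gluing across limit points\<close>

lemma set_integral_zero_countable_UN:
  fixes f :: "real \<Rightarrow> real"
  assumes "countable \<C>" "pairwise disjnt \<C>" and meas: "\<And>C. C \<in> \<C> \<Longrightarrow> C \<in> sets lebesgue"
    and int: "set_integrable lebesgue (\<Union>\<C>) f"
    and zero: "\<And>C. C \<in> \<C> \<Longrightarrow> set_lebesgue_integral lebesgue C f = 0"
  shows "set_lebesgue_integral lebesgue (\<Union>\<C>) f = 0"
proof -
  \<comment> \<open>The family may be finite; the enumeration by all natural numbers is padded with
    the empty set.\<close>
  define A where "A n = (if n \<in> to_nat_on \<C> ` \<C> then from_nat_into \<C> n else {})" for n
  have A: "A n \<in> \<C> \<or> A n = {}" for n using assms(1) by (auto simp: A_def)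
  have inj: "inj_on (to_nat_on \<C>) \<C>" using assms(1) by (rule inj_on_to_nat_on)
  have disj: "A i \<inter> A j = {}" if "i \<noteq> j" for i j
  proof (cases "i \<in> to_nat_on \<C> ` \<C> \<and> j \<in> to_nat_on \<C> ` \<C>")
    case True
    then obtain C D where "C \<in> \<C>" "D \<in> \<C>" "i = to_nat_on \<C> C" "j = to_nat_on \<C> D" by auto
    then show ?thesis using that assms(1,2) True by (auto simp: A_def pairwise_def disjnt_def)
  qed (auto simp: A_def)
  have un: "(\<Union>n. A n) = \<Union>\<C>"
  proof
    show "(\<Union>n. A n) \<subseteq> \<Union>\<C>" using A by (force split: if_splits)
    show "\<Union>\<C> \<subseteq> (\<Union>n. A n)"
    proof
      fix x assume "x \<in> \<Union>\<C>"
      then obtain C where "C \<in> \<C>" "x \<in> C" by blast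
      then have "x \<in> A (to_nat_on \<C> C)" using assms(1) by (simp add: A_def)
      then show "x \<in> (\<Union>n. A n)" by blast
    qed
  qed
  have "set_lebesgue_integral lebesgue (\<Union>n. A n) f = (\<Sum>n. set_lebesgue_integral lebesgue (A n) f)"
  proof (rule lebesgue_integral_countable_add[OF _ disj])
    show "A n \<in> sets lebesgue" for n using A[of n] meas by auto
    show "set_integrable lebesgue (\<Union>n. A n) f" using int un by simp
  qed
  moreover have "set_lebesgue_integral lebesgue (A n) f = 0" for n
    using A[of n] zero by (auto simp: set_lebesgue_integral_def)
  ultimately show ?thesis using un by simp
qed

lemma closed_left_neighbour:
  fixes Z :: "real set"
  assumes "closed Z" "u \<in> Z" "u \<le> x"
  shows "\<exists>\<alpha>\<in>Z. u \<le> \<alpha> \<and> \<alpha> \<le> x \<and> {\<alpha><..x} \<inter> Z = {}"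
proof -
  have "compact (Z \<inter> {u..x})" using assms(1) by (intro closed_Int_compact) auto
  moreover have "Z \<inter> {u..x} \<noteq> {}" using assms by auto
  ultimately obtain \<alpha> where "\<alpha> \<in> Z \<inter> {u..x}" "\<forall>y\<in>Z \<inter> {u..x}. y \<le> \<alpha>"
    using compact_attains_sup by meson
  then show ?thesis by (intro bexI[of _ \<alpha>]) force+
qed

lemma closed_right_neighbour:
  fixes Z :: "real set"
  assumes "closed Z" "u \<in> Z" "x \<le> u"
  shows "\<exists>\<beta>\<in>Z. \<beta> \<le> u \<and> x \<le> \<beta> \<and> {x..<\<beta>} \<inter> Z = {}"
proof -
  have "compact (Z \<inter> {x..u})" using assms(1) by (intro closed_Int_compact) auto
  moreover have "Z \<inter> {x..u} \<noteq> {}" using assms by auto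
  ultimately obtain \<beta> where "\<beta> \<in> Z \<inter> {x..u}" "\<forall>y\<in>Z \<inter> {x..u}. \<beta> \<le> y"
    using compact_attains_inf by meson
  then show ?thesis by (intro bexI[of _ \<beta>]) force+
qed

lemma gaps_countable:
  fixes Z :: "real set"
  defines "\<G> \<equiv> {{\<alpha><..<\<beta>} | \<alpha> \<beta>. \<alpha> \<in> Z \<and> \<beta> \<in> Z \<and> \<alpha> < \<beta> \<and> {\<alpha><..<\<beta>} \<inter> Z = {}}"
  shows "countable \<G>" "pairwise disjnt \<G>"
proof -
  have eq: "\<alpha> = \<alpha>' \<and> \<beta> = \<beta>'" if "\<alpha> \<in> Z" "\<beta> \<in> Z" "\<alpha>' \<in> Z" "\<beta>' \<in> Z" "{\<alpha><..<\<beta>} \<inter> Z = {}" "{\<alpha>'<..<\<beta>'} \<inter> Z = {}"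
      "t \<in> {\<alpha><..<\<beta>}" "t \<in> {\<alpha>'<..<\<beta>'}" for \<alpha> \<beta> \<alpha>' \<beta>' t
    using that by (smt (verit) disjoint_iff greaterThanLessThan_iff)
  show p: "pairwise disjnt \<G>"
    unfolding pairwise_def disjnt_def
  proof (intro ballI impI)
    fix C D assume C: "C \<in> \<G>" and D: "D \<in> \<G>" and "C \<noteq> D"
    then show "C \<inter> D = {}" using eq unfolding \<G>_def by blast
  qed
  show "countable \<G>"
    by (rule countable_disjoint_open_subsets[OF _ p]) (auto simp: \<G>_def)
qed

text \<open>Let Z be the set of limit points of E, W a primitive of \<kappa> and \<Psi> = \<phi> -
  W. Near a point off Z there is no other point of E, so the hypothesis on gaps makes \<Psi> locally
  constant; its value extends to the ends of each component of the complement of Z, where \<phi> is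
  0. Hence \<kappa> has integral 0 over every bounded component, and by countable additivity over
  any interval between points of Z, since \<kappa> vanishes on Z itself. Continuity of \<phi> is a
  consequence, not an input.\<close>

lemma integral_formula_glue:
  fixes \<phi> \<kappa> :: "real \<Rightarrow> real"
  assumes \<kappa>: "locally_integrable \<kappa>"
    and gap: "\<And>x y. x < y \<Longrightarrow> {x<..<y} \<inter> E = {} \<Longrightarrow> \<phi> y - \<phi> x = integral {x..y} \<kappa>"
    and zero: "\<And>u. u islimpt E \<Longrightarrow> \<phi> u = 0" "\<And>u. u islimpt E \<Longrightarrow> \<kappa> u = 0"
    and lim: "\<And>u. u islimpt E \<Longrightarrow> (\<phi> \<longlongrightarrow> 0) (at u within E)"
    and xy: "x \<le> y"
  shows "\<phi> y - \<phi> x = integral {x..y} \<kappa>"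
proof -
  define Z where "Z = {u. u islimpt E}"
  have cZ: "closed Z" unfolding Z_def by (rule closed_limpts)
  obtain W where W: "\<And>x y. x \<le> y \<Longrightarrow> W y - W x = integral {x..y} \<kappa>"
    using antiderivative_exists[OF \<kappa>] by blast
  have cW: "continuous_on UNIV W" by (rule continuous_on_if_integral[OF \<kappa> W])
  define \<Psi> where "\<Psi> t = \<phi> t - W t" for t
  have \<Psi>gap: "\<Psi> t = \<Psi> s" if "{s<..<t} \<inter> E = {}" "s < t" for s t
    using gap[OF that(2,1)] W[of s t] that(2) by (simp add: \<Psi>_def)
  have const: "\<exists>c. \<forall>t\<in>S. \<Psi> t = c" if S: "convex S" "S \<inter> Z = {}" for S
  proof (rule has_field_derivative_zero_constant[OF S(1)])
    fix t assume "t \<in> S"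
    then have "\<not> t islimpt E" using S(2) by (auto simp: Z_def)
    then obtain e where e: "e > 0" "\<And>z. z \<in> E \<Longrightarrow> z \<noteq> t \<Longrightarrow> dist z t \<ge> e"
      unfolding islimpt_approachable by (meson not_le)
    have loc: "\<Psi> s = \<Psi> t" if "dist s t < e" for s
    proof (cases s t rule: linorder_cases)
      case less
      then have "{s<..<t} \<inter> E = {}" using e(2) that by (force simp: dist_real_def)
      then show ?thesis using \<Psi>gap less by metis
    next
      case greater
      then have "{t<..<s} \<inter> E = {}" using e(2) that by (force simp: dist_real_def)
      then show ?thesis using \<Psi>gap greater by metis
    qed simp
    have "((\<lambda>s. \<Psi> t) has_field_derivative 0) (at t within S)" by simp
    then show "(\<Psi> has_field_derivative 0) (at t within S)"
      by (rule has_field_derivative_transform_within[OF _ e(1) \<open>t \<in> S\<close>]) (use loc in auto)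
  qed
  \<comment> \<open>If E accumulates at u from inside the interval, the constant value passes to u
    along E by \<open>lim\<close>; otherwise a gap of E ends at u and the hypothesis on gaps reaches
    the endpoint.\<close>
  have endpoint: "\<Psi> u = c"
    if u: "u = \<alpha> \<or> u = \<beta>" "u \<in> Z" and ab: "\<alpha> < \<beta>" and c: "\<And>t. t \<in> {\<alpha><..<\<beta>} \<Longrightarrow> \<Psi> t = c" for u \<alpha> \<beta> c
  proof (cases "u islimpt (E \<inter> {\<alpha><..<\<beta>})")
    case True
    then have nt: "at u within (E \<inter> {\<alpha><..<\<beta>}) \<noteq> bot" using trivial_limit_within by blast
    have "(\<phi> \<longlongrightarrow> 0) (at u within (E \<inter> {\<alpha><..<\<beta>}))"
      using lim[of u] u(2) by (auto simp: Z_def intro: tendsto_within_subset)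
    moreover have "(W \<longlongrightarrow> W u) (at u within (E \<inter> {\<alpha><..<\<beta>}))"
      using cW by (meson continuous_on_def iso_tuple_UNIV_I subset_UNIV tendsto_within_subset)
    ultimately have "(\<Psi> \<longlongrightarrow> 0 - W u) (at u within (E \<inter> {\<alpha><..<\<beta>}))"
      unfolding \<Psi>_def by (rule tendsto_diff)
    moreover have "0 - W u = \<Psi> u" using zero(1)[of u] u(2) by (simp add: \<Psi>_def Z_def)
    moreover have "(\<Psi> \<longlongrightarrow> c) (at u within (E \<inter> {\<alpha><..<\<beta>}))"
      by (rule tendsto_eventually) (auto simp: eventually_at_filter c)
    ultimately show ?thesis using tendsto_unique[OF nt] by metis
  next
    case False
    then obtain e where e: "e > 0" "\<And>z. z \<in> E \<Longrightarrow> z \<in> {\<alpha><..<\<beta>} \<Longrightarrow> z \<noteq> u \<Longrightarrow> dist z u \<ge> e"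
      unfolding islimpt_approachable by (metis IntI not_le)
    define d where "d = min (e/2) ((\<beta> - \<alpha>)/2)"
    have d: "d > 0" "d < e" "d < \<beta> - \<alpha>"
      using e(1) ab by (simp_all add: d_def min_less_iff_disj)
    from u(1) show ?thesis
    proof
      assume ua: "u = \<alpha>"
      have "{u<..<u+d} \<inter> E = {}" using e(2) d ua by (force simp: dist_real_def)
      then show ?thesis using \<Psi>gap[of u "u+d"] c[of "u+d"] d ua by auto
    next
      assume ub: "u = \<beta>"
      have "{u-d<..<u} \<inter> E = {}" using e(2) d ub by (force simp: dist_real_def)
      then show ?thesis using \<Psi>gap[of "u-d" u] c[of "u-d"] d ub by auto
    qed
  qed
  have lim_gap: "integral {\<alpha>..\<beta>} \<kappa> = 0" if g: "\<alpha> \<in> Z" "\<beta> \<in> Z" "\<alpha> < \<beta>" "{\<alpha><..<\<beta>} \<inter> Z = {}" for \<alpha> \<beta>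
  proof -
    obtain c where c: "\<forall>t\<in>{\<alpha><..<\<beta>}. \<Psi> t = c" using const[of "{\<alpha><..<\<beta>}"] g by auto
    then have "\<Psi> \<alpha> = \<Psi> \<beta>" using endpoint[of \<alpha> \<alpha> \<beta> c] endpoint[of \<beta> \<alpha> \<beta> c] g by simp
    then show ?thesis using W[of \<alpha> \<beta>] g zero(1) by (simp add: \<Psi>_def Z_def)
  qed
  have between: "integral {u..v} \<kappa> = 0" if uv: "u \<in> Z" "v \<in> Z" "u \<le> v" for u v
  proof -
    define \<G> where "\<G> = {{\<alpha><..<\<beta>} | \<alpha> \<beta>. \<alpha> \<in> Z \<inter> {u..v} \<and> \<beta> \<in> Z \<inter> {u..v} \<and> \<alpha> < \<beta> \<and> {\<alpha><..<\<beta>} \<inter> (Z \<inter> {u..v}) = {}}"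
    have empty: "{\<alpha><..<\<beta>} \<inter> Z = {}" if "\<alpha> \<in> {u..v}" "\<beta> \<in> {u..v}" "{\<alpha><..<\<beta>} \<inter> (Z \<inter> {u..v}) = {}" for \<alpha> \<beta>
      using that by auto
    have un: "\<Union>\<G> = {u..v} - Z"
    proof
      show "\<Union>\<G> \<subseteq> {u..v} - Z" using empty unfolding \<G>_def by fastforce
      show "{u..v} - Z \<subseteq> \<Union>\<G>"
      proof
        fix t assume t: "t \<in> {u..v} - Z"
        obtain \<alpha> where \<alpha>: "\<alpha> \<in> Z" "u \<le> \<alpha>" "\<alpha> \<le> t" "{\<alpha><..t} \<inter> Z = {}"
          using closed_left_neighbour[OF cZ uv(1), of t] t by auto
        obtain \<beta> where \<beta>: "\<beta> \<in> Z" "\<beta> \<le> v" "t \<le> \<beta>" "{t..<\<beta>} \<inter> Z = {}"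
          using closed_right_neighbour[OF cZ uv(2), of t] t by auto
        have ne: "\<alpha> \<noteq> t" "\<beta> \<noteq> t" using \<alpha> \<beta> t by auto
        have "{\<alpha><..<\<beta>} \<inter> Z = {}"
        proof -
          have "{\<alpha><..<\<beta>} \<subseteq> {\<alpha><..t} \<union> {t..<\<beta>}" by auto
          then show ?thesis using \<alpha>(4) \<beta>(4) by blast
        qed
        then have "{\<alpha><..<\<beta>} \<inter> (Z \<inter> {u..v}) = {}" by blast
        moreover have "\<alpha> \<in> Z \<inter> {u..v}" "\<beta> \<in> Z \<inter> {u..v}" "\<alpha> < \<beta>" using \<alpha> \<beta> ne t by auto
        ultimately have "{\<alpha><..<\<beta>} \<in> \<G>" unfolding \<G>_def by blast
        moreover have "t \<in> {\<alpha><..<\<beta>}" using \<alpha> \<beta> ne by auto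
        ultimately show "t \<in> \<Union>\<G>" by blast
      qed
    qed
    have "set_integrable lebesgue ({u..v} - Z) \<kappa>"
      by (rule set_integrable_subset[OF locally_integrable_abs_on[OF \<kappa>, of u v]])
         (use cZ in \<open>auto intro!: sets.Diff\<close>)
    then have "set_lebesgue_integral lebesgue (\<Union>\<G>) \<kappa> = 0"
    proof (intro set_integral_zero_countable_UN)
      show "countable \<G>" "pairwise disjnt \<G>" unfolding \<G>_def by (rule gaps_countable)+
      show "C \<in> sets lebesgue" if "C \<in> \<G>" for C using that unfolding \<G>_def by auto
      fix C assume "C \<in> \<G>"
      then obtain \<alpha> \<beta> where C: "C = {\<alpha><..<\<beta>}" "\<alpha> \<in> Z" "\<beta> \<in> Z" "\<alpha> < \<beta>" "{\<alpha><..<\<beta>} \<inter> Z = {}"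
        using empty unfolding \<G>_def by blast
      have "set_lebesgue_integral lebesgue C \<kappa> = integral C \<kappa>"
        by (rule set_lebesgue_integral_eq_integral(2))
           (rule set_integrable_subset[OF locally_integrable_abs_on[OF \<kappa>, of \<alpha> \<beta>]], use C in auto)
      also have "\<dots> = integral {\<alpha>..\<beta>} \<kappa>"
        unfolding C(1) by (rule integral_spike_set) (auto intro: negligible_subset[of "{\<alpha>, \<beta>}"])
      finally show "set_lebesgue_integral lebesgue C \<kappa> = 0" using lim_gap C by simp
    qed (simp add: un)
    moreover have "set_lebesgue_integral lebesgue (\<Union>\<G>) \<kappa> = set_lebesgue_integral lebesgue {u..v} \<kappa>"
      unfolding set_lebesgue_integral_def un
      by (intro Bochner_Integration.integral_cong) (use zero(2) in \<open>auto simp: indicator_def Z_def\<close>)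
    ultimately show ?thesis
      using set_lebesgue_integral_eq_integral(2)[OF locally_integrable_abs_on[OF \<kappa>, of u v]] by simp
  qed
  \<comment> \<open>Both ends are moved to the nearest limit points of E inside [x, y], if there are
    any; from one of these to the other, \<open>between\<close> applies and \<phi> is 0 at
    both.\<close>
  have "\<Psi> x = \<Psi> y"
  proof (cases "{x..y} \<inter> Z = {}")
    case True
    then show ?thesis using const[of "{x..y}"] xy by auto
  next
    case False
    then obtain z where z: "z \<in> Z" "x \<le> z" "z \<le> y" by auto
    obtain u where u: "u \<in> Z" "u \<le> z" "x \<le> u" "{x..<u} \<inter> Z = {}"
      using closed_right_neighbour[OF cZ z(1,2)] by auto
    obtain v where v: "v \<in> Z" "z \<le> v" "v \<le> y" "{v<..y} \<inter> Z = {}"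
      using closed_left_neighbour[OF cZ z(1,3)] by auto
    have "\<Psi> x = \<Psi> u"
    proof (cases "x = u")
      case False
      obtain c where c: "\<forall>t\<in>{x..<u}. \<Psi> t = c" using const[of "{x..<u}"] u by auto
      then show ?thesis using endpoint[of u x u c] u False by auto
    qed simp
    moreover have "\<Psi> v = \<Psi> y"
    proof (cases "y = v")
      case False
      obtain c where c: "\<forall>t\<in>{v<..y}. \<Psi> t = c" using const[of "{v<..y}"] v by auto
      then show ?thesis using endpoint[of v v y c] v False by auto
    qed simp
    moreover have "\<Psi> u = \<Psi> v"
      using between[of u v] W[of u v] u v zero(1) by (simp add: \<Psi>_def Z_def)
    ultimately show ?thesis by simp
  qed
  then show ?thesis using W[OF xy] by (simp add: \<Psi>_def)
qed

section \<open>Geometry of the knots\<close>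

locale knot_system =
  fixes m :: nat and E :: "real set" and a :: "real set \<Rightarrow> real"
  assumes m: "m \<ge> 1" and closed_E: "closed E"
    and large: "infinite E \<or> card E \<ge> m + 1" and choice: "knot_choice E a"
begin

abbreviation stop :: "real \<Rightarrow> nat" where "stop \<equiv> last_index m E a"

abbreviation jump :: "real \<Rightarrow> nat \<Rightarrow> real" where
  "jump x j \<equiv> infdist (a (knot_set a x j)) (knot_set a x j)"

lemma stop_le: "stop x \<le> m - 1"
  unfolding last_index_def by (rule Least_le) simp

lemma before_stop: "j < stop x \<Longrightarrow> j \<noteq> m - 1 \<and> \<not> knot a x j islimpt E"
  unfolding last_index_def using not_less_Least by blast

lemma at_stop: "stop x = m - 1 \<or> knot a x (stop x) islimpt E"
  unfolding last_index_def by (rule LeastI[of _ "m - 1"]) simp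

lemma no_limpt_before_stop:
  "j < stop x \<Longrightarrow> y \<in> knot_set a x j \<Longrightarrow> \<not> y islimpt E"
  using before_stop unfolding knot_set_eq by auto

lemma knot_step:
  assumes "j < stop x" "knot_set a x j \<subseteq> E"
  shows "a (knot_set a x j) \<in> E - knot_set a x j"
    and "y \<in> E - knot_set a x j \<Longrightarrow> jump x j \<le> infdist y (knot_set a x j)"
proof -
  let ?A = "knot_set a x j"
  have "?A \<noteq> E"
    using large card_knot_set[of a x j] finite_knot_set[of a x j] assms(1) stop_le[of x] by auto
  then have "finite ?A \<and> ?A \<noteq> {} \<and> ?A \<subset> E"
    using finite_knot_set knot_set_nonempty assms(2) by auto
  moreover have "\<forall>y\<in>?A. \<not> y islimpt E"
    using no_limpt_before_stop[OF assms(1)] by blast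
  ultimately have *: "a ?A \<in> E - ?A \<and> (\<forall>y\<in>E - ?A. infdist (a ?A) ?A \<le> infdist y ?A)"
    using choice unfolding knot_choice_def by blast
  show "a ?A \<in> E - ?A" using * by blast
  show "jump x j \<le> infdist y ?A" if "y \<in> E - ?A" using * that by blast
qed

lemma knot_set_subset: "x \<in> E \<Longrightarrow> j \<le> stop x \<Longrightarrow> knot_set a x j \<subseteq> E"
  by (induction j) (use knot_step(1) in auto)

lemma knot_set_card: "x \<in> E \<Longrightarrow> j \<le> stop x \<Longrightarrow> card (knot_set a x j) = Suc j"
proof (induction j)
  case (Suc j)
  then have "a (knot_set a x j) \<notin> knot_set a x j"
    using knot_step(1)[of j x] knot_set_subset by auto
  then show ?case using Suc finite_knot_set[of a x j] by simp
qed simp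

lemma knot_set_mono: "i \<le> j \<Longrightarrow> knot_set a x i \<subseteq> knot_set a x j"
  by (induction j) (auto simp: le_Suc_eq)

lemma infdist_finite_attained:
  fixes A :: "real set"
  assumes "finite A" "A \<noteq> {}"
  obtains w where "w \<in> A" "infdist z A = \<bar>z - w\<bar>"
  using infdist_attains_inf[OF finite_imp_closed[OF assms(1)] assms(2), of z]
  by (metis dist_real_def)

lemma infdist_le_abs: "w \<in> A \<Longrightarrow> infdist z A \<le> \<bar>z - w\<bar>" for z :: real
  using infdist_le[of w A z] by (simp add: dist_real_def)

text \<open>A nearest point never jumps over a point of E: if e lay between the new knot z and a
  knot w realising its distance, it would be strictly closer to w. The hull of the knots therefore
  meets E in the knots only, which gives the count in \<open>gap_estimate\<close>.\<close>

lemma knot_set_contiguous: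
  "x \<in> E \<Longrightarrow> j \<le> stop x \<Longrightarrow> u \<in> knot_set a x j \<Longrightarrow> v \<in> knot_set a x j \<Longrightarrow>
    e \<in> E \<Longrightarrow> u \<le> e \<Longrightarrow> e \<le> v \<Longrightarrow> e \<in> knot_set a x j"
proof (induction j arbitrary: u v)
  case (Suc j)
  let ?A = "knot_set a x j"
  define z where "z = a ?A"
  have A: "?A \<subseteq> E" using Suc.prems knot_set_subset by simp
  have near: "infdist z ?A \<le> infdist y ?A" if "y \<in> E - ?A" for y
    unfolding z_def using knot_step(2)[of j x y] Suc.prems A that by simp
  have IH: "e \<in> ?A" if "p \<in> ?A" "q \<in> ?A" "p \<le> e" "e \<le> q" for p q
    using Suc.IH[of p q] Suc.prems that by simp
  obtain w where w: "w \<in> ?A" "infdist z ?A = \<bar>z - w\<bar>"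
    using infdist_finite_attained[OF finite_knot_set knot_set_nonempty] by metis
  show ?case
  proof (rule ccontr)
    assume "\<not> ?case"
    then have e: "e \<notin> ?A" "e \<noteq> z" by (auto simp: z_def)
    then have "\<bar>z - w\<bar> \<le> \<bar>e - w\<bar>"
      using near[of e] infdist_le_abs[OF w(1), of e] w(2) Suc.prems by auto
    moreover have "u \<in> ?A \<or> u = z" "v \<in> ?A \<or> v = z"
      using Suc.prems by (auto simp: z_def)
    ultimately show False
      using IH[of u v] IH[of u w] IH[of w v] e w(1) Suc.prems by (smt (verit))
  qed
qed auto

text \<open>Each knot was attached to an earlier one by a link of length at most r, so the knot set
  is a tree with short edges and every cut of it is crossed by an edge.\<close>

lemma knot_set_linked:
  assumes "\<And>i. i < j \<Longrightarrow> jump x i \<le> r"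
    and "A \<subset> knot_set a x j" "A \<noteq> {}"
  shows "\<exists>u\<in>A. \<exists>v\<in>knot_set a x j - A. \<bar>u - v\<bar> \<le> r"
  using assms
proof (induction j arbitrary: A)
  case (Suc j)
  let ?Y = "knot_set a x j"
  define z where "z = a ?Y"
  obtain w where w: "w \<in> ?Y" "\<bar>z - w\<bar> \<le> r"
    using infdist_finite_attained[OF finite_knot_set knot_set_nonempty] Suc.prems(1)[of j]
    unfolding z_def by (metis lessI)
  have sub: "A \<subseteq> insert z ?Y" using Suc.prems by (auto simp: z_def)
  consider "?Y \<subseteq> A" | "A \<inter> ?Y = {}" | "A \<inter> ?Y \<noteq> {}" "A \<inter> ?Y \<subset> ?Y" by blast
  then show ?case
  proof cases
    case 1
    then have "z \<notin> A" using Suc.prems sub by (auto simp: z_def)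
    then show ?thesis
      using 1 w by (intro bexI[of _ w] bexI[of _ z]) (auto simp: z_def abs_minus_commute)
  next
    case 2
    then have "A = {z}" "z \<notin> ?Y" using sub Suc.prems(3) by auto
    then show ?thesis using w by (intro bexI[of _ z] bexI[of _ w]) auto
  next
    case 3
    then obtain u v where "u \<in> A \<inter> ?Y" "v \<in> ?Y - (A \<inter> ?Y)" "\<bar>u - v\<bar> \<le> r"
      using Suc.IH[of "A \<inter> ?Y"] Suc.prems(1) by (metis less_SucI)
    then show ?thesis by auto
  qed
qed auto

text \<open>A jump larger than \<open>r\<close> means that the points collected so far form a full \<open>r\<close>-chain component
  of \<open>E\<close>. The chain of any other point of that component fills the same component first and then
  continues identically, because the choice of the next knot depends only on the set.\<close>

lemma same_knots_if_big_jump: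
  assumes x: "x \<in> E" and y: "y \<in> E" and xy: "\<bar>x - y\<bar> \<le> r"
    and j: "j < stop x" "jump x j > r"
  shows "knots m E a x = knots m E a y \<and> last_knot m E a x = last_knot m E a y"
proof -
  \<comment> \<open>The first large jump is taken, so that all earlier ones are small and
    \<open>knot_set_linked\<close> applies to the set \<open>?Y\<close> collected before it.\<close>
  obtain k where k: "k < stop x" "jump x k > r" and small: "\<And>i. i < k \<Longrightarrow> jump x i \<le> r"
  proof -
    define k where "k = (LEAST k. jump x k > r)"
    have "k \<le> j" unfolding k_def using j(2) by (rule Least_le)
    moreover have "jump x k > r" unfolding k_def using j(2) by (rule LeastI)
    moreover have "jump x i \<le> r" if "i < k" for i
      using not_less_Least[OF that[unfolded k_def]] by simp
    ultimately show ?thesis using that j(1) by (meson le_less_trans)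
  qed
  let ?Y = "knot_set a x k"
  have YE: "?Y \<subseteq> E" using knot_set_subset x k by simp
  have isolated: "e \<in> ?Y" if "e \<in> E" "w \<in> ?Y" "\<bar>e - w\<bar> \<le> r" for e w
  proof (rule ccontr)
    assume "e \<notin> ?Y"
    then have "jump x k \<le> infdist e ?Y" using knot_step(2)[OF k(1) YE] that by blast
    also have "\<dots> \<le> r" using infdist_le_abs[OF that(2), of e] that(3) by simp
    finally show False using k by simp
  qed
  have "x \<in> ?Y" using knot_set_mono[of 0 k x] by simp
  then have yY: "y \<in> ?Y" using isolated[of y x] xy y by (simp add: abs_minus_commute)
  have sub: "i \<le> k \<Longrightarrow> i \<le> stop y \<and> knot_set a y i \<subseteq> ?Y" for i
  proof (induction i)
    case 0
    then show ?case using yY by simp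
  next
    case (Suc i)
    let ?A = "knot_set a y i"
    have IH: "i \<le> stop y" "?A \<subseteq> ?Y" using Suc by auto
    \<comment> \<open>The knots of y cannot end inside \<open>?Y\<close>: the index m-1 is not
      reached yet and \<open>?Y\<close> contains no limit point.\<close>
    have "i \<noteq> stop y"
    proof
      assume "i = stop y"
      then have "knot a y i islimpt E" using at_stop[of y] stop_le[of x] k(1) Suc.prems by auto
      moreover have "knot a y i \<in> ?Y" using IH(2) unfolding knot_set_eq[of a y] by auto
      ultimately show False using no_limpt_before_stop[OF k(1)] by blast
    qed
    then have i: "i < stop y" using IH by simp
    have AE: "?A \<subseteq> E" using IH YE by blast
    have "card ?A < card ?Y" using knot_set_card x y k i Suc.prems by simp
    then have "?A \<subset> ?Y" using IH by auto
    \<comment> \<open>As long as \<open>?Y\<close> is not exhausted, a short link leads out of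
      \<open>?A\<close> to a point of \<open>?Y\<close>, so the nearest point is within r of
      \<open>?A\<close> and, \<open>?Y\<close> being isolated at scale r, lies in
      \<open>?Y\<close>.\<close>
    then obtain u v where uv: "u \<in> ?A" "v \<in> ?Y - ?A" "\<bar>u - v\<bar> \<le> r"
      using knot_set_linked[OF small _ knot_set_nonempty] by metis
    obtain w where w: "w \<in> ?A" "jump y i = \<bar>a ?A - w\<bar>"
      using infdist_finite_attained[OF finite_knot_set knot_set_nonempty] by metis
    have "jump y i \<le> infdist v ?A" using knot_step(2)[OF i AE, of v] uv YE by auto
    also have "\<dots> \<le> r" using infdist_le_abs[OF uv(1), of v] uv(3) by simp
    finally have "a ?A \<in> ?Y"
      using isolated[of "a ?A" w] w IH knot_step(1)[OF i AE] by auto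
    then show ?case using IH i by simp
  qed
  have ky: "k \<le> stop y" using sub by simp
  \<comment> \<open>Equal cardinality turns the inclusion into equality, although x and y may have
    filled the set in different orders; from here on the two sequences of sets coincide.\<close>
  have "card (knot_set a y k) = card ?Y" using knot_set_card x y k ky by simp
  then have eqk: "knot_set a y k = ?Y"
    using sub[of k] card_subset_eq[OF finite_knot_set] by blast
  have ky': "k < stop y"
  proof -
    have "knot a y k \<in> knot_set a y k" unfolding knot_set_eq by simp
    then have "knot a y k \<in> ?Y" using eqk by simp
    then have "\<not> knot a y k islimpt E" using no_limpt_before_stop[OF k(1)] by blast
    then show ?thesis using at_stop[of y] ky k stop_le[of x] by (metis le_neq_implies_less not_le)
  qed
  have eq: "knot_set a y (k + i) = knot_set a x (k + i)" for i
    by (induction i) (auto simp: eqk)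
  have eqknot: "knot a y i = knot a x i" if ik: "k < i" for i
  proof -
    obtain d where "i = Suc (k + d)" using less_imp_Suc_add[OF ik] by blast
    then show ?thesis using eq[of d] by simp
  qed
  have "stop x \<le> stop y"
    using at_stop[of y] eqknot[OF ky'] before_stop[of "stop y" x] by (metis not_le)
  moreover have "stop y \<le> stop x"
    using at_stop[of x] eqknot[OF k(1)] before_stop[of "stop x" y] by (metis not_le)
  ultimately have st: "stop x = stop y" by simp
  show ?thesis
    using eq[of "stop x - k"] eqknot[OF k(1)] k(1) st unfolding knots_def last_knot_def by simp
qed

lemma knot_set_in_cball:
  "(\<And>i. i < j \<Longrightarrow> jump x i \<le> r) \<Longrightarrow> y \<in> knot_set a x j \<Longrightarrow> \<bar>y - x\<bar> \<le> real j * r"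
proof (induction j arbitrary: y)
  case (Suc j)
  have r: "r \<ge> 0" using Suc.prems(1)[of j] infdist_nonneg by (meson lessI order_trans)
  have IH: "\<bar>y - x\<bar> \<le> real j * r" if "y \<in> knot_set a x j" for y
    using Suc.IH[OF _ that] Suc.prems(1) by simp
  show ?case
  proof (cases "y \<in> knot_set a x j")
    case True
    then show ?thesis using IH r by (smt (verit) mult_right_mono of_nat_Suc)
  next
    case False
    then have y: "y = a (knot_set a x j)" using Suc.prems by simp
    obtain w where w: "w \<in> knot_set a x j" "jump x j = \<bar>y - w\<bar>"
      using infdist_finite_attained[OF finite_knot_set knot_set_nonempty] y by metis
    have "\<bar>y - x\<bar> \<le> \<bar>y - w\<bar> + \<bar>w - x\<bar>" by simp
    also have "\<dots> \<le> r + real j * r" using IH[OF w(1)] Suc.prems(1)[of j] w by simp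
    finally show ?thesis by (simp add: algebra_simps)
  qed
qed simp

text \<open>A limit point of E ends the selection as soon as it is chosen, so before the end u is
  still a competitor for the nearest point, no farther from the knots than from x. Near a limit
  point all knots are therefore close to it.\<close>

lemma jump_near_limpt:
  assumes "x \<in> E" "u islimpt E" "j < stop x"
  shows "jump x j \<le> \<bar>x - u\<bar>"
proof -
  have "u \<in> E" using closed_E assms(2) closed_limpt by blast
  moreover have "u \<notin> knot_set a x j" using no_limpt_before_stop assms by blast
  moreover have "knot_set a x j \<subseteq> E" using knot_set_subset assms by simp
  ultimately have "jump x j \<le> infdist u (knot_set a x j)" using knot_step(2) assms by blast
  moreover have "x \<in> knot_set a x j" using knot_set_mono[of 0 j x] by simp
  ultimately show ?thesis using infdist_le_abs[of x _ u] by fastforce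
qed

lemma knots_limpt: "u islimpt E \<Longrightarrow> knots m E a u = {u} \<and> last_knot m E a u = u"
proof -
  assume "u islimpt E"
  then have "stop u = 0" unfolding last_index_def by (intro Least_eq_0) simp
  then show ?thesis by (simp add: knots_def last_knot_def)
qed

lemma knots_props:
  assumes "x \<in> E"
  shows "finite (knots m E a x)" "knots m E a x \<subseteq> E" "x \<in> knots m E a x"
    "last_knot m E a x \<in> knots m E a x" "card (knots m E a x) \<le> m"
    "card (knots m E a x) < m \<Longrightarrow> last_knot m E a x islimpt E"
  using knot_set_card[OF assms, of "stop x"] knot_set_subset[OF assms, of "stop x"]
    finite_knot_set[of a x] at_stop[of x] stop_le[of x] knot_set_mono[of 0 "stop x" x] m
  unfolding knots_def last_knot_def by (auto simp: knot_set_eq)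

end

section \<open>The jets\<close>

lemma lagrange_props:
  assumes "finite S" "S \<noteq> {}"
  shows "degree (lagrange S f) \<le> card S - 1" "y \<in> S \<Longrightarrow> poly (lagrange S f) y = f y"
    and "degree P \<le> card S - 1 \<Longrightarrow> (\<And>y. y \<in> S \<Longrightarrow> poly P y = f y) \<Longrightarrow> lagrange S f = P"
proof -
  let ?Q = "\<lambda>P. degree P \<le> card S - 1 \<and> (\<forall>y\<in>S. poly P y = f y)"
  have c: "card S > 0" using assms by (simp add: card_gt_0_iff)
  have uniq: "P = Q" if "?Q P" "?Q Q" for P Q
    by (rule hermite_unique[OF assms(1), where \<mu> = "\<lambda>_. 1"]) (use that c in auto)
  obtain P0 where P0: "?Q P0" using hermite_exists[OF assms(1), of "\<lambda>_. 1" "\<lambda>x _. f x"] by auto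
  have ex: "\<exists>!P. ?Q P" using P0 uniq by blast
  have "?Q (lagrange S f)" unfolding lagrange_def using ex by (rule theI')
  then show "degree (lagrange S f) \<le> card S - 1" "y \<in> S \<Longrightarrow> poly (lagrange S f) y = f y" by auto
  then show "degree P \<le> card S - 1 \<Longrightarrow> (\<And>y. y \<in> S \<Longrightarrow> poly P y = f y) \<Longrightarrow> lagrange S f = P"
    using uniq \<open>?Q (lagrange S f)\<close> by blast
qed

lemma lagrange_linear:
  assumes "finite S" "S \<noteq> {}"
  shows "lagrange S (\<lambda>x. c * f x + d * g x) = smult c (lagrange S f) + smult d (lagrange S g)"
proof (rule lagrange_props(3)[OF assms])
  show "degree (smult c (lagrange S f) + smult d (lagrange S g)) \<le> card S - 1"
    using lagrange_props(1)[OF assms] by (intro degree_add_le) (auto intro: order_trans[OF degree_smult_le])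
qed (simp add: lagrange_props(2)[OF assms])

lemma eventually_sets_to:
  "eventually P (sets_to m E s) \<longleftrightarrow>
    (\<exists>\<delta>>0. \<forall>S. S \<subseteq> E \<and> finite S \<and> card S = m \<and> diameter (S \<union> {s}) < \<delta> \<longrightarrow> P S)"
  unfolding sets_to_def
proof (subst eventually_INF_base)
  show "\<exists>x\<in>{0<..}. principal {S. S \<subseteq> E \<and> finite S \<and> card S = m \<and> diameter (S \<union> {s}) < x}
      \<le> inf (principal {S. S \<subseteq> E \<and> finite S \<and> card S = m \<and> diameter (S \<union> {s}) < a})
          (principal {S. S \<subseteq> E \<and> finite S \<and> card S = m \<and> diameter (S \<union> {s}) < b})"
    if "a \<in> {0<..}" "b \<in> {0<..}" for a b :: real
    using that by (intro bexI[of _ "min a b"]) auto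
qed (auto simp: eventually_principal)

text \<open>Limits are unique only along a nontrivial filter; this is what allows \<open>Lim\<close>
  in \<open>jet_limit\<close> to be evaluated.\<close>

lemma sets_to_nontrivial:
  assumes "s islimpt E"
  shows "sets_to m E s \<noteq> bot"
proof -
  have "\<exists>S. S \<subseteq> E \<and> finite S \<and> card S = m \<and> diameter (S \<union> {s}) < \<delta>" if \<delta>: "\<delta> > 0" for \<delta>
  proof -
    have "infinite (E \<inter> ball s (\<delta>/4))"
      using assms \<delta> by (simp add: islimpt_eq_infinite_ball)
    then obtain S where S: "S \<subseteq> E \<inter> ball s (\<delta>/4)" "finite S" "card S = m"
      using infinite_arbitrarily_large by blast
    have "norm (y - z) \<le> \<delta>/2" if "y \<in> S \<union> {s}" "z \<in> S \<union> {s}" for y z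
    proof -
      have "dist s y \<le> \<delta>/4" "dist s z \<le> \<delta>/4" using that S(1) \<delta> by auto
      then show ?thesis using dist_triangle2[of y z s] by (simp add: dist_commute dist_norm)
    qed
    then have "diameter (S \<union> {s}) \<le> \<delta>/2" by (rule diameter_le[rotated]) auto
    then show ?thesis using S \<delta> by (intro exI[of _ S]) auto
  qed
  then have "\<not> eventually (\<lambda>_. False) (sets_to m E s)" unfolding eventually_sets_to by blast
  then show ?thesis by (simp add: trivial_limit_def)
qed

text \<open>Interpolation at m points within \<delta>/2 of s has an error controlled by the integral
  of the modulus of \<open>\<Phi> m\<close> over a shrinking interval. For i = m-1 no power of
  \<delta> helps, and the smallness comes from the continuity of the primitive V alone.\<close>

lemma lagrange_jet_tendsto:
  assumes chain: "antideriv_chain m \<Phi>" and m: "m \<ge> 1" and i: "i < m"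
    and f: "\<And>x. x \<in> E \<Longrightarrow> \<Phi> 0 x = f x"
  shows "((\<lambda>S. poly_deriv i (lagrange S f) s) \<longlongrightarrow> \<Phi> i s) (sets_to m E s)"
proof (rule tendstoI)
  fix e :: real assume e: "e > 0"
  have int: "locally_integrable (\<Phi> m)" using chain by (simp add: chain_integrable)
  then have iabs: "locally_integrable (\<lambda>t. \<bar>\<Phi> m t\<bar>)"
    unfolding locally_integrable_def by (auto intro: set_integrable_abs)
  obtain V where V: "\<And>x y. x \<le> y \<Longrightarrow> V y - V x = integral {x..y} (\<lambda>t. \<bar>\<Phi> m t\<bar>)"
    using antiderivative_exists[OF iabs] by blast
  have cV: "continuous_on UNIV V" by (rule continuous_on_if_integral[OF iabs V])
  then have "isCont V s" by (simp add: continuous_on_eq_continuous_at)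
  then obtain d where d: "d > 0" "\<And>t. dist t s < d \<Longrightarrow> dist (V t) (V s) < e/2"
    using e half_gt_zero unfolding continuous_at_eps_delta by metis
  \<comment> \<open>The bound 1/2 keeps every power of the length \<delta> of the hull at most 1,
    for all i at once.\<close>
  define \<delta> where "\<delta> = min d (1/2)"
  have \<delta>: "\<delta> > 0" "\<delta> \<le> d" "2 * \<delta> \<le> 1" using d by (auto simp: \<delta>_def)
  show "\<forall>\<^sub>F S in sets_to m E s. dist (poly_deriv i (lagrange S f) s) (\<Phi> i s) < e"
    unfolding eventually_sets_to
  proof (intro exI conjI allI impI)
    show "\<delta>/2 > 0" using \<delta> by simp
    fix S assume S: "S \<subseteq> E \<and> finite S \<and> card S = m \<and> diameter (S \<union> {s}) < \<delta>/2"
    then have ne: "S \<noteq> {}" using m by auto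
    then obtain z where z: "z \<in> S" by blast
    have bnd: "bounded (S \<union> {s})" using S by (intro finite_imp_bounded) auto
    have near: "\<bar>y - s\<bar> \<le> \<delta>/2" if "y \<in> S" for y
      using diameter_bounded_bound[OF bnd, of y s] that S by (auto simp: dist_real_def)
    have "\<bar>poly_deriv i (lagrange S f) s - \<Phi> i s\<bar> \<le>
        ((s + \<delta>/2) - (s - \<delta>/2)) ^ (m - 1 - i) * integral {s - \<delta>/2..s + \<delta>/2} (\<lambda>t. \<bar>\<Phi> m t\<bar>)"
    proof (rule interpolation_error[OF chain, where S = S and s = z and r = 0])
      show "degree (lagrange S f) < m"
        using lagrange_props(1)[of S f] S ne m by auto
      show "S \<subseteq> {s - \<delta>/2..s + \<delta>/2}"
      proof
        fix y assume "y \<in> S"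
        then show "y \<in> {s - \<delta>/2..s + \<delta>/2}" using near[of y] unfolding abs_le_iff atLeastAtMost_iff by linarith
      qed
      show "poly (lagrange S f) x = \<Phi> 0 x" if "x \<in> S" for x
        using lagrange_props(2)[of S x f] that S ne f by auto
      then show "poly_deriv j (lagrange S f) z = \<Phi> j z" if "j \<le> 0" for j
        using that z by simp
    qed (use S z i \<delta> in auto)
    also have "\<dots> = \<delta> ^ (m - 1 - i) * (V (s + \<delta>/2) - V (s - \<delta>/2))"
      using V[of "s - \<delta>/2" "s + \<delta>/2"] \<delta> by simp
    also have "\<dots> \<le> 1 * (V (s + \<delta>/2) - V (s - \<delta>/2))"
    proof (rule mult_right_mono)
      show "\<delta> ^ (m - 1 - i) \<le> 1" using \<delta> by (intro power_le_one) auto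
      have "0 \<le> integral {s - \<delta>/2..s + \<delta>/2} (\<lambda>t. \<bar>\<Phi> m t\<bar>)"
        by (rule integral_nonneg[OF locally_integrable_on[OF iabs]]) simp
      then show "0 \<le> V (s + \<delta>/2) - V (s - \<delta>/2)" using V[of "s - \<delta>/2" "s + \<delta>/2"] \<delta> by simp
    qed
    also have "\<dots> < e"
    proof -
      have "\<bar>V (s + \<delta>/2) - V s\<bar> < e/2" "\<bar>V (s - \<delta>/2) - V s\<bar> < e/2"
        using d(2)[of "s + \<delta>/2"] d(2)[of "s - \<delta>/2"] \<delta> by (simp_all add: dist_real_def)
      moreover have "p - q < e" if "\<bar>p - w\<bar> < e/2" "\<bar>q - w\<bar> < e/2" for p q w :: real
        using that by linarith
      ultimately show ?thesis unfolding mult_1 by blast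
    qed
    finally show "dist (poly_deriv i (lagrange S f) s) (\<Phi> i s) < e" by (simp add: dist_real_def)
  qed
qed

lemma jet_limit_eq:
  assumes "antideriv_chain m \<Phi>" "m \<ge> 1" "i < m" "\<And>x. x \<in> E \<Longrightarrow> \<Phi> 0 x = f x" "s islimpt E"
  shows "jet_limit m E f i s = \<Phi> i s"
  unfolding jet_limit_def
  using sets_to_nontrivial[OF assms(5)] lagrange_jet_tendsto[OF assms(1-4)] by (rule tendsto_Lim)

section \<open>Jets as Hermite interpolants at the knots\<close>

context knot_system begin

text \<open>The conditions missing to m are placed at the last knot. With m distinct knots every
  multiplicity is 1, so the Lagrange and the Hermite case of \<open>jet_poly\<close> are treated
  together.\<close>

definition mults :: "real \<Rightarrow> real \<Rightarrow> nat" where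
  "mults x y = (if y = last_knot m E a x then m - card (knots m E a x) + 1 else 1)"

lemma sum_mults:
  assumes "x \<in> E"
  shows "(\<Sum>y\<in>knots m E a x. mults x y) = m"
proof -
  let ?S = "knots m E a x" and ?s = "last_knot m E a x"
  note S = knots_props[OF assms]
  have "(\<Sum>y\<in>?S. mults x y) = mults x ?s + (\<Sum>y\<in>?S - {?s}. mults x y)"
    by (rule sum.remove[OF S(1,4)])
  also have "(\<Sum>y\<in>?S - {?s}. mults x y) = card (?S - {?s})"
    by (simp add: mults_def)
  also have "\<dots> = card ?S - 1" using S(1,4) by simp
  also have "mults x ?s = m - card ?S + 1" by (simp add: mults_def)
  finally show ?thesis using S(1,4,5) card_gt_0_iff[of ?S] by force
qed

text \<open>Leaving the prescribed derivatives \<open>l\<close> free separates the algebra of the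
  interpolation, existence and uniqueness, from the question whether the limits exist.\<close>

definition is_jet :: "(real \<Rightarrow> real) \<Rightarrow> (nat \<Rightarrow> real) \<Rightarrow> real \<Rightarrow> real poly \<Rightarrow> bool" where
  "is_jet f l x P \<longleftrightarrow> degree P \<le> m - 1 \<and> (\<forall>y\<in>knots m E a x. poly P y = f y) \<and>
     (\<forall>i\<in>{1..m - card (knots m E a x)}. poly_deriv i P (last_knot m E a x) = l i)"

lemma is_jet_unique:
  assumes "x \<in> E" "is_jet f l x P" "is_jet f l x Q"
  shows "P = Q"
proof (rule hermite_unique[OF knots_props(1)[OF assms(1)], where \<mu> = "mults x"])
  show "degree P < sum (mults x) (knots m E a x)" "degree Q < sum (mults x) (knots m E a x)"
    using assms m unfolding sum_mults[OF assms(1)] is_jet_def by auto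
  fix y i assume y: "y \<in> knots m E a x" "i < mults x y"
  show "poly_deriv i P y = poly_deriv i Q y"
  proof (cases "i = 0")
    case False
    then have "y = last_knot m E a x" "i \<in> {1..m - card (knots m E a x)}"
      using y by (auto simp: mults_def split: if_splits)
    then show ?thesis using assms(2,3) unfolding is_jet_def by simp
  qed (use y assms(2,3) in \<open>simp add: is_jet_def\<close>)
qed

lemma is_jet_exists:
  assumes "x \<in> E"
  shows "\<exists>P. is_jet f l x P"
proof -
  let ?c = "\<lambda>y i. if i = 0 then f y else l i"
  obtain P where P: "degree P \<le> m - 1"
    "\<forall>y\<in>knots m E a x. \<forall>i<mults x y. poly_deriv i P y = ?c y i"
    using hermite_exists[OF knots_props(1)[OF assms], of "mults x" ?c] unfolding sum_mults[OF assms] by blast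
  have "poly P y = f y" if "y \<in> knots m E a x" for y
    using P(2)[rule_format, OF that, of 0] by (simp add: mults_def)
  moreover have "poly_deriv i P (last_knot m E a x) = l i" if "i \<in> {1..m - card (knots m E a x)}" for i
    using P(2)[rule_format, OF knots_props(4)[OF assms], of i] that by (simp add: mults_def)
  ultimately show ?thesis using P(1) unfolding is_jet_def by blast
qed

lemma jet_poly_is_jet:
  assumes "x \<in> E"
  shows "is_jet f (\<lambda>i. jet_limit m E f i (last_knot m E a x)) x (jet_poly m E a f x)"
proof -
  let ?S = "knots m E a x" and ?s = "last_knot m E a x"
  let ?l = "\<lambda>i. jet_limit m E f i ?s"
  show ?thesis
  proof (cases "card ?S = m")
    case True
    then have "jet_poly m E a f x = lagrange ?S f" by (simp add: jet_poly_def Let_def)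
    then show ?thesis
      using lagrange_props(1)[of ?S f] lagrange_props(2)[of ?S _ f] knots_props(1,3)[OF assms] True
      unfolding is_jet_def by fastforce
  next
    case False
    then have eq: "jet_poly m E a f x = (THE P. is_jet f ?l x P)"
      by (simp add: jet_poly_def Let_def is_jet_def)
    have "\<exists>!P. is_jet f ?l x P" using is_jet_exists[OF assms] is_jet_unique[OF assms] by blast
    then show ?thesis unfolding eq by (rule theI')
  qed
qed

end

text \<open>The extension only sees \<open>f\<close> on \<open>E\<close>; any extension \<open>F\<close> of \<open>f\<close>, with its chain \<open>\<Phi>\<close> of
  derivatives, can be used to describe the jets.\<close>

locale extension_setting = knot_system +
  fixes \<Phi> :: "nat \<Rightarrow> real \<Rightarrow> real" and f :: "real \<Rightarrow> real"
  assumes chain: "antideriv_chain m \<Phi>" and on_E: "\<And>x. x \<in> E \<Longrightarrow> \<Phi> 0 x = f x"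
begin

abbreviation P :: "real \<Rightarrow> real poly" where "P \<equiv> jet_poly m E a f"

lemma jet_degree: "x \<in> E \<Longrightarrow> degree (P x) < m"
  using jet_poly_is_jet[of x f] m unfolding is_jet_def by auto

lemma jet_at_knot: "x \<in> E \<Longrightarrow> y \<in> knots m E a x \<Longrightarrow> poly (P x) y = \<Phi> 0 y"
  using jet_poly_is_jet[of x f] knots_props(2)[of x] on_E unfolding is_jet_def by auto

lemma jet_at_last_knot:
  assumes "x \<in> E" "i \<le> m - card (knots m E a x)"
  shows "poly_deriv i (P x) (last_knot m E a x) = \<Phi> i (last_knot m E a x)"
proof (cases "i = 0")
  case True
  then show ?thesis using jet_at_knot[OF assms(1) knots_props(4)[OF assms(1)]] by simp
next
  case False
  have c: "card (knots m E a x) > 0" using knots_props(1,3)[OF assms(1)] by (auto simp: card_gt_0_iff)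
  have "last_knot m E a x islimpt E" using knots_props(6)[OF assms(1)] False assms(2) by auto
  then have "jet_limit m E f i (last_knot m E a x) = \<Phi> i (last_knot m E a x)"
    using jet_limit_eq[OF chain m _ on_E] c assms(2) m by auto
  then show ?thesis
    using jet_poly_is_jet[OF assms(1), of f] False assms(2) unfolding is_jet_def by auto
qed

lemma jet_error:
  assumes "x \<in> E" "knots m E a x \<subseteq> {\<alpha>..\<beta>}" "k < m" "t \<in> {\<alpha>..\<beta>}"
  shows "\<bar>poly_deriv k (P x) t - \<Phi> k t\<bar> \<le> (\<beta> - \<alpha>) ^ (m - 1 - k) * integral {\<alpha>..\<beta>} (\<lambda>t. \<bar>\<Phi> m t\<bar>)"
  using knots_props[OF assms(1)]
  by (intro interpolation_error[OF chain jet_degree[OF assms(1)] _ _ assms(2) _ jet_at_knot[OF assms(1)]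
        jet_at_last_knot[OF assms(1)] assms(3,4)]) auto

lemma jet_at_limpt:
  assumes "u islimpt E" "i < m"
  shows "poly_deriv i (P u) u = \<Phi> i u"
proof -
  have "u \<in> E" using closed_E assms(1) closed_limpt by blast
  then show ?thesis using jet_at_last_knot[of u i] knots_limpt[OF assms(1)] assms(2) by simp
qed

lemma well_defined: "extension_well_defined m E a f"
  unfolding extension_well_defined_def Let_def
proof (intro ballI impI)
  fix x i assume x: "x \<in> E" "i \<in> {1..m - card (knots m E a x)}"
  have "card (knots m E a x) > 0" using knots_props(1,3)[OF x(1)] by (auto simp: card_gt_0_iff)
  then have "i < m" using x(2) m by auto
  then show "\<exists>l. ((\<lambda>S. poly_deriv i (lagrange S f) (last_knot m E a x)) \<longlongrightarrow> l) (sets_to m E (last_knot m E a x))"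
    using lagrange_jet_tendsto[OF chain m _ on_E] by blast
qed

lemma jet_eq_if_same_knots:
  assumes "x \<in> E" "y \<in> E" "knots m E a x = knots m E a y" "last_knot m E a x = last_knot m E a y"
  shows "P x = P y"
  using assms by (simp add: jet_poly_def Let_def)

end

section \<open>Hermite interpolation on a gap\<close>

lemma higher_pderiv_pcompose_affine:
  "poly_deriv i (pcompose P [:d, c:]) x = c ^ i * poly_deriv i P (d + c * x)"
proof (induction i arbitrary: P)
  case (Suc i)
  have "pderiv (pcompose P [:d, c:]) = smult c (pcompose (pderiv P) [:d, c:])"
    by (simp add: pderiv_pcompose pderiv_pCons mult.commute)
  then have "poly_deriv (Suc i) (pcompose P [:d, c:]) x = poly_deriv i (smult c (pcompose (pderiv P) [:d, c:])) x"
    by (simp add: funpow_Suc_right del: funpow.simps)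
  also have "\<dots> = c * (c ^ i * poly_deriv i (pderiv P) (d + c * x))"
    using Suc by (simp add: higher_pderiv_smult)
  also have "\<dots> = c ^ Suc i * poly_deriv (Suc i) P (d + c * x)"
    by (simp add: funpow_Suc_right del: funpow.simps)
  finally show ?case .
qed (simp add: poly_pcompose mult.commute)

lemma hermite_props:
  fixes Q :: "real \<Rightarrow> real poly"
  assumes "m \<ge> 1" "u < v"
  shows "degree (hermite m Q u v) \<le> 2 * m - 1"
    and "i < m \<Longrightarrow> poly_deriv i (hermite m Q u v) u = poly_deriv i (Q u) u"
    and "i < m \<Longrightarrow> poly_deriv i (hermite m Q u v) v = poly_deriv i (Q v) v"
    and "degree H \<le> 2 * m - 1 \<Longrightarrow> (\<And>i. i < m \<Longrightarrow> poly_deriv i H u = poly_deriv i (Q u) u) \<Longrightarrow>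
      (\<And>i. i < m \<Longrightarrow> poly_deriv i H v = poly_deriv i (Q v) v) \<Longrightarrow> hermite m Q u v = H"
proof -
  let ?R = "\<lambda>H. degree H \<le> 2 * m - 1 \<and> (\<forall>i<m. poly_deriv i H u = poly_deriv i (Q u) u \<and>
     poly_deriv i H v = poly_deriv i (Q v) v)"
  have sum: "(\<Sum>x\<in>{u, v}. m) = 2 * m" using assms(2) by simp
  have uniq: "H = G" if "?R H" "?R G" for H G
    by (rule hermite_unique[of "{u, v}" _ "\<lambda>_. m"]) (use that sum assms(1) in auto)
  obtain H0 where "?R H0"
    using hermite_exists[of "{u, v}" "\<lambda>_. m" "\<lambda>x i. poly_deriv i (Q x) x"] unfolding sum by auto
  then have "\<exists>!H. ?R H" using uniq by blast
  then have R: "?R (hermite m Q u v)" unfolding hermite_def by (rule theI')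
  then show "degree (hermite m Q u v) \<le> 2 * m - 1"
    and "i < m \<Longrightarrow> poly_deriv i (hermite m Q u v) u = poly_deriv i (Q u) u"
    and "i < m \<Longrightarrow> poly_deriv i (hermite m Q u v) v = poly_deriv i (Q v) v" by auto
  show "degree H \<le> 2 * m - 1 \<Longrightarrow> (\<And>i. i < m \<Longrightarrow> poly_deriv i H u = poly_deriv i (Q u) u) \<Longrightarrow>
      (\<And>i. i < m \<Longrightarrow> poly_deriv i H v = poly_deriv i (Q v) v) \<Longrightarrow> hermite m Q u v = H"
    by (rule uniq[OF R]) auto
qed

text \<open>The proof scales to \<open>[0, 1]\<close>, where a fixed basis of the polynomials with vanishing jet at \<open>0\<close>
  is available.\<close>

lemma hermite_deriv_bound:
  assumes m: "m \<ge> 1"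
  shows "\<exists>C>0. \<forall>Q u v A. u < v \<longrightarrow> degree (Q u) < m \<longrightarrow>
    (\<forall>i<m. \<bar>poly_deriv i (Q v) v - poly_deriv i (Q u) v\<bar> \<le> A * (v - u) ^ (m - 1 - i)) \<longrightarrow>
    (\<forall>x\<in>{u..v}. \<bar>poly_deriv m (hermite m Q u v) x\<bar> \<le> C * A / (v - u))"
proof -
  have "\<exists>B. degree B \<le> 2 * m - 1 \<and>
      (\<forall>i<m. poly_deriv i B 0 = 0 \<and> poly_deriv i B 1 = (if i = j then 1 else 0 :: real))" for j
  proof -
    have sum: "(\<Sum>x\<in>{0, 1 :: real}. m) = 2 * m" by simp
    show ?thesis
      using hermite_exists[of "{0, 1}" "\<lambda>_. m" "\<lambda>x i. if x = 1 \<and> i = j then 1 else 0"] unfolding sum by auto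
  qed
  then obtain B :: "nat \<Rightarrow> real poly" where
    B: "\<And>j. degree (B j) \<le> 2 * m - 1" "\<And>j i. i < m \<Longrightarrow> poly_deriv i (B j) 0 = 0"
       "\<And>j i. i < m \<Longrightarrow> poly_deriv i (B j) 1 = (if i = j then 1 else 0)"
    by metis
  have "\<exists>M\<ge>0. \<forall>x\<in>{0..1}. \<bar>poly_deriv m (B j) x\<bar> \<le> M" for j
  proof -
    have "compact ((\<lambda>x. poly_deriv m (B j) x) ` {0..1})"
      by (intro compact_continuous_image continuous_intros) auto
    then have "bounded ((\<lambda>x. poly_deriv m (B j) x) ` {0..1})" by (rule compact_imp_bounded)
    then obtain M where "\<forall>x\<in>{0..1}. \<bar>poly_deriv m (B j) x\<bar> \<le> M" unfolding bounded_iff by auto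
    then show ?thesis by (intro exI[of _ "\<bar>M\<bar>"]) force
  qed
  then obtain M where M: "\<And>j. M j \<ge> 0" "\<And>j x. x \<in> {0..1} \<Longrightarrow> \<bar>poly_deriv m (B j) x\<bar> \<le> M j"
    by metis
  define C where "C = 1 + (\<Sum>j<m. M j)"
  have C: "C > 0" using sum_nonneg[of "{..<m}" M] M(1) by (simp add: C_def)
  show ?thesis
  proof (intro exI[of _ C] conjI C allI impI ballI)
    fix Q :: "real \<Rightarrow> real poly" and u v A x :: real
    assume uv: "u < v" and deg: "degree (Q u) < m" and x: "x \<in> {u..v}"
      and A: "\<forall>i<m. \<bar>poly_deriv i (Q v) v - poly_deriv i (Q u) v\<bar> \<le> A * (v - u) ^ (m - 1 - i)"
    define h where "h = v - u"
    have h: "h > 0" using uv by (simp add: h_def)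
    define \<delta> where "\<delta> i = poly_deriv i (Q v) v - poly_deriv i (Q u) v" for i
    \<comment> \<open>\<open>B j\<close> transplanted to [u, v]. Its derivatives of order below m
      vanish at u; the factor \<open>h ^ j\<close> undoes the scaling, so that at v only the j-th of
      them survives, with value \<open>\<delta> j\<close>.\<close>
    define N where "N j = smult (\<delta> j * h ^ j) (pcompose (B j) [:- u / h, 1 / h:])" for j
    have arg: "- u / h + 1 / h * t = (t - u) / h" for t using h by (simp add: field_simps)
    have N: "poly_deriv i (N j) t = \<delta> j * h ^ j * ((1 / h) ^ i * poly_deriv i (B j) ((t - u) / h))" for i j t
      unfolding N_def higher_pderiv_smult poly_smult higher_pderiv_pcompose_affine arg ..
    \<comment> \<open>\<open>Q u\<close> already has the right jet at u, and the sum corrects its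
      jet at v. As \<open>Q u\<close> has degree below m, only the correction contributes to the
      m-th derivative.\<close>
    define H where "H = Q u + (\<Sum>j<m. N j)"
    have Hd: "poly_deriv i H t = poly_deriv i (Q u) t + (\<Sum>j<m. poly_deriv i (N j) t)" for i t
      by (simp add: H_def higher_pderiv_add higher_pderiv_sum poly_sum)
    have "hermite m Q u v = H"
    proof (rule hermite_props(4)[OF m uv])
      have "degree (N j) \<le> 2 * m - 1" for j
      proof -
        have "degree (N j) \<le> degree (pcompose (B j) [:- u / h, 1 / h:])"
          unfolding N_def by (rule degree_smult_le)
        also have "\<dots> \<le> degree (B j) * 1" using degree_pcompose_le[of "B j" "[:- u / h, 1 / h:]"]
          by (rule order_trans) (intro mult_left_mono; simp)
        finally show ?thesis using B(1)[of j] by simp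
      qed
      then show "degree H \<le> 2 * m - 1"
        unfolding H_def using deg by (intro degree_add_le degree_sum_le) auto
      fix i assume i: "i < m"
      show "poly_deriv i H u = poly_deriv i (Q u) u"
        unfolding Hd N using B(2)[OF i] by simp
      have "(\<Sum>j<m. poly_deriv i (N j) v) = (\<Sum>j<m. if j = i then \<delta> i else 0)"
      proof (rule sum.cong)
        fix j
        have "(v - u) / h = 1" using h by (simp add: h_def)
        then show "poly_deriv i (N j) v = (if j = i then \<delta> i else 0)"
          unfolding N using B(3)[OF i, of j] h by (simp add: power_one_over)
      qed simp
      also have "\<dots> = \<delta> i" using i by simp
      finally show "poly_deriv i H v = poly_deriv i (Q v) v"
        unfolding Hd by (simp add: \<delta>_def)
    qed
    moreover have "\<bar>poly_deriv m H x\<bar> \<le> C * A / (v - u)"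
    proof -
      \<comment> \<open>A is nonnegative because the case i = 0 of the hypothesis bounds an absolute
        value by a positive multiple of A.\<close>
      have "0 \<le> A * (v - u) ^ (m - 1 - 0)" using A m by (smt (verit) abs_ge_zero less_le_trans zero_less_one)
      moreover have "A * (v - u) ^ (m - 1 - 0) < 0" if "A < 0"
        using that uv by (intro mult_neg_pos) auto
      ultimately have A0: "A \<ge> 0" by (meson not_le)
      have tx: "(x - u) / h \<in> {0..1}" using x h by (auto simp: h_def field_simps)
      have "poly_deriv m (Q u) x = 0" using deg by (rule poly_deriv_eq_0)
      then have "\<bar>poly_deriv m H x\<bar> \<le> (\<Sum>j<m. \<bar>poly_deriv m (N j) x\<bar>)"
        unfolding Hd using sum_abs[of "\<lambda>j. poly_deriv m (N j) x" "{..<m}"] by simp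
      also have "\<dots> \<le> (\<Sum>j<m. A / h * M j)"
      proof (rule sum_mono)
        fix j assume "j \<in> {..<m}"
        then have j: "j < m" by simp
        have "\<bar>\<delta> j\<bar> * h ^ j \<le> (A * h ^ (m - 1 - j)) * h ^ j"
          using A j h unfolding \<delta>_def h_def by (intro mult_right_mono) auto
        also have "\<dots> = A * h ^ (m - 1)" using j by (simp add: power_add[symmetric])
        finally have *: "\<bar>\<delta> j\<bar> * h ^ j \<le> A * h ^ (m - 1)" .
        have "\<bar>poly_deriv m (N j) x\<bar> = (\<bar>\<delta> j\<bar> * h ^ j) * ((1 / h) ^ m * \<bar>poly_deriv m (B j) ((x - u) / h)\<bar>)"
          unfolding N using h by (simp add: abs_mult)
        also have "\<dots> \<le> (A * h ^ (m - 1)) * ((1 / h) ^ m * M j)"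
        proof (rule mult_mono[OF *])
          show "(1 / h) ^ m * \<bar>poly_deriv m (B j) ((x - u) / h)\<bar> \<le> (1 / h) ^ m * M j"
            using M(2)[OF tx, of j] h by (intro mult_left_mono) auto
        qed (use h A0 in auto)
        also have "\<dots> = A / h * M j"
        proof -
          obtain k where "m = Suc k" using m by (cases m) auto
          then show ?thesis using h by (simp add: power_one_over field_simps)
        qed
        finally show "\<bar>poly_deriv m (N j) x\<bar> \<le> A / h * M j" .
      qed
      also have "\<dots> = A / h * (\<Sum>j<m. M j)" by (simp add: sum_distrib_left)
      also have "\<dots> \<le> A / h * C" using A0 h by (intro mult_left_mono) (auto simp: C_def)
      finally show ?thesis by (simp add: h_def mult.commute)
    qed
    ultimately show "\<bar>poly_deriv m (hermite m Q u v) x\<bar> \<le> C * A / (v - u)" by simp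
  qed
qed

text \<open>Choosing the constant once makes it a function of m alone, to which the locales below
  can refer.\<close>

definition hermite_const :: "nat \<Rightarrow> real" where
  "hermite_const m = (SOME C. C > 0 \<and> (\<forall>Q u v A. u < v \<longrightarrow> degree (Q u) < m \<longrightarrow>
    (\<forall>i<m. \<bar>poly_deriv i (Q v) v - poly_deriv i (Q u) v\<bar> \<le> A * (v - u) ^ (m - 1 - i)) \<longrightarrow>
    (\<forall>x\<in>{u..v}. \<bar>poly_deriv m (hermite m Q u v) x\<bar> \<le> C * A / (v - u))))"

lemma hermite_const:
  assumes "m \<ge> 1"
  shows "hermite_const m > 0"
    and "u < v \<Longrightarrow> degree (Q u) < m \<Longrightarrow>
      (\<And>i. i < m \<Longrightarrow> \<bar>poly_deriv i (Q v) v - poly_deriv i (Q u) v\<bar> \<le> A * (v - u) ^ (m - 1 - i)) \<Longrightarrow>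
      x \<in> {u..v} \<Longrightarrow> \<bar>poly_deriv m (hermite m Q u v) x\<bar> \<le> hermite_const m * A / (v - u)"
proof -
  have H: "hermite_const m > 0 \<and> (\<forall>Q u v A. u < v \<longrightarrow> degree (Q u) < m \<longrightarrow>
    (\<forall>i<m. \<bar>poly_deriv i (Q v) v - poly_deriv i (Q u) v\<bar> \<le> A * (v - u) ^ (m - 1 - i)) \<longrightarrow>
    (\<forall>x\<in>{u..v}. \<bar>poly_deriv m (hermite m Q u v) x\<bar> \<le> hermite_const m * A / (v - u)))"
    unfolding hermite_const_def by (rule someI_ex[OF hermite_deriv_bound[OF assms]])
  show "hermite_const m > 0" using H by (rule conjunct1)
  show "\<bar>poly_deriv m (hermite m Q u v) x\<bar> \<le> hermite_const m * A / (v - u)"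
    if "u < v" "degree (Q u) < m" "x \<in> {u..v}"
      "\<And>i. i < m \<Longrightarrow> \<bar>poly_deriv i (Q v) v - poly_deriv i (Q u) v\<bar> \<le> A * (v - u) ^ (m - 1 - i)"
    using conjunct2[OF H, rule_format, of u v Q A x] that by blast
qed

text \<open>The 2 comes from comparing the jets at both endpoints with F, and
  \<open>(2 * real m + 1) ^ m\<close> from hulls of length at most 2m + 1 times the gap, raised to
  the powers that occur in the interpolation error.\<close>

definition gap_const :: "nat \<Rightarrow> real" where
  "gap_const m = hermite_const m * (2 * (2 * real m + 1) ^ m)"

context extension_setting begin

definition gap :: "real \<Rightarrow> real \<Rightarrow> bool" where
  "gap u v \<longleftrightarrow> u \<in> E \<and> v \<in> E \<and> u < v \<and> {u<..<v} \<inter> E = {}"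

text \<open>\<open>T\<close> is the hull of the knots of the two endpoints. It contains few points of \<open>E\<close>, so that
  the sets \<open>T\<close> of different gaps have bounded overlap.\<close>

lemma gap_estimate:
  assumes g: "gap u v"
  shows "\<exists>t1 t2. t1 \<le> u \<and> v \<le> t2 \<and> t2 - t1 \<le> (2 * real m + 1) * (v - u) \<and>
    finite (E \<inter> {t1..t2}) \<and> card (E \<inter> {t1..t2}) \<le> 2 * m \<and>
    (\<forall>x\<in>{u..v}. \<bar>poly_deriv m (hermite m P u v) x\<bar> \<le>
       gap_const m / (v - u) * integral {t1..t2} (\<lambda>t. \<bar>\<Phi> m t\<bar>))"
proof -
  have u: "u \<in> E" and v: "v \<in> E" and uv: "u < v" and em: "{u<..<v} \<inter> E = {}"
    using g by (auto simp: gap_def)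
  have int: "locally_integrable (\<Phi> m)" using chain by (simp add: chain_integrable)
  have m0: "real m > 0" using m by simp
  have gc: "gap_const m > 0" unfolding gap_const_def using hermite_const(1)[OF m] by simp
  show ?thesis
  \<comment> \<open>Equal jets give A = 0 and a vanishing m-th derivative on the gap, so the gap can
    serve as its own hull. Different jets exclude a large jump at either end.\<close>
  proof (cases "P u = P v")
    case True
    have "\<bar>poly_deriv m (hermite m P u v) x\<bar> \<le> hermite_const m * 0 / (v - u)" if "x \<in> {u..v}" for x
      by (rule hermite_const(2)[where Q = P, OF m uv]) (use jet_degree[OF u] that True in auto)
    moreover have "0 \<le> integral {u..v} (\<lambda>t. \<bar>\<Phi> m t\<bar>)"
      by (rule integral_nonneg[OF locally_integrable_abs_integrable_on[OF int]]) simp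
    then have "0 \<le> gap_const m / (v - u) * integral {u..v} (\<lambda>t. \<bar>\<Phi> m t\<bar>)"
      using gc uv by simp
    ultimately have bound: "\<forall>x\<in>{u..v}. \<bar>poly_deriv m (hermite m P u v) x\<bar> \<le>
        gap_const m / (v - u) * integral {u..v} (\<lambda>t. \<bar>\<Phi> m t\<bar>)"
      by (force intro: order_trans)
    have "E \<inter> {u..v} = {u, v}" using u v uv em by (auto simp: less_le)
    moreover have "card {u, v} \<le> 2 * m" using uv m by simp
    moreover have "1 * (v - u) \<le> (2 * real m + 1) * (v - u)"
      using uv by (intro mult_right_mono) auto
    ultimately show ?thesis
      using bound by (intro exI[of _ u] exI[of _ v]) simp
  next
    case False
    define r where "r = v - u"
    have r: "r > 0" using uv by (simp add: r_def)
    have small_u: "jump u j \<le> r" if "j < stop u" for j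
      using same_knots_if_big_jump[OF u v _ that, of r] jet_eq_if_same_knots[OF u v] False uv
      by (force simp: r_def)
    have small_v: "jump v j \<le> r" if "j < stop v" for j
      using same_knots_if_big_jump[OF v u _ that, of r] jet_eq_if_same_knots[OF v u] False uv
      by (force simp: r_def)
    have ball: "\<bar>y - x\<bar> \<le> real m * r" if "y \<in> knots m E a x" "\<And>j. j < stop x \<Longrightarrow> jump x j \<le> r" for x y
    proof -
      have "\<bar>y - x\<bar> \<le> real (stop x) * r"
        using knot_set_in_cball[of "stop x" x r y] that unfolding knots_def by blast
      also have "\<dots> \<le> real m * r" using stop_le[of x] r by (intro mult_right_mono) auto
      finally show ?thesis .
    qed
    define S where "S = knots m E a u \<union> knots m E a v"
    note Su = knots_props[OF u] and Sv = knots_props[OF v]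
    have S: "finite S" "u \<in> S" "v \<in> S" "S \<noteq> {}" using Su Sv by (auto simp: S_def)
    define t1 t2 where "t1 = Min S" and "t2 = Max S"
    have t: "t1 \<in> S" "t2 \<in> S" "t1 \<le> u" "v \<le> t2" "S \<subseteq> {t1..t2}"
      using S by (auto simp: t1_def t2_def)
    have "t2 \<le> v + real m * r"
      using t(2) ball[of t2 u] ball[of t2 v] small_u small_v uv unfolding S_def by force
    moreover have "t1 \<ge> u - real m * r"
      using t(1) ball[of t1 u] ball[of t1 v] small_u small_v uv unfolding S_def by force
    ultimately have len: "t2 - t1 \<le> (2 * real m + 1) * r"
      by (simp add: r_def algebra_simps)
    have cu: "e \<in> knots m E a u" if "p \<in> knots m E a u" "q \<in> knots m E a u" "e \<in> E" "p \<le> e" "e \<le> q" for p q e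
      using knot_set_contiguous[OF u order_refl, of p q e] that unfolding knots_def by blast
    have cv: "e \<in> knots m E a v" if "p \<in> knots m E a v" "q \<in> knots m E a v" "e \<in> E" "p \<le> e" "e \<le> q" for p q e
      using knot_set_contiguous[OF v order_refl, of p q e] that unfolding knots_def by blast
    \<comment> \<open>A point of E in the hull lies weakly on one side of the gap, hence between an
      extreme knot and the endpoint to which that knot belongs, so contiguity makes it a knot of the
      same endpoint.\<close>
    have sub: "E \<inter> {t1..t2} \<subseteq> S"
    proof
      fix e assume e: "e \<in> E \<inter> {t1..t2}"
      then have "e \<le> u \<or> v \<le> e" using em by (meson IntE disjoint_iff greaterThanLessThan_iff not_le)
      then show "e \<in> S"
      proof
        assume "e \<le> u"
        then show ?thesis
          using t(1) cu[of t1 u e] cv[of t1 v e] e uv Su(3) Sv(3) unfolding S_def by auto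
      next
        assume "v \<le> e"
        then show ?thesis
          using t(2) cu[of u t2 e] cv[of v t2 e] e uv Su(3) Sv(3) unfolding S_def by auto
      qed
    qed
    have "card (E \<inter> {t1..t2}) \<le> card S" by (rule card_mono[OF S(1) sub])
    also have "\<dots> \<le> m + m" unfolding S_def using card_Un_le[of "knots m E a u" "knots m E a v"] Su(5) Sv(5) by linarith
    finally have card: "card (E \<inter> {t1..t2}) \<le> 2 * m" by simp
    define I where "I = integral {t1..t2} (\<lambda>t. \<bar>\<Phi> m t\<bar>)"
    have I0: "I \<ge> 0" unfolding I_def
      by (rule integral_nonneg[OF locally_integrable_abs_integrable_on[OF int]]) simp
    define L where "L = 2 * real m + 1"
    have L: "L \<ge> 1" by (simp add: L_def)
    \<comment> \<open>Both jets are compared with \<Phi> at v over the common hull; replacing the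
      power of L by \<open>L ^ m\<close> makes the constant independent of i.\<close>
    have "\<bar>poly_deriv i (P v) v - poly_deriv i (P u) v\<bar> \<le> (2 * L ^ m * I) * r ^ (m - 1 - i)" if i: "i < m" for i
    proof -
      have vin: "v \<in> {t1..t2}" using t uv by auto
      have "\<bar>poly_deriv i (P u) v - \<Phi> i v\<bar> \<le> (t2 - t1) ^ (m - 1 - i) * I"
        unfolding I_def using t(5) by (intro jet_error[OF u _ i vin]) (auto simp: S_def)
      moreover have "\<bar>poly_deriv i (P v) v - \<Phi> i v\<bar> \<le> (t2 - t1) ^ (m - 1 - i) * I"
        unfolding I_def using t(5) by (intro jet_error[OF v _ i vin]) (auto simp: S_def)
      moreover have "(t2 - t1) ^ (m - 1 - i) * I \<le> (L ^ m * r ^ (m - 1 - i)) * I"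
      proof (rule mult_right_mono[OF _ I0])
        have "(t2 - t1) ^ (m - 1 - i) \<le> (L * r) ^ (m - 1 - i)"
          using len t uv by (intro power_mono) (auto simp: L_def)
        also have "\<dots> = L ^ (m - 1 - i) * r ^ (m - 1 - i)" by (rule power_mult_distrib)
        also have "\<dots> \<le> L ^ m * r ^ (m - 1 - i)"
          using L r by (intro mult_right_mono power_increasing) auto
        finally show "(t2 - t1) ^ (m - 1 - i) \<le> L ^ m * r ^ (m - 1 - i)" .
      qed
      ultimately show ?thesis by (simp add: algebra_simps)
    qed
    then have "\<bar>poly_deriv m (hermite m P u v) x\<bar> \<le> hermite_const m * (2 * L ^ m * I) / (v - u)" if "x \<in> {u..v}" for x
      unfolding r_def by (intro hermite_const(2)[where Q = P, OF m uv]) (use jet_degree[OF u] that in auto)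
    then show ?thesis
      using t len card finite_subset[OF sub S(1)]
      by (intro exI[of _ t1] exI[of _ t2]) (auto simp: gap_const_def L_def I_def r_def mult.assoc)
  qed
qed

end

section \<open>The derivatives of the extension\<close>

context extension_setting begin

text \<open>The polynomial itself is recorded, not its value, so that candidates for all derivatives
  can be read off before the extension is known to be differentiable.\<close>

definition piece :: "real \<Rightarrow> real poly" where
  "piece x = (if x \<in> E then P x else gap_poly m P (connected_component_set (- E) x))"

text \<open>At the limit points of \<open>E\<close>, that is, at all but countably many points of \<open>E\<close>, the extension
  and \<open>F\<close> have the same jet; this is why the \<open>m\<close>-th derivative of \<open>F\<close> is the right choice on \<open>E\<close>.\<close>

definition ext_chain :: "nat \<Rightarrow> real \<Rightarrow> real" where
  "ext_chain i x = (if i = m \<and> x \<in> E then \<Phi> m x else poly_deriv i (piece x) x)"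

lemma ext_chain_0: "ext_chain 0 = extension m E a f"
  using m by (auto simp: ext_chain_def piece_def extension_def fun_eq_iff)

section \<open>Components of the complement of E and their polynomials\<close>

lemma component_eq:
  assumes "x \<in> S" "connected S" "S \<inter> E = {}"
    and "\<And>y. y \<notin> S \<Longrightarrow> \<exists>e\<in>E. (x \<le> e \<and> e \<le> y) \<or> (y \<le> e \<and> e \<le> x)"
  shows "connected_component_set (- E) x = S"
proof
  let ?C = "connected_component_set (- E) x"
  show "S \<subseteq> ?C" using assms by (intro connected_component_maximal) auto
  show "?C \<subseteq> S"
  proof (rule subsetI, rule ccontr)
    fix y assume y: "y \<in> ?C" "y \<notin> S"
    have x: "x \<in> ?C" using assms(1,3) by (auto simp: connected_component_refl_eq)
    have con: "connected ?C" by simp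
    obtain e where e: "e \<in> E" "(x \<le> e \<and> e \<le> y) \<or> (y \<le> e \<and> e \<le> x)" using assms(4)[OF y(2)] by blast
    then have "e \<in> ?C"
      using connectedD_interval[OF con x y(1)] connectedD_interval[OF con y(1) x] by blast
    then show False using e(1) connected_component_subset by fastforce
  qed
qed

lemma component_gap:
  assumes "gap u v" "u < x" "x < v"
  shows "connected_component_set (- E) x = {u<..<v}"
proof (rule component_eq)
  fix y assume "y \<notin> {u<..<v}"
  then show "\<exists>e\<in>E. (x \<le> e \<and> e \<le> y) \<or> (y \<le> e \<and> e \<le> x)"
    using assms by (cases "y \<le> u") (auto simp: gap_def intro: less_imp_le)
qed (use assms in \<open>auto simp: gap_def\<close>)

lemma component_below:
  assumes "v \<in> E" "{..<v} \<inter> E = {}" "x < v"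
  shows "connected_component_set (- E) x = {..<v}"
proof (rule component_eq)
  fix y assume "y \<notin> {..<v}"
  then show "\<exists>e\<in>E. (x \<le> e \<and> e \<le> y) \<or> (y \<le> e \<and> e \<le> x)"
    using assms by (intro bexI[of _ v]) auto
qed (use assms in auto)

lemma component_above:
  assumes "u \<in> E" "{u<..} \<inter> E = {}" "u < x"
  shows "connected_component_set (- E) x = {u<..}"
proof (rule component_eq)
  fix y assume "y \<notin> {u<..}"
  then show "\<exists>e\<in>E. (x \<le> e \<and> e \<le> y) \<or> (y \<le> e \<and> e \<le> x)"
    using assms by (intro bexI[of _ u]) auto
qed (use assms in auto)

lemma gap_poly_gap: "u < v \<Longrightarrow> gap_poly m Q {u<..<v} = hermite m Q u v"
  by (simp add: gap_poly_def)

lemma gap_poly_below: "gap_poly m Q {..<v} = Q v"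
proof -
  have "\<not> bdd_below {..<v}"
  proof
    assume "bdd_below {..<v}"
    then obtain M where "\<And>t. t < v \<Longrightarrow> M \<le> t" unfolding bdd_below_def by auto
    from this[of "min M v - 1"] show False by linarith
  qed
  then show ?thesis by (simp add: gap_poly_def)
qed

lemma gap_poly_above: "gap_poly m Q {u<..} = Q u"
proof -
  have "\<not> bdd_above {u<..}"
  proof
    assume "bdd_above {u<..}"
    then obtain M where "\<And>t. u < t \<Longrightarrow> t \<le> M" unfolding bdd_above_def by auto
    from this[of "max M u + 1"] show False by linarith
  qed
  then show ?thesis by (simp add: gap_poly_def)
qed

lemma piece_gap:
  assumes "gap u v" "u < x" "x < v"
  shows "piece x = hermite m P u v"
proof -
  have "x \<notin> E" "u < v" using assms by (auto simp: gap_def)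
  then show ?thesis using component_gap[OF assms] by (simp add: piece_def gap_poly_gap)
qed

lemma piece_below:
  assumes "v \<in> E" "{..<v} \<inter> E = {}" "x < v"
  shows "piece x = P v"
proof -
  have "x \<notin> E" using assms by auto
  then show ?thesis using component_below[OF assms] by (simp add: piece_def gap_poly_below)
qed

lemma piece_above:
  assumes "u \<in> E" "{u<..} \<inter> E = {}" "u < x"
  shows "piece x = P u"
proof -
  have "x \<notin> E" using assms by auto
  then show ?thesis using component_above[OF assms] by (simp add: piece_def gap_poly_above)
qed

lemma outside_cases:
  assumes x: "x \<notin> E"
  obtains (gap) u v where "gap u v" "u < x" "x < v"
  | (below) v where "v \<in> E" "{..<v} \<inter> E = {}" "x < v"
  | (above) u where "u \<in> E" "{u<..} \<inter> E = {}" "u < x"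
proof -
  have left: "\<exists>u\<in>E. u < x \<and> {u<..x} \<inter> E = {}" if "w \<in> E" "w < x" for w
    using closed_left_neighbour[OF closed_E that(1), of x] that x by (metis less_le order_less_imp_le)
  have right: "\<exists>v\<in>E. x < v \<and> {x..<v} \<inter> E = {}" if "w \<in> E" "x < w" for w
    using closed_right_neighbour[OF closed_E that(1), of x] that x by (metis less_le order_less_imp_le)
  have "E \<noteq> {}" using large m by auto
  then obtain e where e: "e \<in> E" "e < x \<or> x < e" using x by (metis all_not_in_conv linorder_neqE_linordered_idom)
  consider (both) w w' where "w \<in> E" "w < x" "w' \<in> E" "x < w'"
    | (lo) "e < x" "\<And>w. w \<in> E \<Longrightarrow> w \<le> x" | (hi) "x < e" "\<And>w. w \<in> E \<Longrightarrow> x \<le> w"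
    using e by (meson not_le)
  then show ?thesis
  proof cases
    case both
    obtain u where u: "u \<in> E" "u < x" "{u<..x} \<inter> E = {}" using left both by blast
    obtain v where v: "v \<in> E" "x < v" "{x..<v} \<inter> E = {}" using right both by blast
    have "{u<..<v} \<subseteq> {u<..x} \<union> {x..<v}" by auto
    then have "gap u v" using u v unfolding gap_def by auto
    then show ?thesis using gap u v by blast
  next
    case lo
    obtain u where u: "u \<in> E" "u < x" "{u<..x} \<inter> E = {}" using left lo(1) e(1) by blast
    have "{u<..} \<inter> E \<subseteq> {u<..x} \<inter> E" using lo(2) by auto
    then have "{u<..} \<inter> E = {}" using u(3) by blast
    then show ?thesis using above u by blast
  next
    case hi
    obtain v where v: "v \<in> E" "x < v" "{x..<v} \<inter> E = {}" using right hi(1) e(1) by blast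
    have "{..<v} \<inter> E \<subseteq> {x..<v} \<inter> E" using hi(2) by auto
    then have "{..<v} \<inter> E = {}" using v(3) by blast
    then show ?thesis using below v by blast
  qed
qed

text \<open>The Hermite conditions let the polynomial of a gap take over the jets at both endpoints,
  so for orders below m one polynomial represents the data on the closed interval. The top order is
  claimed only inside, since on E it is borrowed from F.\<close>

lemma local_poly:
  assumes xy: "x < y" and em: "{x<..<y} \<inter> E = {}"
  shows "\<exists>Q. (\<forall>t\<in>{x..y}. \<forall>i<m. ext_chain i t = poly_deriv i Q t) \<and>
    (\<forall>t\<in>{x<..<y}. ext_chain m t = poly_deriv m Q t)"
proof -
  \<comment> \<open>The midpoint lies outside E and singles out the component, of which the interval
    may be only a part.\<close>
  define z where "z = (x + y) / 2"
  have z: "x < z" "z < y" using xy by (auto simp: z_def)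
  then have zE: "z \<notin> E" using em by auto
  have inner: "t \<notin> E" if "t \<in> {x<..<y}" for t using em that by auto
  have lo: "u \<le> x" if "u \<in> E" "u < z" for u using inner[of u] that z by force
  have hi: "y \<le> v" if "v \<in> E" "z < v" for v using inner[of v] that z by force
  from zE show ?thesis
  proof (cases rule: outside_cases)
    case (gap u v)
    have u: "u \<in> E" "v \<in> E" "u < v" using gap(1) by (auto simp: gap_def)
    have b: "u \<le> x" "y \<le> v" using lo hi u gap by auto
    let ?Q = "hermite m P u v"
    have "ext_chain i t = poly_deriv i ?Q t" if ti: "t \<in> {x..y}" "i < m" for i t
    proof -
      have "u \<le> t" "t \<le> v" using ti b by auto
      then consider "t = u" | "t = v" | "u < t" "t < v" by linarith
      then show ?thesis
        using piece_gap[OF gap(1), of t] u ti hermite_props(2,3)[OF m u(3) ti(2), of P]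
        by cases (auto simp: ext_chain_def piece_def)
    qed
    moreover have "ext_chain m t = poly_deriv m ?Q t" if "t \<in> {x<..<y}" for t
      using piece_gap[OF gap(1), of t] inner[OF that] that b by (simp add: ext_chain_def)
    ultimately show ?thesis by blast
  next
    case (below v)
    have b: "y \<le> v" using hi below by auto
    have "ext_chain i t = poly_deriv i (P v) t" if "t \<in> {x..y}" "i < m" for i t
      using piece_below[OF below(1,2), of t] that b below(1)
      by (cases "t = v") (auto simp: ext_chain_def piece_def)
    moreover have "ext_chain m t = poly_deriv m (P v) t" if "t \<in> {x<..<y}" for t
      using piece_below[OF below(1,2), of t] inner[OF that] that b by (simp add: ext_chain_def)
    ultimately show ?thesis by blast
  next
    case (above u)
    have b: "u \<le> x" using lo above by auto
    have "ext_chain i t = poly_deriv i (P u) t" if "t \<in> {x..y}" "i < m" for i t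
      using piece_above[OF above(1,2), of t] that b above(1)
      by (cases "t = u") (auto simp: ext_chain_def piece_def)
    moreover have "ext_chain m t = poly_deriv m (P u) t" if "t \<in> {x<..<y}" for t
      using piece_above[OF above(1,2), of t] inner[OF that] that b by (simp add: ext_chain_def)
    ultimately show ?thesis by blast
  qed
qed

section \<open>Integral formulas between the derivatives of the extension\<close>

lemma ext_chain_integral_on_gap:
  assumes "x < y" "{x<..<y} \<inter> E = {}" "i < m"
  shows "(ext_chain (Suc i) has_integral ext_chain i y - ext_chain i x) {x..y}"
proof -
  obtain Q where Q: "\<And>t i. t \<in> {x..y} \<Longrightarrow> i < m \<Longrightarrow> ext_chain i t = poly_deriv i Q t"
    "\<And>t. t \<in> {x<..<y} \<Longrightarrow> ext_chain m t = poly_deriv m Q t"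
    using local_poly[OF assms(1,2)] by blast
  have "(poly_deriv (Suc i) Q has_integral poly_deriv i Q y - poly_deriv i Q x) {x..y}"
    using assms(1) has_deriv_poly_deriv[of i Q]
    by (intro fundamental_theorem_of_calculus)
       (auto simp: has_real_derivative_iff_has_vector_derivative[symmetric] intro: has_field_derivative_at_within)
  then have "(ext_chain (Suc i) has_integral poly_deriv i Q y - poly_deriv i Q x) {x..y}"
  \<comment> \<open>At the two ends the top entry may be a value of \<open>\<Phi> m\<close>; a
    finite set does not affect the integral.\<close>
  proof (rule has_integral_spike[of "{x, y}", rotated 2])
    fix t assume "t \<in> {x..y} - {x, y}"
    then show "ext_chain (Suc i) t = poly_deriv (Suc i) Q t"
      using Q(1)[of t "Suc i"] Q(2)[of t] assms(3) by (cases "Suc i = m") auto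
  qed simp
  then show ?thesis using Q(1)[of x i] Q(1)[of y i] assms by simp
qed

text \<open>By \<open>jump_near_limpt\<close> every jump from t is at most the distance of t to u,
  so the knots of t lie within m + 1 such distances of u: m for the jumps and one for t itself. The
  interpolation error over this interval tends to 0 as t tends to u, for i = m-1 by continuity of V
  alone.\<close>

lemma ext_chain_tendsto_at_limpt:
  assumes u: "u islimpt E" and i: "i < m"
  shows "((\<lambda>t. ext_chain i t - \<Phi> i t) \<longlongrightarrow> 0) (at u within E)"
proof -
  have int: "locally_integrable (\<Phi> m)" using chain by (simp add: chain_integrable)
  then have iabs: "locally_integrable (\<lambda>t. \<bar>\<Phi> m t\<bar>)"
    unfolding locally_integrable_def by (auto intro: set_integrable_abs)
  obtain V where V: "\<And>x y. x \<le> y \<Longrightarrow> V y - V x = integral {x..y} (\<lambda>t. \<bar>\<Phi> m t\<bar>)"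
    using antiderivative_exists[OF iabs] by blast
  have cV: "continuous_on UNIV V" by (rule continuous_on_if_integral[OF iabs V])
  define R where "R t = (real m + 1) * \<bar>t - u\<bar>" for t
  define B where "B t = (2 * R t) ^ (m - 1 - i) * (V (u + R t) - V (u - R t))" for t
  have cR: "continuous_on UNIV R" unfolding R_def by (intro continuous_intros)
  have "continuous_on UNIV B"
    unfolding B_def by (intro continuous_intros cR continuous_on_compose2[OF cV]) auto
  then have "(B \<longlongrightarrow> B u) (at u within E)"
    by (meson continuous_on_def iso_tuple_UNIV_I subset_UNIV tendsto_within_subset)
  moreover have "B u = 0" by (simp add: B_def R_def)
  ultimately have B0: "(B \<longlongrightarrow> 0) (at u within E)" by simp
  show ?thesis
  proof (rule Lim_null_comparison[OF _ B0])
    have "norm (ext_chain i t - \<Phi> i t) \<le> B t" if t: "t \<in> E" for t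
    proof -
      let ?r = "\<bar>t - u\<bar>"
      have "knots m E a t \<subseteq> {u - R t..u + R t}"
      proof
        fix y assume "y \<in> knots m E a t"
        then have "\<bar>y - t\<bar> \<le> real (stop t) * ?r"
          using knot_set_in_cball[of "stop t" t ?r y] jump_near_limpt[OF t u] unfolding knots_def by blast
        also have "\<dots> \<le> real m * ?r" using stop_le[of t] by (intro mult_right_mono) auto
        finally have "\<bar>y - u\<bar> \<le> R t" by (simp add: R_def distrib_right)
        then show "y \<in> {u - R t..u + R t}" by (auto simp: abs_le_iff)
      qed
      moreover have "t \<in> {u - R t..u + R t}"
      proof -
        have "1 * ?r \<le> R t" unfolding R_def by (intro mult_right_mono) auto
        then show ?thesis by (auto simp: abs_le_iff)
      qed
      ultimately have "\<bar>poly_deriv i (P t) t - \<Phi> i t\<bar> \<le>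
          ((u + R t) - (u - R t)) ^ (m - 1 - i) * integral {u - R t..u + R t} (\<lambda>t. \<bar>\<Phi> m t\<bar>)"
        by (intro jet_error[OF t _ i])
      also have "\<dots> = B t"
      proof -
        have "R t \<ge> 0" by (simp add: R_def)
        then show ?thesis using V[of "u - R t" "u + R t"] by (simp add: B_def)
      qed
      finally show ?thesis using t i by (simp add: ext_chain_def piece_def)
    qed
    then show "\<forall>\<^sub>F t in at u within E. norm (ext_chain i t - \<Phi> i t) \<le> B t"
      by (auto simp: eventually_at_filter)
  qed
qed

text \<open>The gluing is applied to the difference with \<Phi>, the quantity that vanishes at limit
  points of E, and the integral formula of \<Phi> is added back. In the top order the difference is
  0 there by the definition of \<open>ext_chain\<close> on E.\<close>

lemma ext_chain_step:
  assumes i: "i < m" and int: "locally_integrable (ext_chain (Suc i))" and xy: "x \<le> y"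
  shows "ext_chain i y - ext_chain i x = integral {x..y} (ext_chain (Suc i))"
proof -
  let ?\<phi> = "\<lambda>t. ext_chain i t - \<Phi> i t" and ?\<kappa> = "\<lambda>t. ext_chain (Suc i) t - \<Phi> (Suc i) t"
  have int\<Phi>: "locally_integrable (\<Phi> (Suc i))" using chain i by (simp add: chain_integrable)
  have E: "u \<in> E" if "u islimpt E" for u using closed_E that closed_limpt by blast
  have "?\<phi> y - ?\<phi> x = integral {x..y} ?\<kappa>"
  proof (rule integral_formula_glue[OF locally_integrable_diff[OF int int\<Phi>] _ _ _ _ xy, of E])
    fix s t :: real assume st: "s < t" "{s<..<t} \<inter> E = {}"
    have "(\<Phi> (Suc i) has_integral \<Phi> i t - \<Phi> i s) {s..t}"
      using chain_integral[OF chain i, of s t] st locally_integrable_on[OF int\<Phi>, of s t]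
      by (metis has_integral_integral less_imp_le)
    then have "(?\<kappa> has_integral (ext_chain i t - ext_chain i s) - (\<Phi> i t - \<Phi> i s)) {s..t}"
      by (intro has_integral_diff ext_chain_integral_on_gap[OF st i])
    then show "?\<phi> t - ?\<phi> s = integral {s..t} ?\<kappa>" by (simp add: integral_unique algebra_simps)
  next
    fix u assume u: "u islimpt E"
    show "?\<phi> u = 0" using jet_at_limpt[OF u i] E[OF u] i by (simp add: ext_chain_def piece_def)
    show "?\<kappa> u = 0"
      using jet_at_limpt[OF u, of "Suc i"] E[OF u] i by (cases "Suc i = m") (auto simp: ext_chain_def piece_def)
    show "(?\<phi> \<longlongrightarrow> 0) (at u within E)" by (rule ext_chain_tendsto_at_limpt[OF u i])
  qed
  then show ?thesis
    using chain_integral[OF chain i xy]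
      Henstock_Kurzweil_Integration.integral_diff[OF locally_integrable_on[OF int] locally_integrable_on[OF int\<Phi>], of x y]
    by simp
qed

text \<open>Downward induction: a primitive of a locally integrable entry is continuous, hence
  locally integrable. Only the top entry has to be controlled from outside, through its
  \<open>L_p\<close> bound.\<close>

lemma ext_chain_chain:
  assumes "locally_integrable (ext_chain m)"
  shows "antideriv_chain m ext_chain"
proof -
  have int: "locally_integrable (ext_chain i)" if "i \<le> m" for i
    using that
  proof (induction i rule: inc_induct)
    case (step i)
    show ?case
      by (intro continuous_imp_locally_integrable, rule continuous_on_if_integral[OF step.IH])
         (use step in \<open>auto intro: ext_chain_step\<close>)
  qed (rule assms)
  then show ?thesis
    unfolding antideriv_chain_def using ext_chain_step by auto
qed

lemma extension_on_E: "x \<in> E \<Longrightarrow> extension m E a f x = f x"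
  using jet_at_knot[of x x] knots_props(3)[of x] on_E by (simp add: extension_def)

text \<open>Off E the function is locally a derivative of a polynomial, hence continuous on an open
  set; on E it is \<open>\<Phi> m\<close>.\<close>

lemma ext_chain_measurable:
  assumes "\<Phi> m \<in> borel_measurable lebesgue"
  shows "ext_chain m \<in> borel_measurable lebesgue"
proof -
  have op: "open (- E)" using closed_E by (rule open_Compl)
  have "isCont (ext_chain m) x" if x: "x \<in> - E" for x
  proof -
    obtain e where e: "e > 0" "ball x e \<subseteq> - E" using op x open_contains_ball by blast
    then have em: "{x - e<..<x + e} \<inter> E = {}" by (auto simp: ball_eq_greaterThanLessThan)
    obtain Q where Q: "\<And>t. t \<in> {x - e<..<x + e} \<Longrightarrow> ext_chain m t = poly_deriv m Q t"
      using local_poly[OF _ em] e(1) by auto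
    have "isCont (poly_deriv m Q) x" by simp
    then have "(poly_deriv m Q \<longlongrightarrow> ext_chain m x) (at x)"
      using Q[of x] e(1) by (simp add: isCont_def)
    then have "(ext_chain m \<longlongrightarrow> ext_chain m x) (at x)"
      by (rule Lim_transform_within_open[of _ _ _ _ "{x - e<..<x + e}"]) (use Q e(1) in auto)
    then show ?thesis by (simp add: isCont_def)
  qed
  then have "continuous_on (- E) (ext_chain m)" by (intro continuous_at_imp_continuous_on) blast
  then have "(\<lambda>x. indicator (- E) x *\<^sub>R ext_chain m x) \<in> borel_measurable borel"
    using op by (intro borel_measurable_continuous_on_indicator) auto
  then have "(\<lambda>x. indicator (- E) x *\<^sub>R ext_chain m x) \<in> borel_measurable lebesgue"
    by (intro measurable_completion) simp
  moreover have "(\<lambda>x. indicator E x * \<Phi> m x) \<in> borel_measurable lebesgue"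
    using closed_E assms by (intro borel_measurable_times borel_measurable_indicator) auto
  ultimately have "(\<lambda>x. indicator (- E) x *\<^sub>R ext_chain m x + indicator E x * \<Phi> m x) \<in> borel_measurable lebesgue"
    by (rule borel_measurable_add)
  moreover have "(\<lambda>x. indicator (- E) x *\<^sub>R ext_chain m x + indicator E x * \<Phi> m x) = ext_chain m"
    by (auto simp: fun_eq_iff indicator_def ext_chain_def)
  ultimately show ?thesis by simp
qed

end

section \<open>Bounds in \<open>L\<^sub>p\<close>\<close>

text \<open>Convexity of the power function. The point s = 0 is treated by hand because convexity is
  used on the open half-line.\<close>

lemma powr_above_tangent:
  fixes s A q :: real
  assumes "A > 0" "s \<ge> 0" "q \<ge> 1"
  shows "s powr q \<ge> A powr q + q * A powr (q - 1) * (s - A)"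
proof (cases "s = 0")
  case True
  have "A powr q = A * A powr (q - 1)" using assms(1) by (simp add: powr_diff)
  then have "A powr q + q * A powr (q - 1) * (s - A) = (1 - q) * A powr q" using True by (simp add: algebra_simps)
  also have "\<dots> \<le> 0" using assms(3) by (intro mult_nonpos_nonneg) auto
  finally show ?thesis using True by simp
next
  case False
  have "s powr q - A powr q \<ge> (q * A powr (q - 1)) * (s - A)"
  proof (rule convex_on_imp_above_tangent[of "{0<..}"])
    show "convex_on {0<..} (\<lambda>x. x powr q)" using assms(3) by (rule powr_convex)
    show "((\<lambda>x. x powr q) has_field_derivative q * A powr (q - 1)) (at A within {0<..})"
      by (rule has_field_derivative_at_within[OF has_real_derivative_powr[OF assms(1)]])
  qed (use assms False in \<open>auto simp: interior_open\<close>)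
  then show ?thesis by simp
qed

text \<open>Jensen's inequality in its tangent form: the tangent is taken at the mean A of the
  modulus of g, so the linear term integrates to 0. The only factor is a power of the length, with
  no further dependence on q.\<close>

lemma integral_powr_le:
  fixes g :: "real \<Rightarrow> real"
  assumes q: "q > 1" and ab: "a < b" and g: "locally_integrable g"
    and gq: "integrable lebesgue (\<lambda>x. \<bar>g x\<bar> powr q)"
  shows "(integral {a..b} (\<lambda>x. \<bar>g x\<bar>)) powr q \<le> (b - a) powr (q - 1) * integral {a..b} (\<lambda>x. \<bar>g x\<bar> powr q)"
proof -
  define I where "I = integral {a..b} (\<lambda>x. \<bar>g x\<bar>)"
  have i1: "(\<lambda>x. \<bar>g x\<bar>) integrable_on {a..b}" by (rule locally_integrable_abs_integrable_on[OF g])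
  have "set_integrable lebesgue {a..b} (\<lambda>x. \<bar>g x\<bar> powr q)"
    unfolding set_integrable_def using integrable_mult_indicator[OF _ gq, of "{a..b}"] by simp
  then have i2: "(\<lambda>x. \<bar>g x\<bar> powr q) integrable_on {a..b}" by (rule set_lebesgue_integral_eq_integral(1))
  have I0: "I \<ge> 0" unfolding I_def by (rule integral_nonneg[OF i1]) simp
  show ?thesis
  proof (cases "I = 0")
    case True
    have "0 \<le> integral {a..b} (\<lambda>x. \<bar>g x\<bar> powr q)" by (rule integral_nonneg[OF i2]) simp
    then show ?thesis using True by (simp add: I_def)
  next
    case False
    define A where "A = I / (b - a)"
    have A: "A > 0" using False I0 ab by (simp add: A_def)
    have "((\<lambda>x. A powr q + q * A powr (q - 1) * (\<bar>g x\<bar> - A)) has_integral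
       (b - a) * A powr q + q * A powr (q - 1) * (I - (b - a) * A)) {a..b}"
      unfolding I_def using ab has_integral_const_real[of "A powr q" a b] has_integral_const_real[of A a b]
      by (intro has_integral_add has_integral_mult_right has_integral_diff integrable_integral[OF i1]) auto
    moreover have "I - (b - a) * A = 0" using ab by (simp add: A_def)
    ultimately have "((\<lambda>x. A powr q + q * A powr (q - 1) * (\<bar>g x\<bar> - A)) has_integral (b - a) * A powr q) {a..b}"
      by simp
    then have "(b - a) * A powr q \<le> integral {a..b} (\<lambda>x. \<bar>g x\<bar> powr q)"
      using integrable_integral[OF i2] powr_above_tangent[OF A _ less_imp_le[OF q]]
      by (rule has_integral_le) simp
    then have "(b - a) powr (q - 1) * ((b - a) * A powr q) \<le> (b - a) powr (q - 1) * integral {a..b} (\<lambda>x. \<bar>g x\<bar> powr q)"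
      by (intro mult_left_mono) auto
    moreover have "(b - a) powr (q - 1) * ((b - a) * A powr q) = I powr q"
    proof -
      have "(b - a) powr (q - 1) * (b - a) = (b - a) powr q" using ab by (simp add: powr_diff)
      then have "(b - a) powr (q - 1) * ((b - a) * A powr q) = (b - a) powr q * A powr q"
        by (simp add: mult.assoc[symmetric])
      also have "\<dots> = ((b - a) * A) powr q" by (simp add: powr_mult)
      also have "(b - a) * A = I" using ab by (simp add: A_def)
      finally show ?thesis .
    qed
    ultimately show ?thesis by (simp add: I_def)
  qed
qed

section \<open>Membership in \<open>L_p\<close>, uniform integrability and absolute
  continuity\<close>

lemma Lp_spaceD_real:
  assumes "g \<in> Lp_space (ereal q)"
  shows "g \<in> borel_measurable lebesgue" "integrable lebesgue (\<lambda>x. \<bar>g x\<bar> powr q)"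
  using assms by (auto simp: Lp_space_def)

lemma esssup_bound:
  assumes "g \<in> Lp_space \<infinity>"
  shows "Lp_norm \<infinity> g \<ge> 0" "AE x in lebesgue. \<bar>g x\<bar> \<le> Lp_norm \<infinity> g"
proof -
  let ?s = "esssup lebesgue (\<lambda>x. ereal \<bar>g x\<bar>)"
  have fin: "?s < \<infinity>" using assms by (simp add: Lp_space_def)
  have AE: "AE x in lebesgue. ereal \<bar>g x\<bar> \<le> ?s" by (rule esssup_AE)
  have "0 \<le> ?s"
  proof -
    have "esssup lebesgue (\<lambda>x :: real. 0 :: ereal) = 0" by (rule esssup_const) simp
    moreover have "esssup lebesgue (\<lambda>x :: real. 0 :: ereal) \<le> ?s" by (rule esssup_mono) auto
    ultimately show ?thesis by simp
  qed
  then show "Lp_norm \<infinity> g \<ge> 0" by (simp add: Lp_norm_def real_of_ereal_pos)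
  have eq: "ereal (Lp_norm \<infinity> g) = ?s"
    using \<open>0 \<le> ?s\<close> fin by (cases ?s) (auto simp: Lp_norm_def)
  then show "AE x in lebesgue. \<bar>g x\<bar> \<le> Lp_norm \<infinity> g"
    using AE unfolding eq[symmetric] by simp
qed

lemma Lp_infinityI:
  assumes "g \<in> borel_measurable lebesgue" "AE x in lebesgue. \<bar>g x\<bar> \<le> M" "M \<ge> 0"
  shows "g \<in> Lp_space \<infinity> \<and> Lp_norm \<infinity> g \<le> M"
proof -
  have s: "esssup lebesgue (\<lambda>x. ereal \<bar>g x\<bar>) \<le> ereal M"
    by (rule esssup_I) (use assms in auto)
  then have "esssup lebesgue (\<lambda>x. ereal \<bar>g x\<bar>) < \<infinity>" by (rule le_less_trans) simp
  then have "g \<in> Lp_space \<infinity>" using assms(1) by (simp add: Lp_space_def)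
  moreover have "Lp_norm \<infinity> g \<le> M"
    using s assms(3) by (cases "esssup lebesgue (\<lambda>x. ereal \<bar>g x\<bar>)") (auto simp: Lp_norm_def)
  ultimately show ?thesis ..
qed

lemma bounded_locally_integrable:
  fixes g :: "real \<Rightarrow> real"
  assumes "g \<in> borel_measurable lebesgue" "h \<in> borel_measurable lebesgue"
    and "integrable lebesgue h" "AE x in lebesgue. \<bar>g x\<bar> \<le> M + h x"
  shows "locally_integrable g"
  unfolding locally_integrable_def
proof (intro allI)
  fix a b :: real
  have c: "set_integrable lebesgue {a..b} (\<lambda>x. M + h x)"
  proof (rule set_integral_add(1))
    show "set_integrable lebesgue {a..b} (\<lambda>x. M)"
      by (rule locally_integrable_abs_on, rule continuous_imp_locally_integrable) (intro continuous_intros)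
    show "set_integrable lebesgue {a..b} h"
      unfolding set_integrable_def by (rule integrable_mult_indicator[OF _ assms(3)]) simp
  qed
  show "set_integrable lebesgue {a..b} g"
    unfolding set_integrable_def
  proof (rule Bochner_Integration.integrable_bound[OF c[unfolded set_integrable_def]])
    show "(\<lambda>x. indicator {a..b} x *\<^sub>R g x) \<in> borel_measurable lebesgue"
      using assms(1) by (intro borel_measurable_scaleR borel_measurable_indicator) auto
    show "AE x in lebesgue. norm (indicator {a..b} x *\<^sub>R g x) \<le> norm (indicator {a..b} x *\<^sub>R (M + h x))"
      using assms(4) by eventually_elim (auto simp: indicator_def)
  qed
qed

text \<open>Above the level M the surplus power \<open>\<bar>y\<bar> powr (q - 1)\<close> is at
  least \<open>M powr (q - 1)\<close>, which pays for the linear term.\<close>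

lemma abs_le_powr:
  fixes y M q :: real
  assumes "M > 0" "q > 1"
  shows "\<bar>y\<bar> \<le> M + M powr (1 - q) * \<bar>y\<bar> powr q"
proof (cases "\<bar>y\<bar> \<le> M")
  case False
  then have y: "\<bar>y\<bar> > M" by simp
  have "M powr (q - 1) \<le> \<bar>y\<bar> powr (q - 1)" using y assms by (intro powr_mono2) auto
  then have "M powr (1 - q) * M powr (q - 1) * \<bar>y\<bar> \<le> M powr (1 - q) * \<bar>y\<bar> powr (q - 1) * \<bar>y\<bar>"
    by (intro mult_right_mono mult_left_mono) auto
  moreover have "M powr (1 - q) * M powr (q - 1) = 1" using assms by (simp add: powr_add[symmetric])
  moreover have "\<bar>y\<bar> powr (q - 1) * \<bar>y\<bar> = \<bar>y\<bar> powr q" using y assms by (simp add: powr_diff)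
  ultimately show ?thesis using assms by (simp add: mult.assoc)
qed (simp add: add_increasing2)

lemma Lp_locally_integrable:
  assumes "p > 1" "g \<in> Lp_space p"
  shows "locally_integrable g"
proof (cases p)
  case (real q)
  then have q: "q > 1" using assms(1) by simp
  note g = Lp_spaceD_real[of g q]
  show ?thesis
    by (rule bounded_locally_integrable[of g "\<lambda>x. 1 powr (1 - q) * \<bar>g x\<bar> powr q" 1])
       (use g assms(2) real abs_le_powr[of 1 q] q in auto)
next
  case PInf
  have "g \<in> borel_measurable lebesgue" using assms(2) by (simp add: Lp_space_def)
  then show ?thesis
    by (rule bounded_locally_integrable[of g "\<lambda>x. 0" "Lp_norm \<infinity> g"])
       (use esssup_bound(2)[of g] assms(2) PInf in auto)
qed (use assms in auto)

text \<open>Uniform integrability without Hoelder's inequality: the part of \<open>|g|\<close> above a large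
  level \<open>M\<close> is at most \<open>M\<^sup>1\<^sup>-\<^sup>q |g|\<^sup>q\<close>.\<close>

lemma Lp_uniform_split:
  assumes "p > 1" "g \<in> Lp_space p" "\<epsilon> > 0"
  shows "\<exists>M>0. \<exists>h. integrable lebesgue h \<and> (\<forall>x. h x \<ge> 0) \<and> integral\<^sup>L lebesgue h < \<epsilon> \<and>
    (AE x in lebesgue. \<bar>g x\<bar> \<le> M + h x)"
proof (cases p)
  case (real q)
  then have q: "q > 1" using assms(1) by simp
  note g = Lp_spaceD_real[of g q, OF assms(2)[unfolded real]]
  define B where "B = (LINT x|lebesgue. \<bar>g x\<bar> powr q)"
  have "((\<lambda>M. M powr (1 - q) * B) \<longlongrightarrow> 0 * B) at_top"
    using q by (intro tendsto_mult tendsto_const tendsto_neg_powr filterlim_ident) auto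
  then have "\<forall>\<^sub>F M in at_top. M powr (1 - q) * B < \<epsilon>" using assms(3) by (intro order_tendstoD) auto
  then have "\<forall>\<^sub>F M in at_top. M powr (1 - q) * B < \<epsilon> \<and> M > 0"
    using eventually_gt_at_top by (rule eventually_conj)
  from eventually_happens[OF this] obtain M where M: "M powr (1 - q) * B < \<epsilon>" "M > 0"
    by auto
  show ?thesis
    by (intro exI[of _ M] exI[of _ "\<lambda>x. M powr (1 - q) * \<bar>g x\<bar> powr q"] conjI)
       (use M g abs_le_powr[OF M(2) q] in \<open>auto simp: B_def\<close>)
next
  case PInf
  then have "g \<in> Lp_space \<infinity>" using assms by simp
  note b = esssup_bound[OF this]
  have "AE x in lebesgue. \<bar>g x\<bar> \<le> (Lp_norm \<infinity> g + 1) + 0" using b(2) by eventually_elim simp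
  then show ?thesis
    using b(1) assms(3) by (intro exI[of _ "Lp_norm \<infinity> g + 1"] exI[of _ "\<lambda>x. 0"] conjI) auto
qed (use assms in auto)

text \<open>On disjoint intervals the part M of the splitting is paid for by their total length and
  the part h by its total mass, which is below \<epsilon>/2 wherever the intervals lie. Hence the
  choice \<delta> = \<epsilon>/(2M).\<close>

lemma abs_continuous_if_Lp_integral:
  assumes p: "p > 1" and g: "g \<in> Lp_space p"
    and F: "\<And>x y. x \<le> y \<Longrightarrow> F y - F x = integral {x..y} g"
  shows "abs_continuous F"
  unfolding abs_continuous_def
proof (intro allI impI)
  fix \<epsilon> :: real assume \<epsilon>: "\<epsilon> > 0"
  have int: "locally_integrable g" by (rule Lp_locally_integrable[OF p g])
  obtain M h where M: "M > 0" and h: "integrable lebesgue h" "\<And>x. h x \<ge> 0" "integral\<^sup>L lebesgue h < \<epsilon> / 2"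
    and gM: "AE x in lebesgue. \<bar>g x\<bar> \<le> M + h x"
    using Lp_uniform_split[OF p g, of "\<epsilon> / 2"] \<epsilon> by auto
  have hA: "set_integrable lebesgue A h" if "A \<in> sets lebesgue" for A
    unfolding set_integrable_def by (rule integrable_mult_indicator[OF that h(1)])
  show "\<exists>\<delta>>0. \<forall>D. finite D \<and> (\<forall>(a, b)\<in>D. a < b) \<and> disjoint_family_on (\<lambda>(a, b). {a<..<b}) D \<and>
      (\<Sum>(a, b)\<in>D. b - a) < \<delta> \<longrightarrow> (\<Sum>(a, b)\<in>D. \<bar>F b - F a\<bar>) < \<epsilon>"
  proof (intro exI[of _ "\<epsilon> / (2 * M)"] conjI allI impI)
    show "\<epsilon> / (2 * M) > 0" using \<epsilon> M by simp
    fix D :: "(real \<times> real) set"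
    assume D: "finite D \<and> (\<forall>(a, b)\<in>D. a < b) \<and> disjoint_family_on (\<lambda>(a, b). {a<..<b}) D \<and>
      (\<Sum>(a, b)\<in>D. b - a) < \<epsilon> / (2 * M)"
    have one: "\<bar>F b - F a\<bar> \<le> M * (b - a) + set_lebesgue_integral lebesgue {a<..<b} h" if "a < b" for a b
    proof -
      have "set_integrable lebesgue {a..b} (\<lambda>t. M)"
        by (rule locally_integrable_abs_on[OF continuous_imp_locally_integrable]) (intro continuous_intros)
      then have cM: "set_integrable lebesgue {a<..<b} (\<lambda>t. M)"
        by (rule set_integrable_subset) auto
      have "\<bar>F b - F a\<bar> \<le> integral {a..b} (\<lambda>t. \<bar>g t\<bar>)"
        using F[of a b] abs_integral_le[OF int, of a b] that by simp
      also have "\<dots> = integral {a<..<b} (\<lambda>t. \<bar>g t\<bar>)"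
        by (rule integral_spike_set) (auto intro: negligible_subset[of "{a, b}"])
      also have "\<dots> = set_lebesgue_integral lebesgue {a<..<b} (\<lambda>t. \<bar>g t\<bar>)"
        by (rule set_lebesgue_integral_eq_integral(2)[symmetric])
           (rule set_integrable_subset[OF set_integrable_abs[OF locally_integrable_abs_on[OF int, of a b]]], auto)
      also have "\<dots> \<le> set_lebesgue_integral lebesgue {a<..<b} (\<lambda>t. M + h t)"
      proof (rule set_integral_mono_AE)
        show "set_integrable lebesgue {a<..<b} (\<lambda>t. \<bar>g t\<bar>)"
          by (rule set_integrable_subset[OF set_integrable_abs[OF locally_integrable_abs_on[OF int, of a b]]]) auto
        show "set_integrable lebesgue {a<..<b} (\<lambda>t. M + h t)"
          by (intro set_integral_add(1) hA cM) simp
        show "AE t\<in>{a<..<b} in lebesgue. \<bar>g t\<bar> \<le> M + h t" using gM by eventually_elim simp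
      qed
      also have "\<dots> = set_lebesgue_integral lebesgue {a<..<b} (\<lambda>t. M) + set_lebesgue_integral lebesgue {a<..<b} h"
        by (intro set_integral_add(2) hA cM) simp
      also have "set_lebesgue_integral lebesgue {a<..<b} (\<lambda>t. M) = M * (b - a)"
        using that by (simp add: set_lebesgue_integral_def)
      finally show ?thesis .
    qed
    have "(\<Sum>(a, b)\<in>D. \<bar>F b - F a\<bar>) \<le> (\<Sum>z\<in>D. M * (snd z - fst z) + set_lebesgue_integral lebesgue {fst z<..<snd z} h)"
      using D one by (intro sum_mono) (auto split: prod.splits)
    also have "\<dots> = M * (\<Sum>(a, b)\<in>D. b - a) + (\<Sum>z\<in>D. set_lebesgue_integral lebesgue {fst z<..<snd z} h)"
      by (simp add: sum.distrib sum_distrib_left case_prod_beta)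
    finally have sum: "(\<Sum>(a, b)\<in>D. \<bar>F b - F a\<bar>) \<le>
        M * (\<Sum>(a, b)\<in>D. b - a) + (\<Sum>z\<in>D. set_lebesgue_integral lebesgue {fst z<..<snd z} h)" .
    have U: "(\<Union>z\<in>D. {fst z<..<snd z}) \<in> sets lebesgue" using D by (intro sets.finite_UN) auto
    have "(\<Sum>z\<in>D. set_lebesgue_integral lebesgue {fst z<..<snd z} h) =
        set_lebesgue_integral lebesgue (\<Union>z\<in>D. {fst z<..<snd z}) h"
      by (rule set_integral_finite_Union[symmetric]) (use D hA in \<open>auto simp: case_prod_beta disjoint_family_on_def\<close>)
    also have "\<dots> \<le> integral\<^sup>L lebesgue h"
      unfolding set_lebesgue_integral_def
      by (rule integral_mono[OF hA[OF U, unfolded set_integrable_def] h(1)]) (use h(2) in \<open>auto simp: indicator_def\<close>)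
    finally have "(\<Sum>z\<in>D. set_lebesgue_integral lebesgue {fst z<..<snd z} h) < \<epsilon> / 2" using h(3) by simp
    moreover have "M * (\<Sum>(a, b)\<in>D. b - a) \<le> M * (\<epsilon> / (2 * M))"
      using D M by (intro mult_left_mono) auto
    moreover have "M * (\<epsilon> / (2 * M)) = \<epsilon> / 2" using M by simp
    ultimately show "(\<Sum>(a, b)\<in>D. \<bar>F b - F a\<bar>) < \<epsilon>" using sum by linarith
  qed
qed

lemma chain_imp_sobolev:
  assumes m: "m \<ge> 1" and chain: "antideriv_chain m \<Phi>" and p: "p > 1" and g: "\<Phi> m \<in> Lp_space p"
  shows "\<Phi> 0 \<in> sobolev m p"
proof -
  have eq: "(deriv ^^ k) (\<Phi> 0) = \<Phi> k" if "k < m" for k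
    using that
  proof (induction k)
    case (Suc k)
    then show ?case using DERIV_imp_deriv[OF chain_deriv[OF chain, of k]] by auto
  qed simp
  show ?thesis
    unfolding sobolev_def
  proof (intro CollectI conjI allI impI)
    fix k x assume "k < m - 1"
    then have "Suc k < m" by simp
    then show "(deriv ^^ k) (\<Phi> 0) field_differentiable at x"
      unfolding field_differentiable_def using chain_deriv[OF chain, of k x] eq[of k] by auto
  next
    have "\<Phi> (m - 1) y - \<Phi> (m - 1) x = integral {x..y} (\<Phi> m)" if "x \<le> y" for x y
      using chain_integral[OF chain _ that, of "m - 1"] m by simp
    then show "abs_continuous ((deriv ^^ (m - 1)) (\<Phi> 0))"
      using eq[of "m - 1"] m abs_continuous_if_Lp_integral[OF p g] by simp
    show "\<exists>g\<in>Lp_space p. is_weak_deriv m (\<Phi> 0) g" using chain_imp_weak_deriv[OF chain] g by blast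
  qed
qed

section \<open>Overlap of the hulls and summation over the gaps\<close>

lemma borel_measurable_nn_integral_count_space:
  fixes f :: "'i \<Rightarrow> 'a \<Rightarrow> ennreal"
  assumes "countable I" and [measurable]: "\<And>i. i \<in> I \<Longrightarrow> f i \<in> borel_measurable M"
  shows "(\<lambda>x. \<integral>\<^sup>+i. f i x \<partial>count_space I) \<in> borel_measurable M"
proof (cases "finite I")
  case True
  then show ?thesis by (simp add: nn_integral_count_space_finite)
next
  case False
  then have "I \<noteq> {}" by auto
  have "(\<integral>\<^sup>+i. f i x \<partial>count_space I) = (\<Sum>n. f (from_nat_into I n) x)" for x
    by (simp add: nn_integral_bij_count_space[symmetric, OF bij_betw_from_nat_into[OF assms(1) False]]
        nn_integral_count_space_nat)
  moreover have "f (from_nat_into I n) \<in> borel_measurable M" for n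
    using from_nat_into[OF \<open>I \<noteq> {}\<close>] by simp
  ultimately show ?thesis by simp
qed

text \<open>\<open>2 * real m + 1\<close> bounds the ratio of hull to gap,
  \<open>4 * real m + 2\<close> is the overlap number 4m + 1 plus one for the part on E. The maximum
  with 1 makes every factor at least 1, so that exponents up to q can be raised to q; the q-th root
  then leaves a constant free of p.\<close>

definition norm_const :: "nat \<Rightarrow> real" where
  "norm_const m = max (gap_const m) 1 * (2 * real m + 1) * (4 * real m + 2)"

lemma norm_const_ge_1: "norm_const m \<ge> 1"
proof -
  have "1 * 1 * 1 \<le> max (gap_const m) 1 * (2 * real m + 1) * (4 * real m + 2)"
    by (intro mult_mono) auto
  then show ?thesis by (simp add: norm_const_def)
qed

context extension_setting begin

lemma ext_chain_gap: "gap u v \<Longrightarrow> u < x \<Longrightarrow> x < v \<Longrightarrow> ext_chain m x = poly_deriv m (hermite m P u v) x"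
  using piece_gap[of u v x] by (auto simp: ext_chain_def gap_def)

text \<open>A point off E in no bounded gap lies in an unbounded component, where the extension is a
  single jet of degree below m.\<close>

lemma ext_chain_unbounded:
  assumes "x \<notin> E" "\<And>u v. gap u v \<Longrightarrow> u < x \<Longrightarrow> x < v \<Longrightarrow> False"
  shows "ext_chain m x = 0"
  using assms(1)
proof (cases rule: outside_cases)
  case (gap u v)
  then show ?thesis using assms(2) by blast
next
  case (below v)
  then show ?thesis
    using piece_below[OF below] poly_deriv_eq_0[OF jet_degree[OF below(1)]] assms(1) by (simp add: ext_chain_def)
next
  case (above u)
  then show ?thesis
    using piece_above[OF above] poly_deriv_eq_0[OF jet_degree[OF above(1)]] assms(1) by (simp add: ext_chain_def)
qed

lemma gap_right_unique: "gap u v \<Longrightarrow> gap u w \<Longrightarrow> v = w"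
  unfolding gap_def by (metis disjoint_iff greaterThanLessThan_iff linorder_neqE_linordered_idom)

lemma gap_left_unique: "gap u w \<Longrightarrow> gap v w \<Longrightarrow> u = v"
  unfolding gap_def by (metis disjoint_iff greaterThanLessThan_iff linorder_neqE_linordered_idom)

lemma countable_gaps: "countable {z. gap (fst z) (snd z)}"
proof -
  let ?I = "\<lambda>z :: real \<times> real. {fst z<..<snd z}"
  let ?G = "{z. gap (fst z) (snd z)}"
  have "?I ` ?G \<subseteq> {{\<alpha><..<\<beta>} | \<alpha> \<beta>. \<alpha> \<in> E \<and> \<beta> \<in> E \<and> \<alpha> < \<beta> \<and> {\<alpha><..<\<beta>} \<inter> E = {}}"
    unfolding gap_def by blast
  then have "countable (?I ` ?G)" using gaps_countable(1) countable_subset by blast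
  moreover have "inj_on ?I ?G"
  proof (rule inj_onI)
    fix y z assume yz: "y \<in> ?G" "z \<in> ?G" "?I y = ?I z"
    then have "fst y < snd y" "fst z < snd z" by (auto simp: gap_def)
    then have "fst y = Inf (?I y)" "snd y = Sup (?I y)" "fst z = Inf (?I z)" "snd z = Sup (?I z)" by simp_all
    then show "y = z" using yz(3) by (metis prod_eqI)
  qed
  ultimately show ?thesis by (rule countable_image_inj_on)
qed

text \<open>If several gaps lie to the right of \<open>y\<close> while their hulls contain \<open>y\<close>, then the hull of
  the rightmost one contains the left endpoints of all of them.\<close>

lemma hull_overlap:
  assumes t: "\<And>u v. gap u v \<Longrightarrow> t1 u v \<le> u \<and> v \<le> t2 u v \<and>
    finite (E \<inter> {t1 u v..t2 u v}) \<and> card (E \<inter> {t1 u v..t2 u v}) \<le> 2 * m"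
  shows "finite {z. gap (fst z) (snd z) \<and> y \<in> {t1 (fst z) (snd z)..t2 (fst z) (snd z)}} \<and>
    card {z. gap (fst z) (snd z) \<and> y \<in> {t1 (fst z) (snd z)..t2 (fst z) (snd z)}} \<le> 4 * m + 1"
proof -
  define A where "A = {z. gap (fst z) (snd z) \<and> y \<in> {t1 (fst z) (snd z)..t2 (fst z) (snd z)}}"
  \<comment> \<open>The family is not known to be finite; a bound for its finite subfamilies, in
    which a rightmost gap exists, gives both finiteness and the count.\<close>
  have R: "finite {z \<in> A. y \<le> fst z} \<and> card {z \<in> A. y \<le> fst z} \<le> 2 * m"
  proof (rule finite_if_finite_subsets_card_bdd)
    fix G assume G: "G \<subseteq> {z \<in> A. y \<le> fst z}" "finite G"
    show "card G \<le> 2 * m"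
    proof (cases "G = {}")
      case False
      have "Max (fst ` G) \<in> fst ` G" using G False by simp
      then obtain z where z: "z \<in> G" "fst z = Max (fst ` G)" by auto
      have g: "gap (fst w) (snd w)" "y \<le> fst w" if "w \<in> G" for w using G that by (auto simp: A_def)
      let ?T = "E \<inter> {t1 (fst z) (snd z)..t2 (fst z) (snd z)}"
      have "fst ` G \<subseteq> ?T"
      proof (rule image_subsetI)
        fix w assume w: "w \<in> G"
        have "fst w \<le> fst z" using z(2) w G(2) by simp
        moreover have "t1 (fst z) (snd z) \<le> y" using z(1) G by (auto simp: A_def)
        ultimately show "fst w \<in> ?T"
          using g[OF w] g[OF z(1)] t[OF g(1)[OF z(1)]] by (auto simp: gap_def)
      qed
      then have "card (fst ` G) \<le> card ?T" using t[OF g(1)[OF z(1)]] by (intro card_mono) auto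
      moreover have "inj_on fst G"
        by (rule inj_onI) (metis g(1) gap_right_unique prod_eqI)
      ultimately show ?thesis using t[OF g(1)[OF z(1)]] by (simp add: card_image)
    qed simp
  qed
  have L: "finite {z \<in> A. snd z \<le> y} \<and> card {z \<in> A. snd z \<le> y} \<le> 2 * m"
  proof (rule finite_if_finite_subsets_card_bdd)
    fix G assume G: "G \<subseteq> {z \<in> A. snd z \<le> y}" "finite G"
    show "card G \<le> 2 * m"
    proof (cases "G = {}")
      case False
      have "Min (snd ` G) \<in> snd ` G" using G False by simp
      then obtain z where z: "z \<in> G" "snd z = Min (snd ` G)" by auto
      have g: "gap (fst w) (snd w)" "snd w \<le> y" if "w \<in> G" for w using G that by (auto simp: A_def)
      let ?T = "E \<inter> {t1 (fst z) (snd z)..t2 (fst z) (snd z)}"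
      have "snd ` G \<subseteq> ?T"
      proof (rule image_subsetI)
        fix w assume w: "w \<in> G"
        have "snd z \<le> snd w" using z(2) w G(2) by simp
        moreover have "y \<le> t2 (fst z) (snd z)" using z(1) G by (auto simp: A_def)
        ultimately show "snd w \<in> ?T"
          using g[OF w] g[OF z(1)] t[OF g(1)[OF z(1)]] by (auto simp: gap_def)
      qed
      then have "card (snd ` G) \<le> card ?T" using t[OF g(1)[OF z(1)]] by (intro card_mono) auto
      moreover have "inj_on snd G"
        by (rule inj_onI) (metis g(1) gap_left_unique prod_eqI)
      ultimately show ?thesis using t[OF g(1)[OF z(1)]] by (simp add: card_image)
    qed simp
  qed
  have M: "finite {z \<in> A. fst z < y \<and> y < snd z} \<and> card {z \<in> A. fst z < y \<and> y < snd z} \<le> 1"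
  proof -
    have "z = w" if "z \<in> A" "w \<in> A" "fst z < y" "y < snd z" "fst w < y" "y < snd w" for z w
    proof -
      have g: "gap (fst z) (snd z)" "gap (fst w) (snd w)" using that by (auto simp: A_def)
      have "fst z = fst w"
        using g that by (smt (verit) disjoint_iff gap_def greaterThanLessThan_iff)
      then show ?thesis using g gap_right_unique by (metis prod_eqI)
    qed
    then have "\<exists>z. {z \<in> A. fst z < y \<and> y < snd z} \<subseteq> {z}" by blast
    then obtain z where "{z \<in> A. fst z < y \<and> y < snd z} \<subseteq> {z}" ..
    then show ?thesis using card_mono[of "{z}"] finite_subset[of _ "{z}"] by fastforce
  qed
  \<comment> \<open>Gaps to the right of y, gaps to the left, and at most one around y: 2m + 2m +
    1.\<close>
  have eq: "A = ({z \<in> A. y \<le> fst z} \<union> {z \<in> A. snd z \<le> y}) \<union> {z \<in> A. fst z < y \<and> y < snd z}" by auto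
  have "finite A" using R L M by (subst eq) auto
  moreover have "card A \<le> (card {z \<in> A. y \<le> fst z} + card {z \<in> A. snd z \<le> y}) + card {z \<in> A. fst z < y \<and> y < snd z}"
    by (subst eq) (meson add_mono_thms_linordered_semiring(3) card_Un_le order_trans)
  ultimately show ?thesis using R L M unfolding A_def[symmetric] by linarith
qed

lemma hulls_exist:
  obtains t1 t2 :: "real \<Rightarrow> real \<Rightarrow> real" where
    "\<And>u v. gap u v \<Longrightarrow> t1 u v \<le> u \<and> v \<le> t2 u v \<and>
      finite (E \<inter> {t1 u v..t2 u v}) \<and> card (E \<inter> {t1 u v..t2 u v}) \<le> 2 * m"
    "\<And>u v. gap u v \<Longrightarrow> t2 u v - t1 u v \<le> (2 * real m + 1) * (v - u)"
    "\<And>u v x. gap u v \<Longrightarrow> x \<in> {u<..<v} \<Longrightarrow>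
      \<bar>ext_chain m x\<bar> \<le> gap_const m / (v - u) * integral {t1 u v..t2 u v} (\<lambda>t. \<bar>\<Phi> m t\<bar>)"
proof -
  have "\<forall>u v. \<exists>t1 t2. gap u v \<longrightarrow> t1 \<le> u \<and> v \<le> t2 \<and> t2 - t1 \<le> (2 * real m + 1) * (v - u) \<and>
    finite (E \<inter> {t1..t2}) \<and> card (E \<inter> {t1..t2}) \<le> 2 * m \<and>
    (\<forall>x\<in>{u..v}. \<bar>poly_deriv m (hermite m P u v) x\<bar> \<le>
       gap_const m / (v - u) * integral {t1..t2} (\<lambda>t. \<bar>\<Phi> m t\<bar>))"
    using gap_estimate by meson
  then obtain t1 t2 where t: "\<And>u v. gap u v \<Longrightarrow> t1 u v \<le> u \<and> v \<le> t2 u v \<and>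
    t2 u v - t1 u v \<le> (2 * real m + 1) * (v - u) \<and>
    finite (E \<inter> {t1 u v..t2 u v}) \<and> card (E \<inter> {t1 u v..t2 u v}) \<le> 2 * m \<and>
    (\<forall>x\<in>{u..v}. \<bar>poly_deriv m (hermite m P u v) x\<bar> \<le>
       gap_const m / (v - u) * integral {t1 u v..t2 u v} (\<lambda>t. \<bar>\<Phi> m t\<bar>))"
    by metis
  show ?thesis
    by (rule that[of t1 t2]) (use t ext_chain_gap in auto)
qed

lemma gap_const_pos: "gap_const m > 0"
  unfolding gap_const_def using hermite_const(1)[OF m] by simp

text \<open>On a gap (u, v) the integral over the hull is at most the norm of
  \<open>\<Phi> m\<close> times (2m + 1)(v - u), and the length of the gap cancels.\<close>

lemma ext_chain_Lp_infinity:
  assumes g: "\<Phi> m \<in> Lp_space \<infinity>"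
  shows "ext_chain m \<in> Lp_space \<infinity> \<and> Lp_norm \<infinity> (ext_chain m) \<le> norm_const m * Lp_norm \<infinity> (\<Phi> m)"
proof -
  define M where "M = Lp_norm \<infinity> (\<Phi> m)"
  have M: "M \<ge> 0" "AE x in lebesgue. \<bar>\<Phi> m x\<bar> \<le> M" using esssup_bound[OF g] by (auto simp: M_def)
  have int: "locally_integrable (\<Phi> m)" using chain by (simp add: chain_integrable)
  have meas: "\<Phi> m \<in> borel_measurable lebesgue" using g by (simp add: Lp_space_def)
  have IM: "integral {c..d} (\<lambda>t. \<bar>\<Phi> m t\<bar>) \<le> M * (d - c)" if "c \<le> d" for c d
  proof -
    have "integral {c..d} (\<lambda>t. \<bar>\<Phi> m t\<bar>) = set_lebesgue_integral lebesgue {c..d} (\<lambda>t. \<bar>\<Phi> m t\<bar>)"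
      by (rule set_lebesgue_integral_eq_integral(2)[symmetric, OF set_integrable_abs[OF locally_integrable_abs_on[OF int]]])
    also have "\<dots> \<le> set_lebesgue_integral lebesgue {c..d} (\<lambda>t. M)"
    proof (rule set_integral_mono_AE)
      show "set_integrable lebesgue {c..d} (\<lambda>t. \<bar>\<Phi> m t\<bar>)"
        by (rule set_integrable_abs[OF locally_integrable_abs_on[OF int]])
      show "set_integrable lebesgue {c..d} (\<lambda>t. M)"
        by (rule locally_integrable_abs_on[OF continuous_imp_locally_integrable]) (intro continuous_intros)
      show "AE t\<in>{c..d} in lebesgue. \<bar>\<Phi> m t\<bar> \<le> M" using M(2) by eventually_elim simp
    qed
    also have "\<dots> = M * (d - c)" using that by (simp add: set_lebesgue_integral_def)
    finally show ?thesis .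
  qed
  obtain t1 t2 where t: "\<And>u v. gap u v \<Longrightarrow> t1 u v \<le> u \<and> v \<le> t2 u v \<and>
      finite (E \<inter> {t1 u v..t2 u v}) \<and> card (E \<inter> {t1 u v..t2 u v}) \<le> 2 * m"
    "\<And>u v. gap u v \<Longrightarrow> t2 u v - t1 u v \<le> (2 * real m + 1) * (v - u)"
    "\<And>u v x. gap u v \<Longrightarrow> x \<in> {u<..<v} \<Longrightarrow>
      \<bar>ext_chain m x\<bar> \<le> gap_const m / (v - u) * integral {t1 u v..t2 u v} (\<lambda>t. \<bar>\<Phi> m t\<bar>)"
    using hulls_exist by blast
  have KM: "gap_const m * (2 * real m + 1) * M \<le> norm_const m * M" "M \<le> norm_const m * M"
  proof -
    have "gap_const m * (2 * real m + 1) * 1 \<le> max (gap_const m) 1 * (2 * real m + 1) * (4 * real m + 2)"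
      using gap_const_pos by (intro mult_mono) auto
    then show "gap_const m * (2 * real m + 1) * M \<le> norm_const m * M"
      using M(1) by (intro mult_right_mono) (auto simp: norm_const_def)
    have "1 * M \<le> norm_const m * M" by (rule mult_right_mono[OF norm_const_ge_1 M(1)])
    then show "M \<le> norm_const m * M" by simp
  qed
  have gapbd: "\<bar>ext_chain m x\<bar> \<le> norm_const m * M" if uv: "gap u v" "x \<in> {u<..<v}" for u v x
  proof -
    have pos: "v - u > 0" using uv by auto
    have "\<bar>ext_chain m x\<bar> \<le> gap_const m / (v - u) * (M * ((2 * real m + 1) * (v - u)))"
    proof (rule order_trans[OF t(3)[OF uv]], rule mult_left_mono)
      have "integral {t1 u v..t2 u v} (\<lambda>t. \<bar>\<Phi> m t\<bar>) \<le> M * (t2 u v - t1 u v)"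
        using t(1)[OF uv(1)] pos by (intro IM) auto
      also have "\<dots> \<le> M * ((2 * real m + 1) * (v - u))"
        by (rule mult_left_mono[OF t(2)[OF uv(1)] M(1)])
      finally show "integral {t1 u v..t2 u v} (\<lambda>t. \<bar>\<Phi> m t\<bar>) \<le> M * ((2 * real m + 1) * (v - u))" .
    qed (use pos gap_const_pos in auto)
    also have "\<dots> = gap_const m * (2 * real m + 1) * M" using pos by (simp add: field_simps)
    finally show ?thesis using KM by simp
  qed
  have "AE x in lebesgue. \<bar>ext_chain m x\<bar> \<le> norm_const m * M"
    using M(2)
  proof eventually_elim
    case (elim x)
    show ?case
    proof (cases "x \<in> E")
      case True
      then show ?thesis using elim KM by (simp add: ext_chain_def)
    next
      case xE: False
      show ?thesis
      proof (cases "\<exists>u v. gap u v \<and> u < x \<and> x < v")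
        case True
        then show ?thesis using gapbd by auto
      next
        case False
        then have "ext_chain m x = 0" using ext_chain_unbounded[OF xE] by blast
        then show ?thesis using M KM by simp
      qed
    qed
  qed
  then show ?thesis
    unfolding M_def[symmetric] using M KM ext_chain_measurable[OF meas]
    by (intro Lp_infinityI) auto
qed

lemma ext_chain_Lp_real:
  assumes q: "q > 1" and g: "\<Phi> m \<in> Lp_space (ereal q)"
  shows "ext_chain m \<in> Lp_space (ereal q) \<and>
    Lp_norm (ereal q) (ext_chain m) \<le> norm_const m * Lp_norm (ereal q) (\<Phi> m)"
proof -
  note gD = Lp_spaceD_real[OF g]
  have int: "locally_integrable (\<Phi> m)" using chain by (simp add: chain_integrable)
  have meas: "ext_chain m \<in> borel_measurable lebesgue" by (rule ext_chain_measurable[OF gD(1)])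
  define w where "w x = \<bar>\<Phi> m x\<bar> powr q" for x
  have w0: "w x \<ge> 0" for x by (simp add: w_def)
  have wint: "integrable lebesgue w" using gD(2) by (simp add: w_def[abs_def])
  have wm: "w \<in> borel_measurable lebesgue" using wint by simp
  define N where "N = (LINT x|lebesgue. w x)"
  have N0: "N \<ge> 0" unfolding N_def by (rule Bochner_Integration.integral_nonneg) (rule w0)
  have nnN: "(\<integral>\<^sup>+x. ennreal (w x) \<partial>lebesgue) = ennreal N"
    unfolding N_def by (rule nn_integral_eq_integral[OF wint]) (simp add: w0)
  obtain t1 t2 where t: "\<And>u v. gap u v \<Longrightarrow> t1 u v \<le> u \<and> v \<le> t2 u v \<and>
      finite (E \<inter> {t1 u v..t2 u v}) \<and> card (E \<inter> {t1 u v..t2 u v}) \<le> 2 * m"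
    "\<And>u v. gap u v \<Longrightarrow> t2 u v - t1 u v \<le> (2 * real m + 1) * (v - u)"
    "\<And>u v x. gap u v \<Longrightarrow> x \<in> {u<..<v} \<Longrightarrow>
      \<bar>ext_chain m x\<bar> \<le> gap_const m / (v - u) * integral {t1 u v..t2 u v} (\<lambda>t. \<bar>\<Phi> m t\<bar>)"
    using hulls_exist by blast
  define L where "L = 2 * real m + 1"
  have L: "L \<ge> 1" by (simp add: L_def)
  \<comment> \<open>Constant of the pointwise estimate on a gap: the power q of
    \<open>gap_const m\<close>, and \<open>L powr (q - 1)\<close> from Jensen's inequality on a hull
    of length at most L times the gap.\<close>
  define D where "D = gap_const m powr q * L powr (q - 1)"
  have D0: "D \<ge> 0" by (simp add: D_def)
  let ?G = "{z. gap (fst z) (snd z)}"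
  let ?T = "\<lambda>z. {t1 (fst z) (snd z)..t2 (fst z) (snd z)}"
  let ?I = "\<lambda>z :: real \<times> real. {fst z<..<snd z}"
  define W where "W z = integral (?T z) w" for z
  have wT: "set_integrable lebesgue A w" if "A \<in> sets lebesgue" for A
    unfolding set_integrable_def by (rule integrable_mult_indicator[OF that wint])
  have W0: "W z \<ge> 0" for z
    unfolding W_def by (rule integral_nonneg[OF set_lebesgue_integral_eq_integral(1)[OF wT]]) (auto simp: w0)
  have nnW: "ennreal (W z) = (\<integral>\<^sup>+x. ennreal (w x) * indicator (?T z) x \<partial>lebesgue)" for z
  proof -
    have "W z = set_lebesgue_integral lebesgue (?T z) w"
      unfolding W_def by (rule set_lebesgue_integral_eq_integral(2)[symmetric, OF wT]) simp
    also have "\<dots> = (LINT x|lebesgue. indicator (?T z) x * w x)" by (simp add: set_lebesgue_integral_def)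
    also have "ennreal \<dots> = (\<integral>\<^sup>+x. ennreal (indicator (?T z) x * w x) \<partial>lebesgue)"
      by (rule nn_integral_eq_integral[symmetric])
         (use wT[of "?T z"] w0 in \<open>auto simp: set_integrable_def\<close>)
    also have "\<dots> = (\<integral>\<^sup>+x. ennreal (w x) * indicator (?T z) x \<partial>lebesgue)"
      by (rule nn_integral_cong) (auto simp: indicator_def)
    finally show ?thesis .
  qed
  have gapbd: "\<bar>ext_chain m x\<bar> powr q \<le> D / (v - u) * W (u, v)" if uv: "gap u v" "x \<in> {u<..<v}" for u v x
  proof -
    have pos: "v - u > 0" using uv by auto
    have tt: "t1 u v < t2 u v" using t(1)[OF uv(1)] pos by linarith
    define J where "J = integral {t1 u v..t2 u v} (\<lambda>t. \<bar>\<Phi> m t\<bar>)"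
    have J0: "J \<ge> 0" unfolding J_def
      by (rule integral_nonneg[OF locally_integrable_abs_integrable_on[OF int]]) simp
    have "\<bar>ext_chain m x\<bar> powr q \<le> (gap_const m / (v - u) * J) powr q"
      using t(3)[OF uv] q by (intro powr_mono2) (auto simp: J_def)
    also have "\<dots> = (gap_const m / (v - u)) powr q * J powr q" by (rule powr_mult)
    also have "\<dots> \<le> (gap_const m / (v - u)) powr q * ((L * (v - u)) powr (q - 1) * W (u, v))"
    proof (rule mult_left_mono)
      have "J powr q \<le> (t2 u v - t1 u v) powr (q - 1) * W (u, v)"
        unfolding J_def W_def w_def fst_conv snd_conv by (rule integral_powr_le[OF q tt int gD(2)])
      also have "\<dots> \<le> (L * (v - u)) powr (q - 1) * W (u, v)"
        using t(2)[OF uv(1)] tt q W0 by (intro mult_right_mono powr_mono2) (auto simp: L_def)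
      finally show "J powr q \<le> (L * (v - u)) powr (q - 1) * W (u, v)" .
    qed simp
    also have "\<dots> = D / (v - u) * W (u, v)"
    proof -
      \<comment> \<open>The exponent -q from the gap estimate and q-1 from Jensen leave exactly one
        inverse power of v - u, which integration over the gap removes.\<close>
      have "(gap_const m / (v - u)) powr q * (L * (v - u)) powr (q - 1) = D / (v - u)"
      proof -
        have "(v - u) powr (q - 1) = (v - u) powr q / (v - u)" using pos by (simp add: powr_diff)
        moreover have "(v - u) powr q \<noteq> 0" using pos by simp
        ultimately show ?thesis unfolding D_def powr_divide powr_mult by simp
      qed
      then show ?thesis by (simp add: mult.assoc[symmetric])
    qed
    finally show ?thesis .
  qed
  \<comment> \<open>The sum over gaps is an integral over a counting measure, so that Tonelli's
    theorem applies; at any x at most one of its terms is nonzero.\<close>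
  have pointwise: "ennreal (\<bar>ext_chain m x\<bar> powr q) \<le>
      ennreal (w x) + (\<integral>\<^sup>+z. ennreal (D / (snd z - fst z) * W z) * indicator (?I z) x \<partial>count_space ?G)" for x
  proof (cases "x \<in> E")
    case True
    then show ?thesis by (simp add: ext_chain_def w_def)
  next
    case False
    show ?thesis
    proof (cases "\<exists>u v. gap u v \<and> u < x \<and> x < v")
      case True
      then obtain u v where uv: "gap u v" "x \<in> {u<..<v}" by auto
      have "ennreal (\<bar>ext_chain m x\<bar> powr q) \<le> ennreal (D / (snd (u, v) - fst (u, v)) * W (u, v)) * indicator (?I (u, v)) x"
        using gapbd[OF uv] uv(2) by (simp add: ennreal_leI)
      also have "\<dots> \<le> (\<integral>\<^sup>+z. ennreal (D / (snd z - fst z) * W z) * indicator (?I z) x \<partial>count_space ?G)"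
        by (rule nn_integral_ge_point) (use uv in auto)
      finally show ?thesis by (simp add: add_increasing)
    next
      case none: False
      then have "ext_chain m x = 0" using ext_chain_unbounded[OF False] by blast
      then show ?thesis by simp
    qed
  qed
  have mI: "(\<lambda>x. c * indicator (?I z) x) \<in> borel_measurable lebesgue" for c :: ennreal and z
    by (intro borel_measurable_times_ennreal borel_measurable_const borel_measurable_indicator) simp
  have mT: "(\<lambda>x. ennreal (w x) * indicator (?T z) x) \<in> borel_measurable lebesgue" for z
    using wm by (intro borel_measurable_times_ennreal borel_measurable_indicator) auto
  have mS: "(\<lambda>x. \<integral>\<^sup>+z. ennreal (D / (snd z - fst z) * W z) * indicator (?I z) x \<partial>count_space ?G) \<in> borel_measurable lebesgue"
    using countable_gaps mI by (intro borel_measurable_nn_integral_count_space) auto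
  have sumW: "(\<integral>\<^sup>+z. ennreal (W z) \<partial>count_space ?G) \<le> ennreal ((4 * real m + 1) * N)"
  proof -
    have "(\<integral>\<^sup>+z. ennreal (W z) \<partial>count_space ?G) =
        (\<integral>\<^sup>+z. (\<integral>\<^sup>+x. ennreal (w x) * indicator (?T z) x \<partial>lebesgue) \<partial>count_space ?G)"
      unfolding nnW ..
    \<comment> \<open>After the exchange the inner sum counts the hulls that contain x.\<close>
    also have "\<dots> = (\<integral>\<^sup>+x. (\<integral>\<^sup>+z. ennreal (w x) * indicator (?T z) x \<partial>count_space ?G) \<partial>lebesgue)"
      by (rule nn_integral_count_space_nn_integral[symmetric, OF countable_gaps mT])
    also have "\<dots> \<le> (\<integral>\<^sup>+x. ennreal (w x) * ennreal (4 * real m + 1) \<partial>lebesgue)"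
    proof (rule nn_integral_mono)
      fix x
      let ?A = "{z. gap (fst z) (snd z) \<and> x \<in> ?T z}"
      have A: "finite ?A" "card ?A \<le> 4 * m + 1" using hull_overlap[of t1 t2 x, OF t(1)] by auto
      have "(\<integral>\<^sup>+z. ennreal (w x) * indicator (?T z) x \<partial>count_space ?G) =
          ennreal (w x) * (\<integral>\<^sup>+z. indicator (?T z) x \<partial>count_space ?G)"
        by (rule nn_integral_cmult) simp
      also have "(\<integral>\<^sup>+z. indicator (?T z) x \<partial>count_space ?G) = (\<integral>\<^sup>+z. indicator ?A z \<partial>count_space ?G)"
        by (rule nn_integral_cong) (auto simp: indicator_def)
      also have "\<dots> = emeasure (count_space ?G) ?A" by (rule nn_integral_indicator) auto
      also have "\<dots> = of_nat (card ?A)" using A(1) by (intro emeasure_count_space_finite) auto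
      also have "\<dots> = ennreal (real (card ?A))" by (simp add: ennreal_of_nat_eq_real_of_nat)
      also have "\<dots> \<le> ennreal (4 * real m + 1)" using A(2) by (intro ennreal_leI) linarith
      finally show "(\<integral>\<^sup>+z. ennreal (w x) * indicator (?T z) x \<partial>count_space ?G) \<le> ennreal (w x) * ennreal (4 * real m + 1)"
        by (simp add: mult_left_mono)
    qed
    also have "\<dots> = ennreal N * ennreal (4 * real m + 1)"
      unfolding nnN[symmetric] using wm by (intro nn_integral_multc) auto
    also have "\<dots> = ennreal (N * (4 * real m + 1))" using N0 by (intro ennreal_mult[symmetric]) auto
    also have "N * (4 * real m + 1) = (4 * real m + 1) * N" by (rule mult.commute)
    finally show ?thesis .
  qed
  have "(\<integral>\<^sup>+x. ennreal (\<bar>ext_chain m x\<bar> powr q) \<partial>lebesgue) \<le>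
      (\<integral>\<^sup>+x. ennreal (w x) + (\<integral>\<^sup>+z. ennreal (D / (snd z - fst z) * W z) * indicator (?I z) x \<partial>count_space ?G) \<partial>lebesgue)"
    by (intro nn_integral_mono pointwise)
  also have "\<dots> = ennreal N + (\<integral>\<^sup>+x. (\<integral>\<^sup>+z. ennreal (D / (snd z - fst z) * W z) * indicator (?I z) x \<partial>count_space ?G) \<partial>lebesgue)"
    unfolding nnN[symmetric] using wm mS by (intro nn_integral_add) auto
  also have "(\<integral>\<^sup>+x. (\<integral>\<^sup>+z. ennreal (D / (snd z - fst z) * W z) * indicator (?I z) x \<partial>count_space ?G) \<partial>lebesgue) =
      (\<integral>\<^sup>+z. (\<integral>\<^sup>+x. ennreal (D / (snd z - fst z) * W z) * indicator (?I z) x \<partial>lebesgue) \<partial>count_space ?G)"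
    by (rule nn_integral_count_space_nn_integral[OF countable_gaps mI])
  also have "\<dots> = (\<integral>\<^sup>+z. ennreal D * ennreal (W z) \<partial>count_space ?G)"
  proof (rule nn_integral_cong)
    fix z assume "z \<in> space (count_space ?G)"
    then have z: "fst z < snd z" by (auto simp: gap_def)
    have "(\<integral>\<^sup>+x. ennreal (D / (snd z - fst z) * W z) * indicator (?I z) x \<partial>lebesgue) =
        ennreal (D / (snd z - fst z) * W z) * emeasure lebesgue (?I z)"
      by (rule nn_integral_cmult_indicator) simp
    also have "\<dots> = ennreal (D / (snd z - fst z) * W z) * ennreal (snd z - fst z)" using z by simp
    also have "\<dots> = ennreal (D / (snd z - fst z) * W z * (snd z - fst z))"
      using z D0 W0[of z] by (intro ennreal_mult[symmetric] mult_nonneg_nonneg divide_nonneg_pos) auto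
    also have "D / (snd z - fst z) * W z * (snd z - fst z) = D * W z" using z by simp
    also have "ennreal (D * W z) = ennreal D * ennreal (W z)" using D0 W0 by (intro ennreal_mult) auto
    finally show "(\<integral>\<^sup>+x. ennreal (D / (snd z - fst z) * W z) * indicator (?I z) x \<partial>lebesgue) = ennreal D * ennreal (W z)" .
  qed
  also have "\<dots> = ennreal D * (\<integral>\<^sup>+z. ennreal (W z) \<partial>count_space ?G)"
    by (rule nn_integral_cmult) simp
  also have "ennreal N + \<dots> \<le> ennreal N + ennreal D * ennreal ((4 * real m + 1) * N)"
    by (intro add_left_mono mult_left_mono sumW) simp
  also have "\<dots> = ennreal (N + D * ((4 * real m + 1) * N))"
  proof -
    have "ennreal D * ennreal ((4 * real m + 1) * N) = ennreal (D * ((4 * real m + 1) * N))"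
      using N0 D0 by (intro ennreal_mult[symmetric]) auto
    moreover have "ennreal N + ennreal (D * ((4 * real m + 1) * N)) = ennreal (N + D * ((4 * real m + 1) * N))"
      using N0 D0 by (intro ennreal_plus[symmetric]) auto
    ultimately show ?thesis by simp
  qed
  finally have bound: "(\<integral>\<^sup>+x. ennreal (\<bar>ext_chain m x\<bar> powr q) \<partial>lebesgue) \<le> ennreal (N + D * ((4 * real m + 1) * N))" .
  have me: "(\<lambda>x. \<bar>ext_chain m x\<bar> powr q) \<in> borel_measurable lebesgue" using meas by simp
  have eint: "integrable lebesgue (\<lambda>x. \<bar>ext_chain m x\<bar> powr q)"
  proof (rule integrableI_nonneg[OF me])
    show "(\<integral>\<^sup>+x. ennreal (\<bar>ext_chain m x\<bar> powr q) \<partial>lebesgue) < \<infinity>"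
      by (rule le_less_trans[OF bound]) simp
  qed simp
  have "ennreal (LINT x|lebesgue. \<bar>ext_chain m x\<bar> powr q) \<le> ennreal (N + D * ((4 * real m + 1) * N))"
    using bound nn_integral_eq_integral[OF eint] by simp
  then have le: "(LINT x|lebesgue. \<bar>ext_chain m x\<bar> powr q) \<le> N + D * ((4 * real m + 1) * N)"
    using N0 D0 by (subst (asm) ennreal_le_iff) auto
  \<comment> \<open>The contributions of E and of the gaps are absorbed into a q-th power: L enters
    to the power q-1 and \<open>4 * real m + 2\<close> to the power 1, and both bases are at least
    1.\<close>
  also have "\<dots> \<le> norm_const m powr q * N"
  proof -
    define \<gamma> where "\<gamma> = max (gap_const m) 1"
    have \<gamma>: "\<gamma> \<ge> 1" "\<gamma> \<ge> gap_const m" by (auto simp: \<gamma>_def)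
    have "D \<le> \<gamma> powr q * L powr q"
      unfolding D_def using \<gamma> L q gap_const_pos by (intro mult_mono powr_mono2 powr_mono) auto
    moreover have "1 * 1 \<le> \<gamma> powr q * L powr q" using \<gamma> L q by (intro mult_mono ge_one_powr_ge_zero) auto
    ultimately have "1 + D * (4 * real m + 1) \<le> \<gamma> powr q * L powr q + \<gamma> powr q * L powr q * (4 * real m + 1)"
      by (intro add_mono mult_right_mono) auto
    also have "\<dots> = \<gamma> powr q * L powr q * (4 * real m + 2)" by (simp add: algebra_simps)
    also have "\<dots> \<le> \<gamma> powr q * L powr q * (4 * real m + 2) powr q"
      using q powr_mono[of 1 q "4 * real m + 2"] by (intro mult_left_mono) auto
    also have "\<dots> = norm_const m powr q" by (simp add: norm_const_def \<gamma>_def L_def powr_mult)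
    finally have "(1 + D * (4 * real m + 1)) * N \<le> norm_const m powr q * N" using N0 by (intro mult_right_mono)
    then show ?thesis by (simp add: algebra_simps)
  qed
  finally have "(LINT x|lebesgue. \<bar>ext_chain m x\<bar> powr q) powr (1 / q) \<le> (norm_const m powr q * N) powr (1 / q)"
    using q by (intro powr_mono2) auto
  also have "\<dots> = norm_const m * N powr (1 / q)"
    using q norm_const_ge_1[of m] by (simp add: powr_mult powr_powr)
  finally have "Lp_norm (ereal q) (ext_chain m) \<le> norm_const m * Lp_norm (ereal q) (\<Phi> m)"
    by (simp add: Lp_norm_def N_def w_def)
  then show ?thesis using meas eint by (simp add: Lp_space_def)
qed

lemma ext_chain_Lp:
  assumes "p > 1" "\<Phi> m \<in> Lp_space p"
  shows "ext_chain m \<in> Lp_space p" "Lp_norm p (ext_chain m) \<le> norm_const m * Lp_norm p (\<Phi> m)"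
  using assms ext_chain_Lp_infinity ext_chain_Lp_real by (cases p; auto)+

lemma extension_in_sobolev:
  assumes p: "p > 1" and g: "\<Phi> m \<in> Lp_space p"
  shows "extension m E a f \<in> sobolev m p"
    "sobolev_seminorm m p (extension m E a f) \<le> norm_const m * Lp_norm p (\<Phi> m)"
proof -
  note e = ext_chain_Lp[OF p g]
  have chain': "antideriv_chain m ext_chain"
    by (rule ext_chain_chain[OF Lp_locally_integrable[OF p e(1)]])
  show s: "extension m E a f \<in> sobolev m p"
    using chain_imp_sobolev[OF m chain' p e(1)] by (simp add: ext_chain_0)
  have "is_weak_deriv m (extension m E a f) (ext_chain m)"
    using chain_imp_weak_deriv[OF chain'] by (simp add: ext_chain_0)
  then show "sobolev_seminorm m p (extension m E a f) \<le> norm_const m * Lp_norm p (\<Phi> m)"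
    using sobolev_seminorm_eq[OF m s] e(2) by simp
qed

end

section \<open>Linearity\<close>

context knot_system begin

text \<open>\<open>Lim\<close> is linear only where the limits exist and the filter is nontrivial.
  Existence is the well-definedness for f and g; a condition on derivatives occurs only at a limit
  point of E, which gives nontriviality.\<close>

lemma jet_limit_linear:
  assumes f: "extension_well_defined m E a f" and g: "extension_well_defined m E a g"
    and x: "x \<in> E" and i: "i \<in> {1..m - card (knots m E a x)}"
  shows "jet_limit m E (\<lambda>x. c * f x + d * g x) i (last_knot m E a x) =
    c * jet_limit m E f i (last_knot m E a x) + d * jet_limit m E g i (last_knot m E a x)"
proof -
  let ?s = "last_knot m E a x"
  have lt: "card (knots m E a x) < m" using i by auto
  have nt: "sets_to m E ?s \<noteq> bot" by (rule sets_to_nontrivial[OF knots_props(6)[OF x lt]])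
  let ?l = "\<lambda>f S. poly_deriv i (lagrange S f) ?s"
  obtain lf where lf: "(?l f \<longlongrightarrow> lf) (sets_to m E ?s)"
    using f x i lt unfolding extension_well_defined_def Let_def by blast
  obtain lg where lg: "(?l g \<longlongrightarrow> lg) (sets_to m E ?s)"
    using g x i lt unfolding extension_well_defined_def Let_def by blast
  have "((\<lambda>S. c * ?l f S + d * ?l g S) \<longlongrightarrow> c * lf + d * lg) (sets_to m E ?s)"
    by (intro tendsto_intros lf lg)
  moreover have "\<forall>\<^sub>F S in sets_to m E ?s. c * ?l f S + d * ?l g S = ?l (\<lambda>x. c * f x + d * g x) S"
    unfolding eventually_sets_to
  proof (intro exI[of _ 1] conjI allI impI)
    fix S assume "S \<subseteq> E \<and> finite S \<and> card S = m \<and> diameter (S \<union> {?s}) < 1"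
    then have S: "finite S" "S \<noteq> {}" using m by auto
    show "c * ?l f S + d * ?l g S = ?l (\<lambda>x. c * f x + d * g x) S"
      by (simp add: lagrange_linear[OF S] higher_pderiv_add higher_pderiv_smult)
  qed simp
  ultimately have lfg: "(?l (\<lambda>x. c * f x + d * g x) \<longlongrightarrow> c * lf + d * lg) (sets_to m E ?s)"
    by (rule Lim_transform_eventually)
  show ?thesis
    unfolding jet_limit_def tendsto_Lim[OF nt lfg] tendsto_Lim[OF nt lf] tendsto_Lim[OF nt lg] ..
qed

text \<open>Interpolation conditions are linear in the data and determine the jet.\<close>

lemma jet_poly_linear:
  assumes f: "extension_well_defined m E a f" and g: "extension_well_defined m E a g" and x: "x \<in> E"
  shows "jet_poly m E a (\<lambda>x. c * f x + d * g x) x = smult c (jet_poly m E a f x) + smult d (jet_poly m E a g x)"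
proof (rule is_jet_unique[OF x jet_poly_is_jet[OF x]])
  show "is_jet (\<lambda>x. c * f x + d * g x)
      (\<lambda>i. jet_limit m E (\<lambda>x. c * f x + d * g x) i (last_knot m E a x)) x
      (smult c (jet_poly m E a f x) + smult d (jet_poly m E a g x))"
    using jet_poly_is_jet[OF x, of f] jet_poly_is_jet[OF x, of g] jet_limit_linear[OF f g x]
    unfolding is_jet_def
    by (auto simp: higher_pderiv_add higher_pderiv_smult
        intro!: degree_add_le intro: order_trans[OF degree_smult_le])
qed

lemma hermite_linear:
  assumes "u < v" "Q u = smult c (Q1 u) + smult d (Q2 u)" "Q v = smult c (Q1 v) + smult d (Q2 v)"
  shows "hermite m Q u v = smult c (hermite m Q1 u v) + smult d (hermite m Q2 u v)"
proof (rule hermite_props(4)[OF m assms(1)])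
  show "degree (smult c (hermite m Q1 u v) + smult d (hermite m Q2 u v)) \<le> 2 * m - 1"
    by (intro degree_add_le order_trans[OF degree_smult_le] hermite_props(1)[OF m assms(1)])
qed (simp_all add: higher_pderiv_add higher_pderiv_smult assms hermite_props(2,3)[OF m assms(1)])

end

text \<open>The chains of f and g are unrelated; they enter only through
  \<open>well_defined\<close>, after which uniqueness of interpolation gives linearity on each
  component.\<close>

lemma extension_linear:
  assumes "extension_setting m E a \<Phi> f" "extension_setting m E a \<Psi> g"
  shows "extension m E a (\<lambda>x. c * f x + d * g x) x = c * extension m E a f x + d * extension m E a g x"
proof -
  interpret F: extension_setting m E a \<Phi> f by fact
  interpret G: extension_setting m E a \<Psi> g by fact
  let ?P = "jet_poly m E a"
  have lin: "?P (\<lambda>x. c * f x + d * g x) y = smult c (?P f y) + smult d (?P g y)" if "y \<in> E" for y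
    by (rule F.jet_poly_linear[OF F.well_defined G.well_defined that])
  show ?thesis
  proof (cases "x \<in> E")
    case True
    then show ?thesis by (simp add: extension_def lin)
  next
    case False
    let ?J = "connected_component_set (- E) x"
    have "gap_poly m (?P (\<lambda>x. c * f x + d * g x)) ?J =
      smult c (gap_poly m (?P f) ?J) + smult d (gap_poly m (?P g) ?J)"
      using False
    proof (cases rule: F.outside_cases)
      case (gap u v)
      then have uv: "u \<in> E" "v \<in> E" "u < v" by (auto simp: F.gap_def)
      have "?J = {u<..<v}" by (rule F.component_gap[OF gap])
      then show ?thesis
        using F.hermite_linear[OF uv(3), of "?P (\<lambda>x. c * f x + d * g x)" c "?P f" d "?P g"] lin uv
        by (simp add: F.gap_poly_gap)
    next
      case (below v)
      then show ?thesis using lin F.component_below[OF below] by (simp add: F.gap_poly_below)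
    next
      case (above u)
      then show ?thesis using lin F.component_above[OF above] by (simp add: F.gap_poly_above)
    qed
    then show ?thesis using False by (simp add: extension_def)
  qed
qed

section \<open>From one extension F to the infimum over all extensions\<close>

lemma trace_extension_setting:
  assumes ks: "knot_system m E a" and F: "F \<in> sobolev m p" "\<And>x. x \<in> E \<Longrightarrow> F x = f x"
    and g: "is_weak_deriv m F g"
  shows "extension_setting m E a (\<lambda>i. if i < m then (deriv ^^ i) F else g) f"
proof -
  interpret knot_system m E a by fact
  show ?thesis
    by unfold_locales (use sobolev_imp_chain[OF m F(1) g] F(2) m in auto)
qed

theorem mainTheorem4:
  fixes m :: nat
  assumes "m \<ge> 1"
  shows "\<exists>C :: real. \<forall>(E :: real set) (a :: real set \<Rightarrow> real) (p :: ereal).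
    closed E \<longrightarrow> infinite E \<or> card E \<ge> m + 1 \<longrightarrow> knot_choice E a \<longrightarrow> 1 < p \<longrightarrow>
    (\<forall>f\<in>trace_space m p E. extension_well_defined m E a f) \<and>
    (\<forall>f\<in>trace_space m p E. extension m E a f \<in> sobolev m p) \<and>
    (\<forall>f\<in>trace_space m p E. \<forall>g\<in>trace_space m p E. \<forall>c d :: real.
       extension m E a (\<lambda>x. c * f x + d * g x) =
       (\<lambda>x. c * extension m E a f x + d * extension m E a g x)) \<and>
    (\<forall>f\<in>trace_space m p E.
       (\<forall>x\<in>E. extension m E a f x = f x) \<and>
       sobolev_seminorm m p (extension m E a f) \<le> C * trace_seminorm m p E f)"
proof (intro exI[of _ "norm_const m"] allI impI)
  fix E :: "real set" and a :: "real set \<Rightarrow> real" and p :: ereal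
  assume "closed E" "infinite E \<or> card E \<ge> m + 1" "knot_choice E a" and p: "1 < p"
  then have ks: "knot_system m E a" using assms by unfold_locales auto
  \<comment> \<open>The representative in \<open>L_p\<close> given by membership is used for the
    chain; by \<open>sobolev_seminorm_eq\<close> the arbitrary choice in the seminorm has the same
    norm.\<close>
  have chain_of: "\<exists>\<Phi>. extension_setting m E a \<Phi> f \<and> \<Phi> m \<in> Lp_space p \<and>
      sobolev_seminorm m p F = Lp_norm p (\<Phi> m)"
    if F: "F \<in> sobolev m p" "\<And>x. x \<in> E \<Longrightarrow> F x = f x" for f F
  proof -
    obtain g where g: "g \<in> Lp_space p" "is_weak_deriv m F g"
      using F(1) unfolding sobolev_def by blast
    show ?thesis
      using trace_extension_setting[OF ks F g(2)] g(1) sobolev_seminorm_eq[OF assms F(1) g(2)]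
      by (intro exI[of _ "\<lambda>i. if i < m then (deriv ^^ i) F else g"]) simp
  qed
  have tr: "\<exists>\<Phi>. extension_setting m E a \<Phi> f \<and> \<Phi> m \<in> Lp_space p" if "f \<in> trace_space m p E" for f
    using that chain_of[of _ f] unfolding trace_space_def by blast
  show "(\<forall>f\<in>trace_space m p E. extension_well_defined m E a f) \<and>
    (\<forall>f\<in>trace_space m p E. extension m E a f \<in> sobolev m p) \<and>
    (\<forall>f\<in>trace_space m p E. \<forall>g\<in>trace_space m p E. \<forall>c d :: real.
       extension m E a (\<lambda>x. c * f x + d * g x) =
       (\<lambda>x. c * extension m E a f x + d * extension m E a g x)) \<and>
    (\<forall>f\<in>trace_space m p E.
       (\<forall>x\<in>E. extension m E a f x = f x) \<and>
       sobolev_seminorm m p (extension m E a f) \<le> norm_const m * trace_seminorm m p E f)"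
  proof (intro conjI ballI allI)
    fix f assume f: "f \<in> trace_space m p E"
    obtain \<Phi> where \<Phi>: "extension_setting m E a \<Phi> f" "\<Phi> m \<in> Lp_space p" using tr[OF f] by blast
    show "extension_well_defined m E a f" by (rule extension_setting.well_defined[OF \<Phi>(1)])
    show "extension m E a f \<in> sobolev m p" by (rule extension_setting.extension_in_sobolev(1)[OF \<Phi>(1) p \<Phi>(2)])
    show "extension m E a f x = f x" if "x \<in> E" for x
      by (rule extension_setting.extension_on_E[OF \<Phi>(1) that])
    show "extension m E a (\<lambda>x. c * f x + d * g x) = (\<lambda>x. c * extension m E a f x + d * extension m E a g x)"
      if g: "g \<in> trace_space m p E" for g c d
    proof -
      obtain \<Psi> where \<Psi>: "extension_setting m E a \<Psi> g" using tr[OF g] by blast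
      show ?thesis by (rule ext) (rule extension_linear[OF \<Phi>(1) \<Psi>])
    qed
    have K: "norm_const m > 0" using norm_const_ge_1[of m] by simp
    \<comment> \<open>Dividing by the constant turns the claim into a lower bound for an infimum,
      which is checked on each F separately; every F contributes its own chain, while the left side
      is the same for all.\<close>
    have "sobolev_seminorm m p (extension m E a f) / norm_const m \<le> trace_seminorm m p E f"
      unfolding trace_seminorm_def
    proof (rule cINF_greatest)
      show "{F \<in> sobolev m p. \<forall>x\<in>E. F x = f x} \<noteq> {}" using f unfolding trace_space_def by blast
      fix F assume "F \<in> {F \<in> sobolev m p. \<forall>x\<in>E. F x = f x}"
      then have F: "F \<in> sobolev m p" "\<And>x. x \<in> E \<Longrightarrow> F x = f x" by auto
      obtain \<Psi> where \<Psi>: "extension_setting m E a \<Psi> f" "\<Psi> m \<in> Lp_space p"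
        "sobolev_seminorm m p F = Lp_norm p (\<Psi> m)" using chain_of[OF F] by blast
      show "sobolev_seminorm m p (extension m E a f) / norm_const m \<le> sobolev_seminorm m p F"
        using extension_setting.extension_in_sobolev(2)[OF \<Psi>(1) p \<Psi>(2)] \<Psi>(3) K
        by (simp add: divide_le_eq mult.commute)
    qed
    then show "sobolev_seminorm m p (extension m E a f) \<le> norm_const m * trace_seminorm m p E f"
      using K by (simp add: divide_le_eq mult.commute)
  qed
qed

end
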